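(* Let $x_1,\dots,x_n\in\mathbb R^d$ and let $p\ge0$ be the smallest integer such that $\mathrm{rank}\,V_{\le p}=n$, where $V_{\le p}=(V_0\ \cdots\ V_p)$ is the multivariate Vandermonde matrix. Let $k$ be a positive definite kernel function on $\mathbb R^d$ such that either (a) $k(x,y)=\psi(\|x-y\|)$ is radial with $\psi$ analytic at $0$ and regularity index $r\ge p+1$ ($r=\infty$ allowed), or (b) $k\in\mathcal C^{p+1,p+1}$ and $K(\varepsilon)=[k(\varepsilon x_i,\varepsilon x_j)]_{i,j=1}^n$ is analytic in $\varepsilon$ near $0$. Let $j\le p$ be such that $V_{\le j}$ has full column rank. Then: 1. The number of eigenvalues of $K(\varepsilon)$ in the $j$-th block (of order $\varepsilon^{2j}$) is exactly $\mathcal H_{j,d}=\binom{j+d-1}{d-1}$, the number of monomials of degree $j$. 2. The Schur complement $S_j$ admits the simplified expression $S_0=R_{0,0}W_{0,0}R_{0,0}^T$ and, for $j>0$, $$S_j=R_{j,j}\left(W_{j,j}-W_{j,<j}(W_{<j,<j})^{-1}W_{<j,j}\right)R_{j,j}^T ;$$ therefore the leading coefficients of these eigenvalues are given by the eigenvalues of $S_j$, and the limiting eigenvectors (in the sense of the asymptotic spectral equivalent, of which the following is the coefficient of $\varepsilon^{2j}$) are given by the eigenvectors of $$Q_jS_jQ_j^T=\begin{cases}V_0W_{0,0}V_0^T,& j=0,\\ Q_jQ_j^TV_j\left(W_{j,j}-W_{j,<j}(W_{<j,<j})^{-1}W_{<j,j}\right)V_j^TQ_jQ_j^T,& j>0.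\end{cases}$$
   Context: Vandermonde matrices: for $\alpha\in\mathbb N^d$, $x^\alpha=\prod x_i^{\alpha_i}$, $|\alpha|=\sum\alpha_i$, $\alpha!=\prod\alpha_i!$. $V_s=[x_i^{\alpha}]_{1\le i\le n,\,|\alpha|=s}$, $V_{\le s}=(V_0\ \cdots\ V_s)$, with a fixed ordering of the monomials of each degree; $\mathrm{rank}\,V_{\le -1}=0$. Kernels: a positive definite kernel is a symmetric function $k:\mathbb R^d\times\mathbb R^d\to\mathbb R$ whose kernel matrices at finitely many distinct points are positive definite. For a radial kernel with $\psi(s)=\sum_m\psi_ms^m$, the regularity index $r$ is the integer with $\psi_{2r-1}\ne0$ and $\psi_{2c-1}=0$ for all $1\le c<r$ ($r=\infty$ if all odd coefficients vanish); $K(\varepsilon)=[\psi(\varepsilon\|x_i-x_j\|)]$ is regarded as analytic in $\varepsilon$ via the power series of $\psi$. $k\in\mathcal C^{q,q}$ means that all $\partial_x^{\alpha}\partial_y^{\beta}k$ with $|\alpha|,|\beta|\le q$ exist and are continuous near $(0,0)$. Wronskian: $W_{i,l}=\left[\frac{1}{\alpha!\beta!}\partial_x^\alpha\partial_y^\beta k(x,y)|_{x=y=0}\right]_{|\alpha|=i,|\beta|=l}$ (ordering of multi-indices as in $V_i,V_l$), $W_{\le q,\le q}=(W_{i,l})_{i,l=0}^q$, $W_{<j,<j}=W_{\le j-1,\le j-1}$, $W_{j,<j}=(W_{j,0}\cdots W_{j,j-1})$, $W_{<j,j}=W_{j,<j}^T$. Block QR: with $b_i=\mathrm{rank}\,V_{\le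 i}-\mathrm{rank}\,V_{\le i-1}$, $V_{\le p}=QR$ with $Q=(Q_0\cdots Q_p)$ orthogonal, $Q_i\in\mathbb R^{n\times b_i}$, $R$ block upper triangular with blocks $R_{i,l}\in\mathbb R^{b_i\times\mathcal H_{l,d}}$. Schur complements: $S_j$ is the $j$-th Schur complement of $H=(H_{i,l})_{i,l=0}^p$, $H_{i,l}=R_{i,i}W_{i,l}R_{l,l}^T$, i.e. $S_0=H_{0,0}$, $S_j=H_{j,j}-H_{j,<j}(H_{<j,<j})^{-1}H_{<j,j}$ with the same block notation as for $W$. Spectral asymptotics: for a real symmetric $K(\varepsilon)$ analytic near $0$, take analytic eigenvalues $\lambda_k(\varepsilon)$ and analytic orthonormal eigenvectors $u_k(\varepsilon)$ (Rellich). If $\lambda_k\not\equiv0$, write $\lambda_k=\varepsilon^{a}(\tilde\lambda_k+O(\varepsilon))$, $\tilde\lambda_k\ne0$: $\lambda_k$ is "of order $\varepsilon^{a}$", $\tilde\lambda_k$ is its leading coefficient, $\mathrm{lt}(\lambda_k)=\tilde\lambda_k\varepsilon^a$, and $u_k(0)$ is the limiting eigenvector; if $\lambda_k\equiv0$, $\mathrm{lt}(\lambda_k)=0$. The asymptotic spectral equivalent is $\underline K(\varepsilon)=\sum_k\mathrm{lt}(\lambda_k)(\varepsilon)\,u_k(0)u_k(0)^T$. "Given by the eigenvectors" means that the limiting eigenvectors of the group are eigenvectors of the stated matrix for its nonzero eigenvalues (individually determined when these are simple).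
   Formalization: Invertibility of W_{<j,<j}, whose inverse occurs in the claim, is assumed; the count of eigenvalues of exact order ε^{2j} in item 1 is claimed only when W_{≤j,≤j} is invertible. Without these the claim can fail: d=1, k=exp(xy)−xy, three points, j=1. *)

theory Defs
  imports
    "HOL-Analysis.Analysis"
    "HOL-Library.Landau_Symbols"
    "HOL-Library.Extended_Nat"
    "Jordan_Normal_Form.Char_Poly"
    "Jordan_Normal_Form.Gauss_Jordan_Elimination"
    "Jordan_Normal_Form.DL_Rank"
begin

text \<open>In this theory \<open>vec\<close> and \<open>mat\<close> are those of Jordan_Normal_Form; the points live in
  \<open>real ^ 'd\<close>, whose component function is written \<open>vec_nth\<close>, so that \<open>$\<close> is free for matrix
  vectors.\<close>

unbundle no vec_syntax

subsection \<open>Block matrices\<close>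

text \<open>\<open>block_row nr B q\<close> is $(B_0 \cdots B_{q-1})$ with \<open>nr\<close> rows, and
  \<open>block_mat rd cd B q\<close> is $(B_{i,l})_{i,l=0}^{q-1}$, where $B_{i,l}$ is of size
  \<open>rd i\<close> by \<open>cd l\<close>.\<close>

primrec block_row :: "nat \<Rightarrow> (nat \<Rightarrow> real mat) \<Rightarrow> nat \<Rightarrow> real mat" where
  "block_row nr B 0 = 0\<^sub>m nr 0"
| "block_row nr B (Suc q) =
     four_block_mat (block_row nr B q) (B q)
       (0\<^sub>m 0 (dim_col (block_row nr B q))) (0\<^sub>m 0 (dim_col (B q)))"

primrec block_col :: "nat \<Rightarrow> (nat \<Rightarrow> real mat) \<Rightarrow> nat \<Rightarrow> real mat" where
  "block_col nc B 0 = 0\<^sub>m 0 nc"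
| "block_col nc B (Suc q) = block_col nc B q @\<^sub>r B q"

definition block_mat ::
  "(nat \<Rightarrow> nat) \<Rightarrow> (nat \<Rightarrow> nat) \<Rightarrow> (nat \<Rightarrow> nat \<Rightarrow> real mat) \<Rightarrow> nat \<Rightarrow> real mat" where
  "block_mat rd cd B q = block_col (\<Sum>l<q. cd l) (\<lambda>i. block_row (rd i) (B i) q) q"

text \<open>Only meaningful for invertible arguments.\<close>

definition inv_mat :: "real mat \<Rightarrow> real mat" where
  "inv_mat A = the (mat_inverse A)"

text \<open>The Schur complement of a block matrix with square diagonal blocks of size \<open>dm i\<close>. As for
  the Wronskian blocks, the block column $B_{<j,j}$ is by convention the transpose of $B_{j,<j}$;
  it is only applied to symmetric block matrices.\<close>

definition schur_complement ::
  "(nat \<Rightarrow> nat) \<Rightarrow> (nat \<Rightarrow> nat \<Rightarrow> real mat) \<Rightarrow> nat \<Rightarrow> real mat" where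
  "schur_complement dm B j =
     (if j = 0 then B 0 0
      else B j j - block_row (dm j) (B j) j * inv_mat (block_mat dm dm B j)
                     * transpose_mat (block_row (dm j) (B j) j))"

definition pos_def_mat :: "real mat \<Rightarrow> bool" where
  "pos_def_mat A \<longleftrightarrow> square_mat A \<and> transpose_mat A = A \<and>
     (\<forall>v \<in> carrier_vec (dim_row A). v \<noteq> 0\<^sub>v (dim_row A) \<longrightarrow> v \<bullet> (A *\<^sub>v v) > 0)"

subsection \<open>Multi-indices and Vandermonde matrices\<close>

definition mi_degree :: "('d::finite \<Rightarrow> nat) \<Rightarrow> nat" where
  "mi_degree \<alpha> = (\<Sum>i\<in>UNIV. \<alpha> i)"

definition mi_fact :: "('d::finite \<Rightarrow> nat) \<Rightarrow> real" where
  "mi_fact \<alpha> = (\<Prod>i\<in>UNIV. fact (\<alpha> i))"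

definition monomial :: "real ^ 'd \<Rightarrow> ('d::finite \<Rightarrow> nat) \<Rightarrow> real" where
  "monomial x \<alpha> = (\<Prod>i\<in>UNIV. vec_nth x i ^ \<alpha> i)"

text \<open>\<open>mi s\<close> lists the multi-indices of degree \<open>s\<close> in the chosen order.\<close>

definition monomial_ordering :: "(nat \<Rightarrow> ('d::finite \<Rightarrow> nat) list) \<Rightarrow> bool" where
  "monomial_ordering mi \<longleftrightarrow> (\<forall>s. distinct (mi s) \<and> set (mi s) = {\<alpha>. mi_degree \<alpha> = s})"

definition vandermonde ::
  "(nat \<Rightarrow> ('d::finite \<Rightarrow> nat) list) \<Rightarrow> nat \<Rightarrow> (nat \<Rightarrow> real ^ 'd) \<Rightarrow> nat \<Rightarrow> real mat" where
  "vandermonde mi n x s = mat n (length (mi s)) (\<lambda>(i, c). monomial (x i) (mi s ! c))"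

subsection \<open>Kernels\<close>

definition pos_def_kernel :: "(real ^ 'd \<Rightarrow> real ^ 'd \<Rightarrow> real) \<Rightarrow> bool" where
  "pos_def_kernel k \<longleftrightarrow> (\<forall>x y. k x y = k y x) \<and>
     (\<forall>m (z :: nat \<Rightarrow> real ^ 'd). inj_on z {..<m} \<longrightarrow>
        pos_def_mat (mat m m (\<lambda>(i, l). k (z i) (z l))))"

text \<open>First-order partial derivatives of a function of two vectors: direction \<open>Inl i\<close> is the
  \<open>i\<close>-th coordinate of the first argument, \<open>Inr i\<close> that of the second.\<close>

definition partial_slice ::
  "'d + 'd \<Rightarrow> (real ^ 'd \<Rightarrow> real ^ 'd \<Rightarrow> real) \<Rightarrow> real ^ 'd \<Rightarrow> real ^ 'd \<Rightarrow> real \<Rightarrow> real" where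
  "partial_slice v k x y t =
     (case v of Inl i \<Rightarrow> k (x + t *\<^sub>R axis i 1) y | Inr i \<Rightarrow> k x (y + t *\<^sub>R axis i 1))"

primrec iter_partial ::
  "('d::finite + 'd) list \<Rightarrow> (real ^ 'd \<Rightarrow> real ^ 'd \<Rightarrow> real) \<Rightarrow> real ^ 'd \<Rightarrow> real ^ 'd \<Rightarrow> real" where
  "iter_partial [] k = k"
| "iter_partial (v # vs) k = (\<lambda>x y. deriv (partial_slice v (iter_partial vs k) x y) 0)"

definition mi_directions :: "('d::{finite,linorder} \<Rightarrow> nat) \<Rightarrow> 'd list" where
  "mi_directions \<alpha> = concat (map (\<lambda>i. replicate (\<alpha> i) i) (sorted_list_of_set UNIV))"

text \<open>$\partial_x^\alpha \partial_y^\beta k$; the linear order of the coordinates only serves to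
  fix the order in which the derivatives are taken.\<close>

definition mixed_partial ::
  "('d::{finite,linorder} \<Rightarrow> nat) \<Rightarrow> ('d \<Rightarrow> nat) \<Rightarrow> (real ^ 'd::{finite,linorder} \<Rightarrow> real ^ 'd::{finite,linorder} \<Rightarrow> real) \<Rightarrow>
   real ^ 'd::{finite,linorder} \<Rightarrow> real ^ 'd::{finite,linorder} \<Rightarrow> real" where
  "mixed_partial \<alpha> \<beta> k =
     iter_partial (map Inl (mi_directions \<alpha>) @ map Inr (mi_directions \<beta>)) k"

text \<open>$k \in \mathcal{C}^{q,q}$ near the origin: all iterated partial derivatives, in any order, of
  order at most \<open>q\<close> in each of the two arguments exist and are continuous.\<close>

definition Cqq_near_0 :: "nat \<Rightarrow> (real ^ 'd::finite \<Rightarrow> real ^ 'd \<Rightarrow> real) \<Rightarrow> bool" where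
  "Cqq_near_0 q k \<longleftrightarrow> (\<exists>U. open U \<and> (0, 0) \<in> U \<and>
     (\<forall>vs. length (filter isl vs) \<le> q \<and> length (filter (\<lambda>v. \<not> isl v) vs) \<le> q \<longrightarrow>
        continuous_on U (\<lambda>(x, y). iter_partial vs k x y) \<and>
        (\<forall>v ws. vs = v # ws \<longrightarrow>
           (\<forall>(x, y) \<in> U. partial_slice v (iter_partial ws k) x y field_differentiable at 0))))"

definition wronskian ::
  "(nat \<Rightarrow> ('d::{finite,linorder} \<Rightarrow> nat) list) \<Rightarrow> (real ^ 'd::{finite,linorder} \<Rightarrow> real ^ 'd::{finite,linorder} \<Rightarrow> real) \<Rightarrow>
   nat \<Rightarrow> nat \<Rightarrow> real mat" where
  "wronskian mi k i l = mat (length (mi i)) (length (mi l))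
     (\<lambda>(a, c). mixed_partial (mi i ! a) (mi l ! c) k 0 0 / (mi_fact (mi i ! a) * mi_fact (mi l ! c)))"

subsection \<open>Analytic functions of one real variable near 0\<close>

definition has_power_series_0 :: "(real \<Rightarrow> real) \<Rightarrow> (nat \<Rightarrow> real) \<Rightarrow> bool" where
  "has_power_series_0 f a \<longleftrightarrow> (\<exists>\<rho>>0. \<forall>t. \<bar>t\<bar> < \<rho> \<longrightarrow> (\<lambda>m. a m * t ^ m) sums f t)"

definition analytic_0 :: "(real \<Rightarrow> real) \<Rightarrow> bool" where
  "analytic_0 f \<longleftrightarrow> (\<exists>a. has_power_series_0 f a)"

definition regularity_index :: "(nat \<Rightarrow> real) \<Rightarrow> enat \<Rightarrow> bool" where
  "regularity_index a r \<longleftrightarrow>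
     (case r of
        enat m \<Rightarrow> 1 \<le> m \<and> a (2 * m - 1) \<noteq> 0 \<and> (\<forall>c. 1 \<le> c \<and> c < m \<longrightarrow> a (2 * c - 1) = 0)
      | \<infinity> \<Rightarrow> (\<forall>c\<ge>1. a (2 * c - 1) = 0))"

text \<open>\<open>K\<close> is the scaled kernel matrix of \<open>k\<close>, and one of the two smoothness assumptions holds. In the
  radial case \<open>\<psi>\<close> is given by its power series on both sides of \<open>0\<close>, so \<open>K \<epsilon>\<close> is the analytic
  continuation of the kernel matrix to negative \<open>\<epsilon>\<close> (which differs from \<open>k (\<epsilon> x\<^sub>i) (\<epsilon> x\<^sub>l)\<close> there
  when \<open>\<psi>\<close> has odd terms).\<close>

definition radial_kernel_matrix ::
  "enat \<Rightarrow> (real ^ 'd \<Rightarrow> real ^ 'd \<Rightarrow> real) \<Rightarrow> nat \<Rightarrow> (nat \<Rightarrow> real ^ 'd::finite) \<Rightarrow>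
   (real \<Rightarrow> real mat) \<Rightarrow> bool" where
  "radial_kernel_matrix r k n x K \<longleftrightarrow>
     (\<exists>\<psi> a. (\<forall>y z. k y z = \<psi> (norm (y - z))) \<and> has_power_series_0 \<psi> a \<and> regularity_index a r \<and>
        K = (\<lambda>\<epsilon>. mat n n (\<lambda>(i, l). \<psi> (\<epsilon> * norm (x i - x l)))))"

definition smooth_kernel_matrix ::
  "nat \<Rightarrow> (real ^ 'd \<Rightarrow> real ^ 'd \<Rightarrow> real) \<Rightarrow> nat \<Rightarrow> (nat \<Rightarrow> real ^ 'd::finite) \<Rightarrow>
   (real \<Rightarrow> real mat) \<Rightarrow> bool" where
  "smooth_kernel_matrix q k n x K \<longleftrightarrow>
     Cqq_near_0 q k \<and> K = (\<lambda>\<epsilon>. mat n n (\<lambda>(i, l). k (\<epsilon> *\<^sub>R x i) (\<epsilon> *\<^sub>R x l))) \<and>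
     (\<forall>i<n. \<forall>l<n. analytic_0 (\<lambda>\<epsilon>. K \<epsilon> $$ (i, l)))"

subsection \<open>Block QR factorisation\<close>

definition block_QR ::
  "nat \<Rightarrow> nat \<Rightarrow> (nat \<Rightarrow> nat) \<Rightarrow> (nat \<Rightarrow> nat) \<Rightarrow> (nat \<Rightarrow> real mat) \<Rightarrow>
   (nat \<Rightarrow> real mat) \<Rightarrow> (nat \<Rightarrow> nat \<Rightarrow> real mat) \<Rightarrow> bool" where
  "block_QR n p h b V Q R \<longleftrightarrow>
     (\<forall>i\<le>p. Q i \<in> carrier_mat n (b i)) \<and>
     (\<forall>i\<le>p. \<forall>l\<le>p. R i l \<in> carrier_mat (b i) (h l)) \<and>
     (\<forall>i\<le>p. \<forall>l<i. R i l = 0\<^sub>m (b i) (h l)) \<and>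
     block_row n Q (Suc p) \<in> carrier_mat n n \<and>
     transpose_mat (block_row n Q (Suc p)) * block_row n Q (Suc p) = 1\<^sub>m n \<and>
     block_row n V (Suc p) = block_row n Q (Suc p) * block_mat b h R (Suc p)"

subsection \<open>Spectral asymptotics\<close>

text \<open>Analytic eigenvalues and orthonormal eigenvectors of \<open>K\<close> in a neighbourhood of \<open>0\<close>, as
  provided by Rellich's theorem.\<close>

definition analytic_eigensystem ::
  "nat \<Rightarrow> (real \<Rightarrow> real mat) \<Rightarrow> (nat \<Rightarrow> real \<Rightarrow> real) \<Rightarrow> (nat \<Rightarrow> real \<Rightarrow> real vec) \<Rightarrow> bool" where
  "analytic_eigensystem n K ev u \<longleftrightarrow>
     (\<forall>k<n. analytic_0 (ev k) \<and> (\<forall>i<n. analytic_0 (\<lambda>\<epsilon>. u k \<epsilon> $ i))) \<and>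
     (\<forall>\<^sub>F \<epsilon> in nhds 0. \<forall>k<n.
        u k \<epsilon> \<in> carrier_vec n \<and> K \<epsilon> *\<^sub>v u k \<epsilon> = ev k \<epsilon> \<cdot>\<^sub>v u k \<epsilon> \<and>
        (\<forall>l<n. u k \<epsilon> \<bullet> u l \<epsilon> = (if k = l then 1 else 0)))"

definition leading_asymptotic :: "(real \<Rightarrow> real) \<Rightarrow> nat \<Rightarrow> real \<Rightarrow> bool" where
  "leading_asymptotic f a c \<longleftrightarrow>
     c \<noteq> 0 \<and> (\<lambda>\<epsilon>. f \<epsilon> - c * \<epsilon> ^ a) \<in> O[at 0](\<lambda>\<epsilon>. \<epsilon> ^ (a + 1))"

definition of_order :: "(real \<Rightarrow> real) \<Rightarrow> nat \<Rightarrow> bool" where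
  "of_order f a \<longleftrightarrow> (\<exists>c. leading_asymptotic f a c)"

text \<open>The leading term $\mathrm{lt}(f) = c\,\varepsilon^a$ as a polynomial in $\varepsilon$; its
  leading coefficient is $c$.\<close>

definition lead_term :: "(real \<Rightarrow> real) \<Rightarrow> real poly" where
  "lead_term f =
     (if \<forall>\<^sub>F \<epsilon> in nhds 0. f \<epsilon> = 0 then 0
      else (THE q. \<exists>a c. q = Polynomial.monom c a \<and> leading_asymptotic f a c))"

definition spectral_equivalent ::
  "nat \<Rightarrow> (nat \<Rightarrow> real \<Rightarrow> real) \<Rightarrow> (nat \<Rightarrow> real \<Rightarrow> real vec) \<Rightarrow> real poly mat" where
  "spectral_equivalent n ev u = mat n n (\<lambda>(i, l).
     \<Sum>k<n. Polynomial.smult (u k 0 $ i * u k 0 $ l) (lead_term (ev k)))"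

end

theory Submission
  imports Defs "HOL-Combinatorics.Multiset_Permutations"
begin

text \<open>
  Put $M(\varepsilon) = Q^T K(\varepsilon) Q$. The columns of $Q_i$ annihilate the monomials of degree
  below $i$, so the mean value form of Taylor's theorem, applied in each argument separately, gives
  $\varepsilon^{-i-l} M_{i,l}(\varepsilon) \to H_{i,l}$. This only needs $k \in \mathcal{C}^{j,j}$ and
  $\varepsilon > 0$; a radial kernel has this smoothness because $\psi(\|z\|)$ is a polynomial in $\|z\|^2$ up
  to a term of order $2p+1$.

  For $\varepsilon > 0$ all eigenvalues are positive. If $\lambda_k$ has order below $\varepsilon^{2j}$, the
  spectral decomposition bounds $\lambda_k$ times the squared components of degree at least $j$ of
  $v_k = Q^T u_k$ by diagonal entries of $M$, which are $O(\varepsilon^{2j})$, so these components vanish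
  in the limit. Otherwise, after multiplying the components of degree $i < j$ by $\varepsilon^{i-j}$, the
  eigenvalue equation converges to a block system, and eliminating the low degrees leaves
  $S_j y = \mu_k y$ for the limit $y$ of the degree $j$ components. Hence
  $Q_j S_j Q_j^T u_k(0) = \mu_k u_k(0)$ for every $k$, where $\mu_k$ is the leading coefficient of
  $\lambda_k$ if its order is $\varepsilon^{2j}$, and $0$ otherwise.
\<close>

subsection \<open>Functions with continuous partial derivatives\<close>

text \<open>In the radial case odd powers of the norm are the obstacle: a term of order 2p+1 is
  still 2p times continuously differentiable, which is what p derivatives in each argument amount
  to. Only \<open>W_{<j,<j}\<close> is assumed invertible, so \<open>S_j\<close> may be singular and
  an eigenvalue may have order above eps^(2j). Order 2j and all higher orders are therefore treated
  together, through the limit of lambda_k / eps^(2j). Multiplicities come last and from algebra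
  alone: the u_k(0) are an orthonormal eigenbasis of Q_j S_j Q_j^T, so its characteristic polynomial
  is the product of the X - mu_k, and it also equals X^(n - b_j) times that of
  \<open>S_j\<close>.\<close>

definition line_derivative ::
  "'a::real_normed_vector set \<Rightarrow> ('a \<Rightarrow> real) \<Rightarrow> 'a \<Rightarrow> ('a \<Rightarrow> real) \<Rightarrow> bool" where
  "line_derivative U f a g \<longleftrightarrow>
     (\<forall>z\<in>U. ((\<lambda>t. f (z + t *\<^sub>R a)) has_real_derivative g z) (at 0))"

lemma eventually_on_line:
  fixes z a :: "'a::real_normed_vector"
  assumes "open B" "z \<in> B"
  shows "\<forall>\<^sub>F t in nhds (0::real). z + t *\<^sub>R a \<in> B"
proof -
  have "((\<lambda>t. z + t *\<^sub>R a) \<longlongrightarrow> z + 0 *\<^sub>R a) (nhds (0::real))"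
    by (intro tendsto_intros filterlim_ident)
  then show ?thesis by (rule topological_tendstoD) (use assms in auto)
qed

lemma line_derivative_shift:
  assumes "line_derivative U f a g" "y + s *\<^sub>R a \<in> U"
  shows "((\<lambda>t. f (y + t *\<^sub>R a)) has_real_derivative g (y + s *\<^sub>R a)) (at s)"
proof -
  have "((\<lambda>t. f (y + s *\<^sub>R a + t *\<^sub>R a)) has_real_derivative g (y + s *\<^sub>R a)) (at 0)"
    using assms unfolding line_derivative_def by blast
  then have "((\<lambda>t. f (y + (t + s) *\<^sub>R a)) has_real_derivative g (y + s *\<^sub>R a)) (at 0)"
    by (simp add: scaleR_add_left algebra_simps)
  then show ?thesis
    using DERIV_shift[of "\<lambda>t. f (y + t *\<^sub>R a)" "g (y + s *\<^sub>R a)" 0 s] by simp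
qed

text \<open>Stated for either sign of \<tau>, because the coordinates \<open>inner h b\<close> of an
  increment may be negative.\<close>

lemma mvt_from_0:
  fixes f :: "real \<Rightarrow> real"
  assumes "\<And>s. \<bar>s\<bar> \<le> \<bar>\<tau>\<bar> \<Longrightarrow> (f has_real_derivative f' s) (at s)"
  shows "\<exists>s. \<bar>s\<bar> \<le> \<bar>\<tau>\<bar> \<and> f \<tau> - f 0 = \<tau> * f' s"
proof -
  consider "\<tau> = 0" | "\<tau> > 0" | "\<tau> < 0" by linarith
  then show ?thesis
  proof cases
    case 2
    then obtain z where "0 < z" "z < \<tau>" "f \<tau> - f 0 = (\<tau> - 0) * f' z"
      using MVT2[of 0 \<tau> f f'] assms by force
    then show ?thesis using 2 by (intro exI[of _ z]) auto
  next
    case 3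
    then obtain z where "\<tau> < z" "z < 0" "f 0 - f \<tau> = (0 - \<tau>) * f' z"
      using MVT2[of \<tau> 0 f f'] assms by force
    then show ?thesis using 3 by (intro exI[of _ z]) (auto simp: algebra_simps)
  qed auto
qed

text \<open>The coordinates in \<open>B\<close> are changed one after another. Each change is a mean
  value step whose slope is close to \<open>g b z\<close> by continuity and costs at most
  \<open>e * norm h\<close>; hence the induction over \<open>B\<close> and the factor
  \<open>card B\<close>.\<close>

lemma continuous_partials_increment:
  fixes f :: "'a::euclidean_space \<Rightarrow> real"
  assumes U: "open U" "z \<in> U"
    and D: "\<And>b. b \<in> Basis \<Longrightarrow> line_derivative U f b (g b)"
    and C: "\<And>b. b \<in> Basis \<Longrightarrow> continuous_on U (g b)"
    and e: "(e::real) > 0"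
  shows "finite B \<Longrightarrow> B \<subseteq> Basis \<Longrightarrow> \<exists>\<delta>>0. \<forall>h. norm h < \<delta> \<longrightarrow>
     \<bar>f (z + (\<Sum>b\<in>B. (inner h b) *\<^sub>R b)) - f z - (\<Sum>b\<in>B. (inner h b) * g b z)\<bar> \<le> e * card B * norm h"
proof (induction B rule: finite_induct)
  case empty
  show ?case by (intro exI[of _ 1]) auto
next
  case (insert b B)
  then obtain \<delta>1 where d1: "\<delta>1 > 0" "\<And>h. norm h < \<delta>1 \<Longrightarrow>
     \<bar>f (z + (\<Sum>b\<in>B. (inner h b) *\<^sub>R b)) - f z - (\<Sum>b\<in>B. (inner h b) * g b z)\<bar> \<le> e * card B * norm h"
    by auto
  have b: "b \<in> Basis" and BB: "B \<subseteq> Basis" using insert by auto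
  have "isCont (g b) z"
    using C[OF b] U continuous_on_eq_continuous_at by blast
  then obtain d2 where d2: "d2 > 0" "\<And>y. dist y z < d2 \<Longrightarrow> \<bar>g b y - g b z\<bar> < e"
    using e unfolding continuous_at_eps_delta dist_real_def by blast
  obtain d3 where d3: "d3 > 0" "ball z d3 \<subseteq> U"
    using U open_contains_ball by blast
  \<comment> \<open>After \<open>card B\<close> coordinate changes and part of one more, the point
    is within \<open>N * norm h\<close> of \<open>z\<close>; \<delta> keeps it both in the
    continuity ball of \<open>g b\<close> and in \<open>U\<close>.\<close>
  define N where "N = real (card B) + 1"
  have N: "N > 0" unfolding N_def by simp
  define \<delta> where "\<delta> = min \<delta>1 (min d2 d3 / N)"
  have dpos: "\<delta> > 0" unfolding \<delta>_def using d1 d2 d3 N by simp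
  have "\<bar>f (z + (\<Sum>b\<in>insert b B. (inner h b) *\<^sub>R b)) - f z - (\<Sum>b\<in>insert b B. (inner h b) * g b z)\<bar>
          \<le> e * card (insert b B) * norm h" if h: "norm h < \<delta>" for h
  proof -
    define y where "y = z + (\<Sum>b\<in>B. (inner h b) *\<^sub>R b)"
    have hN: "norm h * N < min d2 d3"
      using h N unfolding \<delta>_def by (simp add: field_simps)
    have "norm (\<Sum>b\<in>B. (inner h b) *\<^sub>R b) \<le> (\<Sum>b\<in>B. norm h)"
      by (rule sum_norm_le) (use BB in \<open>auto simp: Basis_le_norm\<close>)
    then have ny: "norm (y - z) \<le> card B * norm h" unfolding y_def by simp
    have near: "dist (y + s *\<^sub>R b) z < min d2 d3" if s: "\<bar>s\<bar> \<le> \<bar>inner h b\<bar>" for s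
    proof -
      have "dist (y + s *\<^sub>R b) z = norm ((y - z) + s *\<^sub>R b)"
        by (simp add: dist_norm algebra_simps)
      also have "\<dots> \<le> norm (y - z) + \<bar>s\<bar>"
        using norm_triangle_ineq[of "y - z" "s *\<^sub>R b"] b by simp
      also have "\<dots> \<le> norm h * N"
        using ny s Basis_le_norm[OF b, of h] unfolding N_def by (simp add: algebra_simps)
      finally show ?thesis using hN by simp
    qed
    have "\<exists>s. \<bar>s\<bar> \<le> \<bar>inner h b\<bar> \<and>
            f (y + (inner h b) *\<^sub>R b) - f (y + 0 *\<^sub>R b) = (inner h b) * g b (y + s *\<^sub>R b)"
    proof (rule mvt_from_0)
      fix s assume "\<bar>s\<bar> \<le> \<bar>inner h b\<bar>"
      then have "y + s *\<^sub>R b \<in> U" using near[of s] d3 by (auto simp: dist_commute)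
      then show "((\<lambda>t. f (y + t *\<^sub>R b)) has_real_derivative g b (y + s *\<^sub>R b)) (at s)"
        using line_derivative_shift D[OF b] by blast
    qed
    then obtain s where s: "\<bar>s\<bar> \<le> \<bar>inner h b\<bar>"
      "f (y + (inner h b) *\<^sub>R b) - f y = (inner h b) * g b (y + s *\<^sub>R b)" by auto
    have "\<bar>f (y + (inner h b) *\<^sub>R b) - f y - (inner h b) * g b z\<bar> = \<bar>inner h b\<bar> * \<bar>g b (y + s *\<^sub>R b) - g b z\<bar>"
      unfolding s(2) by (simp add: algebra_simps flip: abs_mult)
    also have "\<dots> \<le> norm h * e"
      using near[OF s(1)] d2(2)[of "y + s *\<^sub>R b"] Basis_le_norm[OF b, of h] by (intro mult_mono) auto
    finally have 1: "\<bar>f (y + (inner h b) *\<^sub>R b) - f y - (inner h b) * g b z\<bar> \<le> e * norm h"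
      by (simp add: mult.commute)
    have 2: "\<bar>f y - f z - (\<Sum>b\<in>B. (inner h b) * g b z)\<bar> \<le> e * card B * norm h"
      unfolding y_def using d1(2) h unfolding \<delta>_def by simp
    have 3: "z + (\<Sum>b\<in>insert b B. (inner h b) *\<^sub>R b) = y + (inner h b) *\<^sub>R b"
      unfolding y_def using insert by (simp add: algebra_simps)
    have 4: "(\<Sum>b\<in>insert b B. inner h b * g b z) = inner h b * g b z + (\<Sum>b\<in>B. inner h b * g b z)"
      using insert(1,2) by simp
    have 5: "e * card (insert b B) * norm h = e * norm h + e * card B * norm h"
      using insert(1,2) by (simp add: algebra_simps)
    show ?thesis unfolding 3 4 5 using 1 2 by linarith
  qed
  then show ?case using dpos by blast
qed

lemma has_derivative_continuous_partials:
  fixes f :: "'a::euclidean_space \<Rightarrow> real"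
  assumes U: "open U" "z \<in> U"
    and D: "\<And>b. b \<in> Basis \<Longrightarrow> line_derivative U f b (g b)"
    and C: "\<And>b. b \<in> Basis \<Longrightarrow> continuous_on U (g b)"
  shows "(f has_derivative (\<lambda>h. \<Sum>b\<in>Basis. (inner h b) * g b z)) (at z)"
  unfolding has_derivative_at_alt
proof (intro conjI allI impI)
  show "bounded_linear (\<lambda>h. \<Sum>b\<in>Basis. (inner h b) * g b z)"
    by (intro bounded_linear_sum bounded_linear_mult_left[THEN bounded_linear_compose]
        bounded_linear_inner_left)
  fix e :: real assume "e > 0"
  then have "e / DIM('a) > 0" by simp
  from continuous_partials_increment[OF U D C this, of Basis]
  obtain d where d: "d > 0" "\<And>h. norm h < d \<Longrightarrow>
     \<bar>f (z + h) - f z - (\<Sum>b\<in>Basis. (inner h b) * g b z)\<bar> \<le> e * norm h"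
    by (auto simp: euclidean_representation)
  show "\<exists>d>0. \<forall>y. norm (y - z) < d \<longrightarrow>
      norm (f y - f z - (\<Sum>b\<in>Basis. (inner (y - z) b) * g b z)) \<le> e * norm (y - z)"
    using d(1) d(2)[of "_ - z"] by (intro exI[of _ d]) simp
qed

text \<open>Both mixed derivatives are values, at nearby points, of the same second difference quotient.\<close>

lemma mixed_line_derivatives_eq:
  fixes f :: "'a::real_normed_vector \<Rightarrow> real"
  assumes U: "open U" "z \<in> U"
    and a: "line_derivative U f a fa" and b: "line_derivative U f b fb"
    and ab: "line_derivative U fa b fab" and ba: "line_derivative U fb a fba"
    and cab: "continuous_on U fab" and cba: "continuous_on U fba"
  shows "fab z = fba z"
proof (rule ccontr)
  assume neq: "fab z \<noteq> fba z"
  define e where "e = \<bar>fab z - fba z\<bar> / 2"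
  have e: "e > 0" unfolding e_def using neq by simp
  have "isCont fab z" "isCont fba z"
    using cab cba U continuous_on_eq_continuous_at by blast+
  then obtain d1 d2 where d1: "d1 > 0" "\<forall>y. dist y z < d1 \<longrightarrow> \<bar>fab y - fab z\<bar> < e"
    and d2: "d2 > 0" "\<forall>y. dist y z < d2 \<longrightarrow> \<bar>fba y - fba z\<bar> < e"
    using e unfolding continuous_at_eps_delta dist_real_def by (elim allE[of _ e]) auto
  obtain d3 where d3: "d3 > 0" "ball z d3 \<subseteq> U"
    using U open_contains_ball by blast
  define d where "d = min d1 (min d2 d3)"
  have d: "d > 0" unfolding d_def using d1 d2 d3 by simp
  \<comment> \<open>Small enough that \<open>z + s a + r b\<close> stays within \<open>d\<close> of
    \<open>z\<close> whenever \<open>s\<close> and \<open>r\<close> are bounded by \<open>t\<close>;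
    the added 1 keeps the denominator positive if both directions vanish.\<close>
  define t where "t = d / (2 * (norm a + norm b + 1))"
  have den: "norm a + norm b + 1 > 0"
    using norm_ge_zero[of a] norm_ge_zero[of b] by linarith
  have t: "t > 0" unfolding t_def using d den by simp
  have near: "dist (z + s *\<^sub>R a + r *\<^sub>R b) z < d" if "\<bar>s\<bar> \<le> t" "\<bar>r\<bar> \<le> t" for s r
  proof -
    have "dist (z + s *\<^sub>R a + r *\<^sub>R b) z = norm (s *\<^sub>R a + r *\<^sub>R b)"
      by (simp add: dist_norm algebra_simps)
    also have "\<dots> \<le> \<bar>s\<bar> * norm a + \<bar>r\<bar> * norm b"
      using norm_triangle_ineq[of "s *\<^sub>R a" "r *\<^sub>R b"] by simp
    also have "\<dots> \<le> t * norm a + t * norm b" using that by (intro add_mono mult_right_mono) auto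
    also have "\<dots> < 2 * (t * (norm a + norm b + 1))"
    proof -
      have "0 \<le> t * norm a" "0 \<le> t * norm b" using t by simp_all
      then show ?thesis using t unfolding distrib_left by linarith
    qed
    also have "\<dots> = d" unfolding t_def using den by (simp add: field_simps)
    finally show ?thesis .
  qed
  have inU: "z + s *\<^sub>R a + r *\<^sub>R b \<in> U" if "\<bar>s\<bar> \<le> t" "\<bar>r\<bar> \<le> t" for s r
    using near[OF that] d3 unfolding d_def by (auto simp: dist_commute)
  have inU': "z + r *\<^sub>R b + s *\<^sub>R a \<in> U" if "\<bar>s\<bar> \<le> t" "\<bar>r\<bar> \<le> t" for s r
    using inU[OF that] by (simp add: add_ac)
  define \<Delta> where "\<Delta> = f (z + t *\<^sub>R b + t *\<^sub>R a) - f (z + t *\<^sub>R a) - (f (z + t *\<^sub>R b) - f z)"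
  \<comment> \<open>A mean value step along \<open>a\<close> for the difference of two parallel
    lines, followed by one along \<open>b\<close> for \<open>fa\<close>, turns \<Delta> into t^2
    times a value of \<open>fab\<close>. Exchanging the two directions gives a value of
    \<open>fba\<close>.\<close>
  have "\<exists>s. \<bar>s\<bar> \<le> \<bar>t\<bar> \<and> (f (z + t *\<^sub>R b + t *\<^sub>R a) - f (z + t *\<^sub>R a)) -
      (f (z + t *\<^sub>R b + 0 *\<^sub>R a) - f (z + 0 *\<^sub>R a)) =
      t * (fa (z + t *\<^sub>R b + s *\<^sub>R a) - fa (z + s *\<^sub>R a))"
  proof (rule mvt_from_0)
    fix s assume "\<bar>s\<bar> \<le> \<bar>t\<bar>"
    then show "((\<lambda>s. f (z + t *\<^sub>R b + s *\<^sub>R a) - f (z + s *\<^sub>R a)) has_real_derivative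
       fa (z + t *\<^sub>R b + s *\<^sub>R a) - fa (z + s *\<^sub>R a)) (at s)"
      using inU'[of s t] inU'[of s 0] t
      by (intro DERIV_diff line_derivative_shift[OF a]) auto
  qed
  then obtain s where s: "\<bar>s\<bar> \<le> t" "\<Delta> = t * (fa (z + t *\<^sub>R b + s *\<^sub>R a) - fa (z + s *\<^sub>R a))"
    unfolding \<Delta>_def using t by auto
  have "\<exists>r. \<bar>r\<bar> \<le> \<bar>t\<bar> \<and> fa (z + s *\<^sub>R a + t *\<^sub>R b) - fa (z + s *\<^sub>R a + 0 *\<^sub>R b) =
      t * fab (z + s *\<^sub>R a + r *\<^sub>R b)"
  proof (rule mvt_from_0)
    fix r assume "\<bar>r\<bar> \<le> \<bar>t\<bar>"
    then show "((\<lambda>r. fa (z + s *\<^sub>R a + r *\<^sub>R b)) has_real_derivative fab (z + s *\<^sub>R a + r *\<^sub>R b)) (at r)"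
      using inU[of s r] s t by (intro line_derivative_shift[OF ab]) auto
  qed
  then obtain r where r: "\<bar>r\<bar> \<le> t" "\<Delta> = t * (t * fab (z + s *\<^sub>R a + r *\<^sub>R b))"
    unfolding s(2) using t by (auto simp: add_ac)
  have "\<exists>s. \<bar>s\<bar> \<le> \<bar>t\<bar> \<and> (f (z + t *\<^sub>R a + t *\<^sub>R b) - f (z + t *\<^sub>R b)) -
      (f (z + t *\<^sub>R a + 0 *\<^sub>R b) - f (z + 0 *\<^sub>R b)) =
      t * (fb (z + t *\<^sub>R a + s *\<^sub>R b) - fb (z + s *\<^sub>R b))"
  proof (rule mvt_from_0)
    fix s assume "\<bar>s\<bar> \<le> \<bar>t\<bar>"
    then show "((\<lambda>s. f (z + t *\<^sub>R a + s *\<^sub>R b) - f (z + s *\<^sub>R b)) has_real_derivative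
       fb (z + t *\<^sub>R a + s *\<^sub>R b) - fb (z + s *\<^sub>R b)) (at s)"
      using inU[of t s] inU[of 0 s] t
      by (intro DERIV_diff line_derivative_shift[OF b]) auto
  qed
  then obtain s' where s': "\<bar>s'\<bar> \<le> t" "\<Delta> = t * (fb (z + t *\<^sub>R a + s' *\<^sub>R b) - fb (z + s' *\<^sub>R b))"
    unfolding \<Delta>_def using t by (auto simp: algebra_simps)
  have "\<exists>r. \<bar>r\<bar> \<le> \<bar>t\<bar> \<and> fb (z + s' *\<^sub>R b + t *\<^sub>R a) - fb (z + s' *\<^sub>R b + 0 *\<^sub>R a) =
      t * fba (z + s' *\<^sub>R b + r *\<^sub>R a)"
  proof (rule mvt_from_0)
    fix r assume "\<bar>r\<bar> \<le> \<bar>t\<bar>"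
    then show "((\<lambda>r. fb (z + s' *\<^sub>R b + r *\<^sub>R a)) has_real_derivative fba (z + s' *\<^sub>R b + r *\<^sub>R a)) (at r)"
      using inU'[of r s'] s' t by (intro line_derivative_shift[OF ba]) auto
  qed
  then obtain r' where r': "\<bar>r'\<bar> \<le> t" "\<Delta> = t * (t * fba (z + s' *\<^sub>R b + r' *\<^sub>R a))"
    unfolding s'(2) using t by (auto simp: add_ac)
  have eq: "fab (z + s *\<^sub>R a + r *\<^sub>R b) = fba (z + s' *\<^sub>R b + r' *\<^sub>R a)"
    using r(2) r'(2) t by simp
  have "\<bar>fab (z + s *\<^sub>R a + r *\<^sub>R b) - fab z\<bar> < e"
    using near[OF s(1) r(1)] d1(2) unfolding d_def by simp
  moreover have "\<bar>fba (z + s' *\<^sub>R b + r' *\<^sub>R a) - fba z\<bar> < e"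
    using near[OF r'(1) s'(1)] d2(2) unfolding d_def by (simp add: add_ac)
  ultimately have "\<bar>fab z - fba z\<bar> < 2 * e" using eq by linarith
  then show False unfolding e_def by simp
qed

subsection \<open>Iterated partial derivatives of a kernel\<close>

text \<open>Regards the kernel as a function on the product space, so that a slice derivative in
  either argument is a derivative along one vector and the results above apply to both.\<close>

definition partial_dir :: "'d::finite + 'd \<Rightarrow> (real ^ 'd) \<times> (real ^ 'd)" where
  "partial_dir v = (case v of Inl i \<Rightarrow> (axis i 1, 0) | Inr i \<Rightarrow> (0, axis i 1))"

definition partials_ok :: "nat \<Rightarrow> ('d + 'd) list \<Rightarrow> bool" where
  "partials_ok q vs \<longleftrightarrow> length (filter isl vs) \<le> q \<and> length (filter (\<lambda>v. \<not> isl v) vs) \<le> q"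

abbreviation partial_fun ::
  "(real ^ 'd::finite \<Rightarrow> real ^ 'd \<Rightarrow> real) \<Rightarrow> ('d + 'd) list \<Rightarrow> (real ^ 'd) \<times> (real ^ 'd) \<Rightarrow> real" where
  "partial_fun k vs \<equiv> (\<lambda>z. iter_partial vs k (fst z) (snd z))"

definition Cqq_on :: "nat \<Rightarrow> (real ^ 'd::finite \<Rightarrow> real ^ 'd \<Rightarrow> real) \<Rightarrow>
    ((real ^ 'd) \<times> (real ^ 'd)) set \<Rightarrow> bool" where
  "Cqq_on q k U \<longleftrightarrow> open U \<and> (0, 0) \<in> U \<and>
     (\<forall>vs. partials_ok q vs \<longrightarrow> continuous_on U (partial_fun k vs)) \<and>
     (\<forall>v ws. partials_ok q (v # ws) \<longrightarrow>
        line_derivative U (partial_fun k ws) (partial_dir v) (partial_fun k (v # ws)))"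

lemma partial_slice_conv:
  "partial_slice v k (fst z) (snd z) t = k (fst (z + t *\<^sub>R partial_dir v)) (snd (z + t *\<^sub>R partial_dir v))"
  by (cases v) (auto simp: partial_slice_def partial_dir_def)

text \<open>The next iterated partial is by definition \<open>deriv\<close> of the slice, so mere
  differentiability of the slice already makes it the derivative along
  \<open>partial_dir v\<close>.\<close>

lemma Cqq_near_0_iff: "Cqq_near_0 q k \<longleftrightarrow> (\<exists>U. Cqq_on q k U)"
proof -
  have *: "partial_slice v (iter_partial ws k) x y field_differentiable at 0 \<longleftrightarrow>
     ((\<lambda>t. partial_fun k ws ((x, y) + t *\<^sub>R partial_dir v)) has_real_derivative
        partial_fun k (v # ws) (x, y)) (at 0)" for v :: "'a + 'a" and ws x y
  proof -
    have "partial_slice v (iter_partial ws k) x y =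
        (\<lambda>t. partial_fun k ws ((x, y) + t *\<^sub>R partial_dir v))"
      using partial_slice_conv[of v "iter_partial ws k" "(x, y)"] by auto
    then show ?thesis
      by (simp del: fst_add snd_add) (metis DERIV_imp_deriv field_differentiable_def)
  qed
  have **: "(\<lambda>(x, y). iter_partial vs k x y) = partial_fun k vs" for vs :: "('a + 'a) list"
    by auto
  have ***: "(\<forall>(x, y)\<in>U. P x y) \<longleftrightarrow> (\<forall>z\<in>U. P (fst z) (snd z))" for P and U :: "('b \<times> 'c) set"
    by auto
  have ****: "(\<forall>vs. P vs \<longrightarrow> C vs \<and> (\<forall>v ws. vs = v # ws \<longrightarrow> L v ws)) \<longleftrightarrow>
      (\<forall>vs. P vs \<longrightarrow> C vs) \<and> (\<forall>v ws. P (v # ws) \<longrightarrow> L v ws)"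
    for P C and L :: "'b \<Rightarrow> 'b list \<Rightarrow> bool"
    by auto
  show ?thesis
    unfolding Cqq_near_0_def Cqq_on_def line_derivative_def partials_ok_def ** * *** ****
      prod.collapse ..
qed

lemma partials_ok_mono: "partials_ok q vs \<Longrightarrow> q \<le> q' \<Longrightarrow> partials_ok q' vs"
  unfolding partials_ok_def by auto

lemma Cqq_near_0_mono:
  assumes "Cqq_near_0 q' k" "q \<le> q'"
  shows "Cqq_near_0 q k"
proof -
  from assms(1) obtain U where U: "Cqq_on q' k U" unfolding Cqq_near_0_iff by blast
  have "Cqq_on q k U"
    unfolding Cqq_on_def
  proof (intro conjI allI impI)
    fix vs :: "('a + 'a) list" assume "partials_ok q vs"
    then have "partials_ok q' vs" using assms(2) by (rule partials_ok_mono)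
    then show "continuous_on U (partial_fun k vs)" using U unfolding Cqq_on_def by simp
  next
    fix v :: "'a + 'a" and ws assume "partials_ok q (v # ws)"
    then have "partials_ok q' (v # ws)" using assms(2) by (rule partials_ok_mono)
    then show "line_derivative U (partial_fun k ws) (partial_dir v) (partial_fun k (v # ws))"
      using U unfolding Cqq_on_def by (simp del: iter_partial.simps)
  qed (use U in \<open>auto simp: Cqq_on_def\<close>)
  then show ?thesis unfolding Cqq_near_0_iff by blast
qed

lemma partials_ok_ConsD: "partials_ok q (v # vs) \<Longrightarrow> partials_ok q vs"
  unfolding partials_ok_def by (auto split: if_splits)

lemma partials_ok_map [simp]:
  "partials_ok q (map Inl w @ map Inr w') \<longleftrightarrow> length w \<le> q \<and> length w' \<le> q"
  "partials_ok q (map Inr w) \<longleftrightarrow> length w \<le> q"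
  by (auto simp: partials_ok_def filter_map comp_def)

text \<open>A derivative depends only on the values near the point, so equality on an open set
  survives differentiation.\<close>

lemma iter_partial_Cons_cong:
  fixes k :: "real ^ 'd::finite \<Rightarrow> real ^ 'd \<Rightarrow> real"
  assumes "open U" "\<And>z. z \<in> U \<Longrightarrow> partial_fun k vs z = partial_fun k ws z" "z \<in> U"
  shows "partial_fun k (v # vs) z = partial_fun k (v # ws) z"
proof -
  have "\<forall>\<^sub>F t in nhds 0. z + t *\<^sub>R partial_dir v \<in> U"
    by (rule eventually_on_line) (use assms in auto)
  then have "\<forall>\<^sub>F t in nhds 0. partial_slice v (iter_partial vs k) (fst z) (snd z) t =
      partial_slice v (iter_partial ws k) (fst z) (snd z) t"
    by eventually_elim (simp add: partial_slice_conv assms(2) del: fst_add snd_add)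
  then show ?thesis by (simp add: deriv_cong_ev)
qed

lemma iter_partial_append_cong:
  fixes k :: "real ^ 'd::finite \<Rightarrow> real ^ 'd \<Rightarrow> real"
  assumes "open U" "\<And>z. z \<in> U \<Longrightarrow> partial_fun k vs z = partial_fun k ws z"
  shows "z \<in> U \<Longrightarrow> partial_fun k (us @ vs) z = partial_fun k (us @ ws) z"
proof (induction us arbitrary: z)
  case Nil
  then show ?case using assms(2) by simp
next
  case (Cons u us)
  have "partial_fun k (u # us @ vs) z = partial_fun k (u # us @ ws) z"
    by (rule iter_partial_Cons_cong[OF assms(1) Cons.IH]) (use Cons.prems in auto)
  then show ?case by simp
qed

text \<open>\<open>partials_ok\<close> only counts letters of each kind, so the exchanged word and
  the shorter words are admissible too; this supplies every derivative that the equality of mixed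
  derivatives asks for.\<close>

lemma iter_partial_swap:
  fixes k :: "real ^ 'd::finite \<Rightarrow> real ^ 'd \<Rightarrow> real"
  assumes k: "Cqq_on q k U" and ok: "partials_ok q (v # w # vs)" and z: "z \<in> U"
  shows "partial_fun k (v # w # vs) z = partial_fun k (w # v # vs) z"
proof -
  have ok': "partials_ok q (w # v # vs)" "partials_ok q (v # vs)" "partials_ok q (w # vs)"
    using ok unfolding partials_ok_def by (auto split: if_splits)
  note K = k[unfolded Cqq_on_def]
  show ?thesis
  proof (rule mixed_line_derivatives_eq[where U = U and f = "partial_fun k vs" and
        a = "partial_dir w" and fa = "partial_fun k (w # vs)" and
        b = "partial_dir v" and fb = "partial_fun k (v # vs)"])
    show "open U" "z \<in> U" using K z by auto
    show "line_derivative U (partial_fun k vs) (partial_dir w) (partial_fun k (w # vs))"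
      "line_derivative U (partial_fun k vs) (partial_dir v) (partial_fun k (v # vs))"
      "line_derivative U (partial_fun k (w # vs)) (partial_dir v) (partial_fun k (v # w # vs))"
      "line_derivative U (partial_fun k (v # vs)) (partial_dir w) (partial_fun k (w # v # vs))"
      "continuous_on U (partial_fun k (v # w # vs))" "continuous_on U (partial_fun k (w # v # vs))"
      using K ok ok' by blast+
  qed
qed

lemma iter_partial_move:
  fixes k :: "real ^ 'd::finite \<Rightarrow> real ^ 'd \<Rightarrow> real"
  assumes k: "Cqq_on q k U" and ok: "partials_ok q (v # us @ vs)" and z: "z \<in> U"
  shows "partial_fun k (v # us @ vs) z = partial_fun k (us @ v # vs) z"
  using ok z
proof (induction us arbitrary: z)
  case Nil
  then show ?case by simp
next
  case (Cons u us)
  have ok': "partials_ok q (v # us @ vs)"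
    using Cons.prems unfolding partials_ok_def by (auto split: if_splits)
  have "partial_fun k (v # u # us @ vs) z = partial_fun k (u # v # us @ vs) z"
    using iter_partial_swap[OF k] Cons.prems by simp
  also have "\<dots> = partial_fun k (u # us @ v # vs) z"
    by (rule iter_partial_Cons_cong[of U]) (use k Cons ok' in \<open>auto simp: Cqq_on_def\<close>)
  finally show ?case by simp
qed

text \<open>The tail is permuted by induction, then the first letter is moved to its place by
  adjacent exchanges. The fixed suffix \<open>vs\<close> lets the derivatives in one argument be
  sorted while those in the other stay inside.\<close>

lemma iter_partial_perm:
  fixes k :: "real ^ 'd::finite \<Rightarrow> real ^ 'd \<Rightarrow> real"
  assumes k: "Cqq_on q k U" and "partials_ok q (us @ vs)" "z \<in> U" "mset us = mset us'"
  shows "partial_fun k (us @ vs) z = partial_fun k (us' @ vs) z"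
  using assms(2-)
proof (induction us arbitrary: z us')
  case Nil
  then show ?case by simp
next
  case (Cons u us)
  have "u \<in> set us'" using Cons.prems(3) by (metis list.set_intros(1) set_mset_mset)
  then obtain a c where us': "us' = a @ u # c" using split_list by metis
  have m: "mset us = mset (a @ c)" using Cons.prems(3) unfolding us' by simp
  have ok: "partials_ok q (us @ vs)" using Cons.prems(1) partials_ok_ConsD by auto
  have "partial_fun k (u # us @ vs) z = partial_fun k (u # (a @ c) @ vs) z"
    by (rule iter_partial_Cons_cong[of U])
      (use k Cons.IH[OF ok _ m] Cons.prems in \<open>auto simp: Cqq_on_def\<close>)
  also have "\<dots> = partial_fun k (u # a @ c @ vs) z" by simp
  also have "\<dots> = partial_fun k (a @ u # c @ vs) z"
  proof (rule iter_partial_move[OF k _ Cons.prems(2)])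
    have "mset (filter P us) = mset (filter P (a @ c))" for P :: "_ \<Rightarrow> bool"
      using m by (simp only: mset_filter)
    then have "length (filter P us) = length (filter P (a @ c))" for P :: "_ \<Rightarrow> bool"
      by (metis size_mset)
    then show "partials_ok q (u # a @ c @ vs)"
      using Cons.prems(1) unfolding partials_ok_def by auto
  qed
  finally show ?case unfolding us' by simp
qed

subsection \<open>Taylor expansion along words of coordinate directions\<close>

text \<open>Taylor terms are indexed by words of coordinates instead of multi-indices:
  differentiating the sum over words of length m along a line gives the sum over words of length
  m+1, without combinatorial factors. These enter only once, when words are grouped by
  content.\<close>

definition word_monomial :: "real ^ 'd \<Rightarrow> 'd list \<Rightarrow> real" where
  "word_monomial x w = prod_list (map (vec_nth x) w)"

lemma word_monomial_simps [simp]: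
  "word_monomial x [] = 1" "word_monomial x (i # w) = vec_nth x i * word_monomial x w"
  by (simp_all add: word_monomial_def)

lemma finite_words [simp]: "finite {w :: 'd::finite list. length w = m}"
  using finite_lists_length_eq[of "UNIV :: 'd set" m] by simp

lemma sum_words_Suc:
  fixes f :: "'d::finite list \<Rightarrow> real"
  shows "(\<Sum>w | length w = Suc m. f w) = (\<Sum>w | length w = m. \<Sum>i\<in>UNIV. f (i # w))"
proof -
  have *: "{w :: 'd list. length w = Suc m} = (\<lambda>(w, i). i # w) ` ({w. length w = m} \<times> UNIV)"
    by (auto simp: length_Suc_conv image_iff)
  show ?thesis unfolding *
    by (subst sum.reindex) (auto simp: inj_on_def sum.cartesian_product intro!: sum.cong)
qed

lemma has_derivative_along_line:
  fixes f :: "real ^ 'd::finite \<Rightarrow> real"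
  assumes U: "open U" "t *\<^sub>R y \<in> U"
    and D: "\<And>i. line_derivative U f (axis i 1) (g i)"
    and C: "\<And>i. continuous_on U (g i)"
  shows "((\<lambda>t. f (t *\<^sub>R y)) has_real_derivative (\<Sum>i\<in>UNIV. vec_nth y i * g i (t *\<^sub>R y))) (at t)"
proof -
  \<comment> \<open>The partials are indexed by coordinates, the differentiability criterion by
    basis vectors; \<open>SOME\<close> recovers the coordinate, which is unique since different axis
    vectors are distinct.\<close>
  define G where "G b = g (SOME i. b = axis i 1)" for b :: "real ^ 'd"
  have G: "G (axis i 1) = g i" for i :: 'd
    unfolding G_def by (rule arg_cong[of _ _ g], rule some_equality) (auto simp: axis_eq_axis)
  have B: "(Basis :: (real ^ 'd) set) = (\<lambda>i. axis i 1) ` UNIV"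
    by (auto simp: Basis_vec_def)
  have "(f has_derivative (\<lambda>h. \<Sum>b\<in>Basis. inner h b * G b (t *\<^sub>R y))) (at (t *\<^sub>R y))"
    by (rule has_derivative_continuous_partials[OF U]) (use D C in \<open>auto simp: B G\<close>)
  moreover have "(\<Sum>b\<in>Basis. inner h b * G b (t *\<^sub>R y)) = (\<Sum>i\<in>UNIV. vec_nth h i * g i (t *\<^sub>R y))" for h
    unfolding B by (subst sum.reindex) (auto simp: inj_on_def axis_eq_axis G inner_axis)
  ultimately have f: "(f has_derivative (\<lambda>h. \<Sum>i\<in>UNIV. vec_nth h i * g i (t *\<^sub>R y))) (at (t *\<^sub>R y))"
    by simp
  have "((\<lambda>t. t *\<^sub>R y) has_derivative (\<lambda>h. h *\<^sub>R y)) (at t)"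
    by (auto intro!: derivative_eq_intros)
  from has_derivative_compose[OF this f]
  have "((\<lambda>t. f (t *\<^sub>R y)) has_derivative (\<lambda>h. (\<Sum>i\<in>UNIV. vec_nth y i * g i (t *\<^sub>R y)) * h)) (at t)"
    by (simp add: sum_distrib_left sum_distrib_right mult_ac)
  then show ?thesis unfolding has_field_derivative_def .
qed

text \<open>\<open>L\<close> inserts the moving point into one of the two arguments and \<iota> tags
  the letters accordingly, so one proof serves both. The new letter goes to the front, that is, it
  is differentiated last.\<close>

lemma DERIV_word_sum:
  fixes k :: "real ^ 'd::finite \<Rightarrow> real ^ 'd \<Rightarrow> real"
  assumes k: "Cqq_on q k U" and L: "bounded_linear L" and \<iota>: "\<And>i. partial_dir (\<iota> i) = L (axis i 1)"
    and z: "z + L (s *\<^sub>R x) \<in> U"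
    and ok: "\<And>w. length w \<le> Suc m \<Longrightarrow> partials_ok q (map \<iota> w @ vs)"
  shows "((\<lambda>s. \<Sum>w | length w = m. word_monomial x w * partial_fun k (map \<iota> w @ vs) (z + L (s *\<^sub>R x)))
    has_real_derivative
    (\<Sum>w | length w = Suc m. word_monomial x w * partial_fun k (map \<iota> w @ vs) (z + L (s *\<^sub>R x)))) (at s)"
proof -
  interpret bounded_linear L by fact
  let ?V = "(\<lambda>u. z + L u) -` U"
  have cont: "continuous_on A (\<lambda>u. z + L u)" for A by (intro continuous_intros continuous_on)
  then have V: "open ?V" using k unfolding Cqq_on_def by (auto intro!: open_vimage)
  have "((\<lambda>s. word_monomial x w * partial_fun k (map \<iota> w @ vs) (z + L (s *\<^sub>R x))) has_real_derivative
     (\<Sum>i\<in>UNIV. word_monomial x (i # w) * partial_fun k (map \<iota> (i # w) @ vs) (z + L (s *\<^sub>R x)))) (at s)"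
    if w: "length w = m" for w
  proof -
    have okw: "partials_ok q (\<iota> i # map \<iota> w @ vs)" for i using ok[of "i # w"] w by simp
    have "((\<lambda>s. partial_fun k (map \<iota> w @ vs) (z + L (s *\<^sub>R x))) has_real_derivative
     (\<Sum>i\<in>UNIV. vec_nth x i * partial_fun k (\<iota> i # map \<iota> w @ vs) (z + L (s *\<^sub>R x)))) (at s)"
    proof (rule has_derivative_along_line[OF V])
      show "s *\<^sub>R x \<in> ?V" using z by simp
      fix i
      have "line_derivative U (partial_fun k (map \<iota> w @ vs)) (partial_dir (\<iota> i))
          (partial_fun k (\<iota> i # map \<iota> w @ vs))"
        using k okw unfolding Cqq_on_def by blast
      then show "line_derivative ?V (\<lambda>u. partial_fun k (map \<iota> w @ vs) (z + L u)) (axis i 1)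
          (\<lambda>u. partial_fun k (\<iota> i # map \<iota> w @ vs) (z + L u))"
        unfolding line_derivative_def \<iota> vimage_eq
        by (simp only: add scaleR add.assoc[symmetric]) blast
      have "continuous_on U (partial_fun k (\<iota> i # map \<iota> w @ vs))"
        using k okw unfolding Cqq_on_def by blast
      then show "continuous_on ?V (\<lambda>u. partial_fun k (\<iota> i # map \<iota> w @ vs) (z + L u))"
        by (rule continuous_on_compose2[OF _ cont]) auto
    qed
    from DERIV_cmult[OF this, of "word_monomial x w"] show ?thesis
      by (simp add: sum_distrib_left mult_ac)
  qed
  then show ?thesis unfolding sum_words_Suc
    by (intro DERIV_sum) simp
qed

lemma DERIV_word_sum_fst:
  fixes k :: "real ^ 'd::finite \<Rightarrow> real ^ 'd \<Rightarrow> real"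
  assumes "Cqq_on q k U" "(s *\<^sub>R x, y) \<in> U"
    and "\<And>w. length w \<le> Suc m \<Longrightarrow> partials_ok q (map Inl w @ vs)"
  shows "((\<lambda>s. \<Sum>w | length w = m. word_monomial x w * iter_partial (map Inl w @ vs) k (s *\<^sub>R x) y)
    has_real_derivative
    (\<Sum>w | length w = Suc m. word_monomial x w * iter_partial (map Inl w @ vs) k (s *\<^sub>R x) y)) (at s)"
proof -
  have "bounded_linear (\<lambda>u :: real ^ 'd. (u, 0 :: real ^ 'd))"
    by (intro bounded_linear_Pair bounded_linear_ident bounded_linear_zero)
  from DERIV_word_sum[OF assms(1) this, of Inl "(0, y)" s x m vs] assms(2,3) show ?thesis
    by (simp add: partial_dir_def)
qed

lemma DERIV_word_sum_snd:
  fixes k :: "real ^ 'd::finite \<Rightarrow> real ^ 'd \<Rightarrow> real"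
  assumes "Cqq_on q k U" "(x, t *\<^sub>R y) \<in> U" "Suc m \<le> q"
  shows "((\<lambda>t. \<Sum>w | length w = m. word_monomial y w * iter_partial (map Inr w) k x (t *\<^sub>R y))
    has_real_derivative
    (\<Sum>w | length w = Suc m. word_monomial y w * iter_partial (map Inr w) k x (t *\<^sub>R y))) (at t)"
proof -
  have "bounded_linear (\<lambda>u :: real ^ 'd. (0 :: real ^ 'd, u))"
    by (intro bounded_linear_Pair bounded_linear_ident bounded_linear_zero)
  from DERIV_word_sum[OF assms(1) this, of Inr "(x, 0)" t y m "[]"] assms(2,3) show ?thesis
    by (simp add: partial_dir_def)
qed

subsection \<open>Multi-indices as contents of words\<close>

lemma monomial_count: "monomial x (count (mset w)) = word_monomial x w"
proof (induction w)
  case Nil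
  show ?case by (simp add: monomial_def)
next
  case (Cons i w)
  have "monomial x (count (mset (i # w))) =
     (\<Prod>j\<in>UNIV. vec_nth x j ^ count (mset w) j * (if j = i then vec_nth x i else 1))"
    unfolding monomial_def by (intro prod.cong) auto
  also have "\<dots> = monomial x (count (mset w)) * vec_nth x i"
    unfolding monomial_def prod.distrib by simp
  finally show ?case by (simp only: Cons.IH word_monomial_simps mult.commute)
qed

lemma mi_degree_count: "mi_degree (count M) = size M"
proof (induction M)
  case empty
  show ?case by (simp add: mi_degree_def)
next
  case (add i M)
  have "mi_degree (count (add_mset i M)) = (\<Sum>j\<in>UNIV. count M j + (if j = i then 1 else 0))"
    unfolding mi_degree_def by (intro sum.cong) auto
  also have "\<dots> = Suc (mi_degree (count M))"
    unfolding mi_degree_def sum.distrib by simp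
  finally show ?case by (simp only: add.IH size_add_mset)
qed

lemma count_mi_directions:
  fixes \<alpha> :: "'d::{finite,linorder} \<Rightarrow> nat"
  shows "count (mset (mi_directions \<alpha>)) = \<alpha>"
proof
  fix i
  have "count (mset (concat (map (\<lambda>i. replicate (\<alpha> i) i) xs))) i =
      (\<Sum>j\<leftarrow>xs. if j = i then \<alpha> i else 0)" for xs
    by (induction xs) auto
  then have "count (mset (mi_directions \<alpha>)) i =
      (\<Sum>j\<leftarrow>sorted_list_of_set (UNIV :: 'd set). if j = i then \<alpha> i else 0)"
    unfolding mi_directions_def by simp
  also have "\<dots> = (\<Sum>j\<in>UNIV. if j = i then \<alpha> i else 0)"
    by (subst sum_list_distinct_conv_sum_set) simp_all
  finally show "count (mset (mi_directions \<alpha>)) i = \<alpha> i" by simp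
qed

lemma length_mi_directions: "length (mi_directions \<alpha>) = mi_degree \<alpha>"
  using mi_degree_count[of "mset (mi_directions \<alpha>)"] by (simp add: count_mi_directions)

lemma mset_mi_directions_count: "mset (mi_directions (count (mset w))) = mset w"
  by (intro multiset_eqI) (simp add: count_mi_directions)

lemma multi_indices_words:
  "{\<alpha> :: 'd::{finite,linorder} \<Rightarrow> nat. mi_degree \<alpha> = s} = (\<lambda>w. count (mset w)) ` {w. length w = s}"
proof (intro equalityI subsetI)
  fix \<alpha> :: "'d \<Rightarrow> nat" assume "\<alpha> \<in> {\<alpha>. mi_degree \<alpha> = s}"
  then show "\<alpha> \<in> (\<lambda>w. count (mset w)) ` {w. length w = s}"
    by (intro image_eqI[of _ _ "mi_directions \<alpha>"]) (simp_all add: count_mi_directions length_mi_directions)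
qed (auto simp: mi_degree_count)

lemma finite_multi_indices [simp]: "finite {\<alpha> :: 'd::{finite,linorder} \<Rightarrow> nat. mi_degree \<alpha> = s}"
  unfolding multi_indices_words by simp

text \<open>These words are the arrangements of a single multiset, hence counted by a multinomial
  coefficient; the product form avoids a division.\<close>

lemma card_words_of_content:
  fixes \<alpha> :: "'d::{finite,linorder} \<Rightarrow> nat"
  assumes "mi_degree \<alpha> = s"
  shows "real (card {w. length w = s \<and> count (mset w) = \<alpha>}) * mi_fact \<alpha> = fact s"
proof -
  let ?M = "mset (mi_directions \<alpha>)"
  have *: "{w. length w = s \<and> count (mset w) = \<alpha>} = permutations_of_multiset ?M"
  proof (intro equalityI subsetI)
    fix w assume "w \<in> {w. length w = s \<and> count (mset w) = \<alpha>}"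
    then show "w \<in> permutations_of_multiset ?M"
      by (auto intro!: permutations_of_multisetI multiset_eqI simp: count_mi_directions)
  next
    fix w assume "w \<in> permutations_of_multiset ?M"
    then have w: "mset w = ?M" by (rule permutations_of_multisetD)
    moreover from this have "length w = length (mi_directions \<alpha>)" by (rule mset_eq_length)
    ultimately show "w \<in> {w. length w = s \<and> count (mset w) = \<alpha>}"
      using assms by (simp add: count_mi_directions length_mi_directions)
  qed
  have "(\<Prod>x\<in>set_mset ?M. fact (count ?M x)) = (\<Prod>x\<in>UNIV. fact (\<alpha> x) :: nat)"
    unfolding count_mi_directions
    by (rule prod.mono_neutral_left)
      (auto simp: set_mset_def count_mi_directions simp del: set_mset_mset)
  then have "card (permutations_of_multiset ?M) * (\<Prod>x\<in>UNIV. fact (\<alpha> x)) = fact s"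
    using card_permutations_of_multiset_aux[of ?M] assms by (simp add: length_mi_directions)
  then have "real (card (permutations_of_multiset ?M) * (\<Prod>x\<in>UNIV. fact (\<alpha> x))) = real (fact s)"
    by presburger
  then show ?thesis unfolding * mi_fact_def by (simp only: of_nat_mult of_nat_prod of_nat_fact)
qed

lemma mi_fact_pos: "mi_fact \<alpha> > 0"
  unfolding mi_fact_def by (intro prod_pos) simp

text \<open>Turns the 1/s! of Taylor's formula into the 1/\<alpha>! of the Wronskian: when words are
  grouped by content, each multi-index occurs s!/\<alpha>! times.\<close>

lemma sum_words_multi_indices:
  fixes f :: "('d::{finite,linorder} \<Rightarrow> nat) \<Rightarrow> real"
  shows "(\<Sum>w | length w = s. f (count (mset w))) / fact s = (\<Sum>\<alpha> | mi_degree \<alpha> = s. f \<alpha> / mi_fact \<alpha>)"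
proof -
  have "(\<Sum>w | length w = s. f (count (mset w))) =
     (\<Sum>\<alpha> | mi_degree \<alpha> = s. \<Sum>w | w \<in> {w. length w = s} \<and> count (mset w) = \<alpha>. f (count (mset w)))"
    by (rule sum.group[symmetric]) (auto simp: mi_degree_count)
  also have "\<dots> = (\<Sum>\<alpha> | mi_degree \<alpha> = s. fact s * (f \<alpha> / mi_fact \<alpha>))"
  proof (rule sum.cong)
    fix \<alpha> :: "'d \<Rightarrow> nat" assume "\<alpha> \<in> {\<alpha>. mi_degree \<alpha> = s}"
    then have a: "real (card {w. length w = s \<and> count (mset w) = \<alpha>}) * mi_fact \<alpha> = fact s"
      by (intro card_words_of_content) simp
    have "(\<Sum>w | w \<in> {w. length w = s} \<and> count (mset w) = \<alpha>. f (count (mset w))) =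
       (\<Sum>w | length w = s \<and> count (mset w) = \<alpha>. f \<alpha>)"
      by (intro sum.cong) auto
    also have "\<dots> = real (card {w. length w = s \<and> count (mset w) = \<alpha>}) * f \<alpha>" by simp
    also have "\<dots> = fact s * (f \<alpha> / mi_fact \<alpha>)"
      using a mi_fact_pos[of \<alpha>] by (simp add: field_simps)
    finally show "(\<Sum>w | w \<in> {w. length w = s} \<and> count (mset w) = \<alpha>. f (count (mset w))) =
        fact s * (f \<alpha> / mi_fact \<alpha>)" .
  qed simp
  also have "\<dots> = fact s * (\<Sum>\<alpha> | mi_degree \<alpha> = s. f \<alpha> / mi_fact \<alpha>)"
    by (simp only: sum_distrib_left)
  finally show ?thesis by simp
qed

text \<open>Words come in arbitrary order, whereas \<open>mixed_partial\<close> differentiates in a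
  fixed one. The letters of the two arguments are sorted separately, the outer ones first and then,
  under them, the inner ones.\<close>

lemma iter_partial_words_eq_mixed_partial:
  fixes k :: "real ^ 'd::{finite,linorder} \<Rightarrow> real ^ 'd::{finite,linorder} \<Rightarrow> real"
  assumes k: "Cqq_on q k U" and w: "length w \<le> q" "length w' \<le> q" and z: "z \<in> U"
  shows "partial_fun k (map Inl w @ map Inr w') z =
    mixed_partial (count (mset w)) (count (mset w')) k (fst z) (snd z)"
proof -
  let ?d = "\<lambda>w. mi_directions (count (mset w))"
  have len: "length (?d w) = length w" for w :: "'d list"
    by (simp add: length_mi_directions mi_degree_count)
  have "partial_fun k (map Inl w @ map Inr w') z = partial_fun k (map Inl (?d w) @ map Inr w') z"
    by (rule iter_partial_perm[OF k _ z]) (use w in \<open>simp_all add: mset_mi_directions_count\<close>)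
  also have "\<dots> = partial_fun k (map Inl (?d w) @ map Inr (?d w')) z"
  proof (rule iter_partial_append_cong[OF _ _ z])
    show "open U" using k by (simp add: Cqq_on_def)
    fix y assume "y \<in> U"
    then show "partial_fun k (map Inr w') y = partial_fun k (map Inr (?d w')) y"
      using iter_partial_perm[OF k, of "map Inr w'" "[]" y "map Inr (?d w')"] w
      by (simp add: mset_mi_directions_count)
  qed
  finally show ?thesis unfolding mixed_partial_def .
qed

subsection \<open>Functionals annihilating polynomials of low degree\<close>

text \<open>Equivalently, the functional with weights \<open>c\<close> at the nodes \<open>x\<close>
  vanishes on all polynomials of degree below \<open>i\<close>. It will be applied to the columns of
  \<open>Q_i\<close>.\<close>

definition annihilates ::
  "nat \<Rightarrow> (nat \<Rightarrow> real ^ 'd::finite) \<Rightarrow> (nat \<Rightarrow> real) \<Rightarrow> nat \<Rightarrow> bool" where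
  "annihilates n x c i \<longleftrightarrow> (\<forall>\<alpha>. mi_degree \<alpha> < i \<longrightarrow> (\<Sum>a<n. c a * monomial (x a) \<alpha>) = 0)"

lemma annihilates_word:
  "annihilates n x c i \<Longrightarrow> length w < i \<Longrightarrow> (\<Sum>a<n. c a * word_monomial (x a) w) = 0"
  unfolding annihilates_def monomial_count[symmetric] by (simp add: mi_degree_count)

text \<open>The whole double sum is treated as one real function, of \<open>t\<close> and then of
  \<open>s\<close>, so that the mean value points are common to all pairs of nodes. The terms of
  lower order vanish because they contain the functional applied to monomials of too small
  degree.\<close>

lemma kernel_functional_mean_value:
  fixes k :: "real ^ 'd::{finite,linorder} \<Rightarrow> real ^ 'd::{finite,linorder} \<Rightarrow> real"
  assumes k: "Cqq_on q k U" and il: "i \<le> q" "l \<le> q"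
    and c: "annihilates n x c i" "annihilates n x c' l"
    and U: "\<And>s t a b. \<bar>s\<bar> \<le> \<epsilon> \<Longrightarrow> \<bar>t\<bar> \<le> \<epsilon> \<Longrightarrow> a < n \<Longrightarrow> b < n \<Longrightarrow> (s *\<^sub>R x a, t *\<^sub>R x b) \<in> U"
    and e: "\<epsilon> > 0"
  shows "\<exists>s t. 0 < s \<and> s \<le> \<epsilon> \<and> 0 < t \<and> t \<le> \<epsilon> \<and>
    (\<Sum>a<n. \<Sum>b<n. c a * c' b * k (\<epsilon> *\<^sub>R x a) (\<epsilon> *\<^sub>R x b)) =
    (\<Sum>a<n. \<Sum>b<n. c a * c' b * (\<Sum>w' | length w' = l. word_monomial (x b) w' *
       (\<Sum>w | length w = i. word_monomial (x a) w *
          iter_partial (map Inl w @ map Inr w') k (s *\<^sub>R x a) (t *\<^sub>R x b)))) / (fact i * fact l) * \<epsilon> ^ (i + l)"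
proof -
  \<comment> \<open>\<open>P m\<close> is the m-th derivative in \<open>t\<close> with the first
    argument still at scale \<epsilon>; \<open>P' m t\<close> is the m-th derivative in
    \<open>s\<close> after \<open>l\<close> derivatives in the second argument. This order matches
    the words, in which the letters of the second argument are innermost.\<close>
  define P where "P m t = (\<Sum>a<n. \<Sum>b<n. c a * c' b * (\<Sum>w | length w = m. word_monomial (x b) w *
      iter_partial (map Inr w) k (\<epsilon> *\<^sub>R x a) (t *\<^sub>R x b)))" for m t
  define P' where "P' m t s = (\<Sum>a<n. \<Sum>b<n. c a * c' b * (\<Sum>w' | length w' = l. word_monomial (x b) w' *
       (\<Sum>w | length w = m. word_monomial (x a) w *
          iter_partial (map Inl w @ map Inr w') k (s *\<^sub>R x a) (t *\<^sub>R x b))))" for m t s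
  have "\<exists>t>0. t \<le> \<epsilon> \<and> P 0 \<epsilon> = (\<Sum>m<l. P m 0 / fact m * \<epsilon> ^ m) + P l t / fact l * \<epsilon> ^ l"
  proof (rule Maclaurin2[OF e refl], intro allI impI)
    fix m t assume mt: "m < l \<and> 0 \<le> t \<and> t \<le> \<epsilon>"
    show "(P m has_real_derivative P (Suc m) t) (at t)"
      unfolding P_def
      by (intro DERIV_sum DERIV_cmult DERIV_word_sum_snd[OF k]) (use mt il e U in auto)
  qed
  then obtain t where t: "0 < t" "t \<le> \<epsilon>"
    "P 0 \<epsilon> = (\<Sum>m<l. P m 0 / fact m * \<epsilon> ^ m) + P l t / fact l * \<epsilon> ^ l" by auto
  have "P m 0 = 0" if "m < l" for m
  proof -
    \<comment> \<open>At \<open>t = 0\<close> the partial derivative no longer depends on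
      \<open>b\<close>, so the sum over \<open>b\<close> factors out.\<close>
    have "P m 0 = (\<Sum>a<n. \<Sum>w | length w = m. c a * iter_partial (map Inr w) k (\<epsilon> *\<^sub>R x a) 0 *
        (\<Sum>b<n. c' b * word_monomial (x b) w))"
      unfolding P_def
      by (simp add: sum_distrib_left mult_ac sum.swap[of _ "{..<n}" "{w. length w = m}"])
    also have "\<dots> = 0"
      using annihilates_word[OF c(2)] that by (intro sum.neutral ballI) auto
    finally show ?thesis .
  qed
  then have 1: "P 0 \<epsilon> = P' 0 t \<epsilon> / fact l * \<epsilon> ^ l"
    using t(3) unfolding P_def P'_def by simp
  have "\<exists>s>0. s \<le> \<epsilon> \<and> P' 0 t \<epsilon> = (\<Sum>m<i. P' m t 0 / fact m * \<epsilon> ^ m) + P' i t s / fact i * \<epsilon> ^ i"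
  proof (rule Maclaurin2[OF e refl], intro allI impI)
    fix m s assume ms: "m < i \<and> 0 \<le> s \<and> s \<le> \<epsilon>"
    show "(P' m t has_real_derivative P' (Suc m) t s) (at s)"
      unfolding P'_def
      by (intro DERIV_sum DERIV_cmult DERIV_word_sum_fst[OF k]) (use ms t il e U in auto)
  qed
  then obtain s where s: "0 < s" "s \<le> \<epsilon>"
    "P' 0 t \<epsilon> = (\<Sum>m<i. P' m t 0 / fact m * \<epsilon> ^ m) + P' i t s / fact i * \<epsilon> ^ i" by auto
  have "P' m t 0 = 0" if "m < i" for m
  proof -
    have "P' m t 0 = (\<Sum>b<n. \<Sum>a<n. c a * c' b * (\<Sum>w' | length w' = l. word_monomial (x b) w' *
       (\<Sum>w | length w = m. word_monomial (x a) w *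
          iter_partial (map Inl w @ map Inr w') k 0 (t *\<^sub>R x b))))"
      unfolding P'_def by (subst sum.swap) simp
    also have "\<dots> = (\<Sum>b<n. \<Sum>w' | length w' = l. \<Sum>w | length w = m. c' b * word_monomial (x b) w' *
          iter_partial (map Inl w @ map Inr w') k 0 (t *\<^sub>R x b) * (\<Sum>a<n. c a * word_monomial (x a) w))"
      by (simp add: sum_distrib_left sum_distrib_right mult_ac
          sum.swap[of _ "{..<n}" "{w. length w = l}"] sum.swap[of _ "{..<n}" "{w. length w = m}"])
    also have "\<dots> = 0"
      using annihilates_word[OF c(1)] that by (intro sum.neutral ballI) auto
    finally show ?thesis .
  qed
  then have 2: "P' 0 t \<epsilon> = P' i t s / fact i * \<epsilon> ^ i"
    using s(3) by simp
  have "P 0 \<epsilon> = P' i t s / (fact i * fact l) * \<epsilon> ^ (i + l)"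
    unfolding 1 2 by (simp add: power_add)
  then have "\<exists>s t. 0 < s \<and> s \<le> \<epsilon> \<and> 0 < t \<and> t \<le> \<epsilon> \<and>
      P 0 \<epsilon> = P' i t s / (fact i * fact l) * \<epsilon> ^ (i + l)"
    using s(1,2) t(1,2) by blast
  then show ?thesis by (simp add: P_def P'_def)
qed

lemma scaled_points_near_0:
  fixes x :: "nat \<Rightarrow> 'a::real_normed_vector"
  assumes "open U" "(0, 0) \<in> U"
  shows "\<exists>\<delta>>0. \<forall>s t a b. \<bar>s\<bar> < \<delta> \<longrightarrow> \<bar>t\<bar> < \<delta> \<longrightarrow> a < n \<longrightarrow> b < n \<longrightarrow> (s *\<^sub>R x a, t *\<^sub>R x b) \<in> U"
proof -
  have "0 \<in> U" using assms(2) by (simp add: zero_prod_def)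
  then obtain e where e: "e > 0" "ball 0 e \<subseteq> U" using assms(1) open_contains_ball by blast
  \<comment> \<open>The 1 makes \<open>R\<close> positive even if all points are zero; the radius
    \<open>e / (2 * R)\<close> then leaves half of \<open>e\<close> to each argument.\<close>
  define R where "R = 1 + (\<Sum>a<n. norm (x a))"
  have R: "R > 0" unfolding R_def by (simp add: add_pos_nonneg sum_nonneg)
  have xR: "norm (x a) \<le> R" if "a < n" for a
    unfolding R_def using member_le_sum[of a "{..<n}" "\<lambda>a. norm (x a)"] that by simp
  have "(s *\<^sub>R x a, t *\<^sub>R x b) \<in> U"
    if "\<bar>s\<bar> < e / (2 * R)" "\<bar>t\<bar> < e / (2 * R)" "a < n" "b < n" for s t a b
  proof -
    have "norm (s *\<^sub>R x a, t *\<^sub>R x b) \<le> \<bar>s\<bar> * norm (x a) + \<bar>t\<bar> * norm (x b)"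
      using norm_Pair_le[of "s *\<^sub>R x a" "t *\<^sub>R x b"] by simp
    also have "\<dots> \<le> \<bar>s\<bar> * R + \<bar>t\<bar> * R"
      using xR that by (intro add_mono mult_left_mono) auto
    also have "\<dots> < e / (2 * R) * R + e / (2 * R) * R"
      using that R by (intro add_strict_mono mult_strict_right_mono) auto
    also have "\<dots> = e" using R by (simp add: field_simps)
    finally have "(s *\<^sub>R x a, t *\<^sub>R x b) \<in> ball 0 e" by simp
    then show ?thesis using e(2) by blast
  qed
  then show ?thesis using e R by (intro exI[of _ "e / (2 * R)"]) auto
qed

text \<open>The mean value points tend to the origin with \<epsilon>, where the partials involved
  are continuous; regrouping words by content then produces the entries of the Wronskian.\<close>

lemma kernel_functional_limit:
  fixes k :: "real ^ 'd::{finite,linorder} \<Rightarrow> real ^ 'd::{finite,linorder} \<Rightarrow> real"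
  assumes k: "Cqq_near_0 q k" and il: "i \<le> q" "l \<le> q"
    and c: "annihilates n x c i" "annihilates n x c' l"
  shows "((\<lambda>\<epsilon>. (\<Sum>a<n. \<Sum>b<n. c a * c' b * k (\<epsilon> *\<^sub>R x a) (\<epsilon> *\<^sub>R x b)) / \<epsilon> ^ (i + l)) \<longlongrightarrow>
    (\<Sum>\<alpha> | mi_degree \<alpha> = i. \<Sum>\<beta> | mi_degree \<beta> = l.
       (\<Sum>a<n. c a * monomial (x a) \<alpha>) * (mixed_partial \<alpha> \<beta> k 0 0 / (mi_fact \<alpha> * mi_fact \<beta>)) *
       (\<Sum>b<n. c' b * monomial (x b) \<beta>))) (at_right 0)" (is "(_ \<longlongrightarrow> ?L) _")
proof -
  obtain U where U: "Cqq_on q k U" using k unfolding Cqq_near_0_iff by blast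
  then have "open U" "(0, 0) \<in> U" unfolding Cqq_on_def by auto
  from scaled_points_near_0[OF this, of n x]
  obtain \<delta> where d: "\<delta> > 0"
    "\<And>s t a b. \<bar>s\<bar> < \<delta> \<Longrightarrow> \<bar>t\<bar> < \<delta> \<Longrightarrow> a < n \<Longrightarrow> b < n \<Longrightarrow> (s *\<^sub>R x a, t *\<^sub>R x b) \<in> U" by blast
  define P where "P s t = (\<Sum>a<n. \<Sum>b<n. c a * c' b * (\<Sum>w' | length w' = l. word_monomial (x b) w' *
       (\<Sum>w | length w = i. word_monomial (x a) w *
          iter_partial (map Inl w @ map Inr w') k (s *\<^sub>R x a) (t *\<^sub>R x b)))) / (fact i * fact l)" for s t
  \<comment> \<open>The conditions on \<epsilon> stand inside the existential, so that choice yields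
    total functions \<sigma> and \<tau>.\<close>
  have "\<forall>\<epsilon>. \<exists>s t. 0 < \<epsilon> \<longrightarrow> \<epsilon> < \<delta> \<longrightarrow> 0 < s \<and> s \<le> \<epsilon> \<and> 0 < t \<and> t \<le> \<epsilon> \<and>
    (\<Sum>a<n. \<Sum>b<n. c a * c' b * k (\<epsilon> *\<^sub>R x a) (\<epsilon> *\<^sub>R x b)) = P s t * \<epsilon> ^ (i + l)"
  proof
    fix \<epsilon>
    show "\<exists>s t. 0 < \<epsilon> \<longrightarrow> \<epsilon> < \<delta> \<longrightarrow> 0 < s \<and> s \<le> \<epsilon> \<and> 0 < t \<and> t \<le> \<epsilon> \<and>
      (\<Sum>a<n. \<Sum>b<n. c a * c' b * k (\<epsilon> *\<^sub>R x a) (\<epsilon> *\<^sub>R x b)) = P s t * \<epsilon> ^ (i + l)"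
    proof (cases "0 < \<epsilon> \<and> \<epsilon> < \<delta>")
      case True
      then show ?thesis
        using kernel_functional_mean_value[OF U il c, of \<epsilon>] d(2) unfolding P_def by force
    qed auto
  qed
  then obtain \<sigma> \<tau> where st: "\<And>\<epsilon>. 0 < \<epsilon> \<Longrightarrow> \<epsilon> < \<delta> \<Longrightarrow> 0 < \<sigma> \<epsilon> \<and> \<sigma> \<epsilon> \<le> \<epsilon> \<and> 0 < \<tau> \<epsilon> \<and> \<tau> \<epsilon> \<le> \<epsilon> \<and>
    (\<Sum>a<n. \<Sum>b<n. c a * c' b * k (\<epsilon> *\<^sub>R x a) (\<epsilon> *\<^sub>R x b)) = P (\<sigma> \<epsilon>) (\<tau> \<epsilon>) * \<epsilon> ^ (i + l)"
    unfolding choice_iff by blast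
  have ev: "\<forall>\<^sub>F \<epsilon> in at_right 0. 0 < \<epsilon> \<and> \<epsilon> < \<delta>"
    using eventually_at_right_less[of "0::real"] eventually_at_right_real[OF d(1)]
    by eventually_elim auto
  have lim0: "(f \<longlongrightarrow> 0) (at_right 0)" if "\<And>\<epsilon>. 0 < \<epsilon> \<Longrightarrow> \<epsilon> < \<delta> \<Longrightarrow> 0 < f \<epsilon> \<and> f \<epsilon> \<le> \<epsilon>" for f :: "real \<Rightarrow> real"
  proof (rule tendsto_sandwich[of "\<lambda>_. 0" f _ "\<lambda>\<epsilon>. \<epsilon>"])
    show "\<forall>\<^sub>F \<epsilon> in at_right 0. 0 \<le> f \<epsilon>" "\<forall>\<^sub>F \<epsilon> in at_right 0. f \<epsilon> \<le> \<epsilon>"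
      using ev by (eventually_elim; use that in force)+
  qed (auto intro: tendsto_ident_at)
  have s0: "(\<sigma> \<longlongrightarrow> 0) (at_right 0)" and t0: "(\<tau> \<longlongrightarrow> 0) (at_right 0)"
    using st by (auto intro!: lim0)
  have part: "((\<lambda>\<epsilon>. iter_partial (map Inl w @ map Inr w') k (\<sigma> \<epsilon> *\<^sub>R x a) (\<tau> \<epsilon> *\<^sub>R x b)) \<longlongrightarrow>
      mixed_partial (count (mset w)) (count (mset w')) k 0 0) (at_right 0)"
    if "length w = i" "length w' = l" for w w' a b
  proof -
    have ok: "partials_ok q (map Inl w @ map Inr w')" using that il by simp
    then have "continuous_on U (partial_fun k (map Inl w @ map Inr w'))"
      using U unfolding Cqq_on_def by blast
    then have "isCont (partial_fun k (map Inl w @ map Inr w')) (0, 0)"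
      using continuous_on_eq_continuous_at[OF \<open>open U\<close>] \<open>(0, 0) \<in> U\<close> by blast
    moreover have "((\<lambda>\<epsilon>. (\<sigma> \<epsilon> *\<^sub>R x a, \<tau> \<epsilon> *\<^sub>R x b)) \<longlongrightarrow> (0 *\<^sub>R x a, 0 *\<^sub>R x b)) (at_right 0)"
      by (intro tendsto_intros s0 t0)
    ultimately have "((\<lambda>\<epsilon>. partial_fun k (map Inl w @ map Inr w') (\<sigma> \<epsilon> *\<^sub>R x a, \<tau> \<epsilon> *\<^sub>R x b)) \<longlongrightarrow>
        partial_fun k (map Inl w @ map Inr w') (0, 0)) (at_right 0)"
      by (intro isCont_tendsto_compose[of _ "partial_fun k (map Inl w @ map Inr w')"]) auto
    then show ?thesis
      using iter_partial_words_eq_mixed_partial[OF U, of w w' "(0, 0)"] that il \<open>(0, 0) \<in> U\<close> by simp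
  qed
  let ?F = "\<lambda>\<alpha> \<beta>. (\<Sum>a<n. c a * monomial (x a) \<alpha>) * mixed_partial \<alpha> \<beta> k 0 0 * (\<Sum>b<n. c' b * monomial (x b) \<beta>)"
  have "((\<lambda>\<epsilon>. P (\<sigma> \<epsilon>) (\<tau> \<epsilon>)) \<longlongrightarrow>
      (\<Sum>a<n. \<Sum>b<n. c a * c' b * (\<Sum>w' | length w' = l. word_monomial (x b) w' *
       (\<Sum>w | length w = i. word_monomial (x a) w *
          mixed_partial (count (mset w)) (count (mset w')) k 0 0))) / (fact i * fact l)) (at_right 0)"
    unfolding P_def by (intro tendsto_intros part) auto
  also have "(\<Sum>a<n. \<Sum>b<n. c a * c' b * (\<Sum>w' | length w' = l. word_monomial (x b) w' *
       (\<Sum>w | length w = i. word_monomial (x a) w *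
          mixed_partial (count (mset w)) (count (mset w')) k 0 0))) =
      (\<Sum>w' | length w' = l. \<Sum>w | length w = i. ?F (count (mset w)) (count (mset w')))"
    by (simp add: sum_distrib_left sum_distrib_right monomial_count mult_ac
        sum.swap[of _ "{..<n}" "{w. length w = l}"] sum.swap[of _ "{..<n}" "{w. length w = i}"])
  \<comment> \<open>The constant is split so that each word sum receives its own factorial and can
    be regrouped separately.\<close>
  also have "\<dots> / (fact i * fact l) =
      (\<Sum>w' | length w' = l. (\<Sum>w | length w = i. ?F (count (mset w)) (count (mset w'))) / fact i) / fact l"
    by (simp flip: sum_divide_distrib)
  also have "\<dots> = (\<Sum>\<beta> | mi_degree \<beta> = l. (\<Sum>\<alpha> | mi_degree \<alpha> = i. ?F \<alpha> \<beta> / mi_fact \<alpha>) / mi_fact \<beta>)"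
    unfolding sum_words_multi_indices[of "\<lambda>\<alpha>. ?F \<alpha> _"]
    by (rule sum_words_multi_indices[of "\<lambda>\<beta>. \<Sum>\<alpha> | mi_degree \<alpha> = i. ?F \<alpha> \<beta> / mi_fact \<alpha>"])
  also have "\<dots> = (\<Sum>\<alpha> | mi_degree \<alpha> = i. \<Sum>\<beta> | mi_degree \<beta> = l. ?F \<alpha> \<beta> / mi_fact \<alpha> / mi_fact \<beta>)"
    unfolding sum_divide_distrib by (rule sum.swap)
  also have "\<dots> = ?L"
    by (intro sum.cong refl) (simp add: field_simps)
  finally have "((\<lambda>\<epsilon>. P (\<sigma> \<epsilon>) (\<tau> \<epsilon>)) \<longlongrightarrow> ?L) (at_right 0)" .
  moreover have "\<forall>\<^sub>F \<epsilon> in at_right 0. P (\<sigma> \<epsilon>) (\<tau> \<epsilon>) =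
      (\<Sum>a<n. \<Sum>b<n. c a * c' b * k (\<epsilon> *\<^sub>R x a) (\<epsilon> *\<^sub>R x b)) / \<epsilon> ^ (i + l)"
    using ev by eventually_elim (use st in auto)
  ultimately show ?thesis by (rule Lim_transform_eventually)
qed

subsection \<open>Radial kernels\<close>

text \<open>Continuous differentiability of order \<open>N\<close>, unfolded one coordinate
  derivative at a time. The partial derivatives appear as explicit witnesses, which suits functions
  that are patched at the origin.\<close>

primrec C_partials :: "nat \<Rightarrow> (real ^ 'd::finite) set \<Rightarrow> (real ^ 'd \<Rightarrow> real) \<Rightarrow> bool" where
  "C_partials 0 B f \<longleftrightarrow> continuous_on B f"
| "C_partials (Suc N) B f \<longleftrightarrow> continuous_on B f \<and>
     (\<exists>g. \<forall>i. line_derivative B f (axis i 1) (g i) \<and> C_partials N B (g i))"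

lemma line_derivative_add:
  "line_derivative B f a f' \<Longrightarrow> line_derivative B g a g' \<Longrightarrow>
   line_derivative B (\<lambda>z. f z + g z) a (\<lambda>z. f' z + g' z)"
  unfolding line_derivative_def by (auto intro!: DERIV_add)

lemma line_derivative_minus:
  "line_derivative B f a f' \<Longrightarrow> line_derivative B (\<lambda>z. - f z) a (\<lambda>z. - f' z)"
  unfolding line_derivative_def by (intro ballI DERIV_minus) auto

lemma line_derivative_cong:
  assumes "open B" "\<And>z. z \<in> B \<Longrightarrow> f z = g z" "line_derivative B f a h"
  shows "line_derivative B g a h"
  unfolding line_derivative_def
proof
  fix z assume z: "z \<in> B"
  have "\<forall>\<^sub>F t in nhds 0. f (z + t *\<^sub>R a) = g (z + t *\<^sub>R a)"
    using eventually_on_line[OF assms(1) z] by eventually_elim (rule assms(2))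
  then have "((\<lambda>t. f (z + t *\<^sub>R a)) has_real_derivative h z) (at 0) \<longleftrightarrow>
      ((\<lambda>t. g (z + t *\<^sub>R a)) has_real_derivative h z) (at 0)"
    by (intro DERIV_cong_ev refl)
  then show "((\<lambda>t. g (z + t *\<^sub>R a)) has_real_derivative h z) (at 0)"
    using assms(3) z unfolding line_derivative_def by blast
qed

lemma C_partials_imp_continuous_on: "C_partials N B f \<Longrightarrow> continuous_on B f"
  by (cases N) auto

lemma C_partials_cong:
  assumes "open B" "\<And>z. z \<in> B \<Longrightarrow> f z = g z" "C_partials N B f"
  shows "C_partials N B g"
proof -
  have "continuous_on B g"
    using C_partials_imp_continuous_on[OF assms(3)] assms(2)
    by (simp cong: continuous_on_cong)
  moreover have "line_derivative B f a h \<Longrightarrow> line_derivative B g a h" for a h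
    by (rule line_derivative_cong[OF assms(1)]) (use assms(2) in auto)
  ultimately show ?thesis
    using assms(3) by (cases N) (simp, simp, blast)
qed

lemma C_partials_add:
  "C_partials N B f \<Longrightarrow> C_partials N B g \<Longrightarrow> C_partials N B (\<lambda>z. f z + g z)"
proof (induction N arbitrary: f g)
  case 0
  then show ?case by (auto intro: continuous_intros)
next
  case (Suc N)
  from Suc.prems obtain f' g' where
    "\<And>i. line_derivative B f (axis i 1) (f' i) \<and> C_partials N B (f' i)"
    "\<And>i. line_derivative B g (axis i 1) (g' i) \<and> C_partials N B (g' i)" by auto
  then have "line_derivative B (\<lambda>z. f z + g z) (axis i 1) (\<lambda>z. f' i z + g' i z) \<and>
      C_partials N B (\<lambda>z. f' i z + g' i z)" for i
    using line_derivative_add Suc.IH by blast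
  then show ?case using Suc.prems by (auto intro!: continuous_intros exI[of _ "\<lambda>i z. f' i z + g' i z"])
qed

lemma real_polynomial_function_line_derivative:
  assumes "real_polynomial_function f"
  shows "\<exists>g. real_polynomial_function g \<and> line_derivative UNIV f a g"
  using assms
proof (induction rule: real_polynomial_function.induct)
  case (linear f)
  interpret bounded_linear f by fact
  have "line_derivative UNIV f a (\<lambda>_. f a)"
    unfolding line_derivative_def by (auto simp: add scaleR intro!: derivative_eq_intros)
  then show ?case by blast
next
  case (const c)
  have "line_derivative UNIV (\<lambda>_. c) a (\<lambda>_. 0)"
    unfolding line_derivative_def by simp
  then show ?case by blast
next
  case (add f g)
  then obtain f' g' where *: "real_polynomial_function f'" "line_derivative UNIV f a f'"
    "real_polynomial_function g'" "line_derivative UNIV g a g'" by blast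
  show ?case
    using line_derivative_add[OF *(2,4)] real_polynomial_function.intros(3)[OF *(1,3)] by blast
next
  case (mult f g)
  then obtain f' g' where *: "real_polynomial_function f'" "line_derivative UNIV f a f'"
    "real_polynomial_function g'" "line_derivative UNIV g a g'" by blast
  have "line_derivative UNIV (\<lambda>z. f z * g z) a (\<lambda>z. f' z * g z + g' z * f z)"
    using *(2,4) unfolding line_derivative_def by (auto intro!: DERIV_mult[THEN DERIV_cong])
  moreover have "real_polynomial_function (\<lambda>z. f' z * g z + g' z * f z)"
    by (intro real_polynomial_function.intros(3,4) * mult(1,2))
  ultimately show ?case by blast
qed

lemma real_polynomial_function_C_partials:
  "real_polynomial_function f \<Longrightarrow> C_partials N UNIV f"
proof (induction N arbitrary: f)
  case 0
  then show ?case by (simp add: continuous_on_polymonial_function real_polynomial_function_eq)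
next
  case (Suc N)
  have "\<forall>i. \<exists>g. real_polynomial_function g \<and> line_derivative UNIV f (axis i 1) g"
    using real_polynomial_function_line_derivative[OF Suc.prems] by blast
  then obtain g where g: "\<And>i. real_polynomial_function (g i) \<and> line_derivative UNIV f (axis i 1) (g i)"
    by metis
  then show ?case
    using Suc by (auto simp: continuous_on_polymonial_function real_polynomial_function_eq)
qed

lemma C_partials_subset: "C_partials N B f \<Longrightarrow> B' \<subseteq> B \<Longrightarrow> C_partials N B' f"
proof (induction N arbitrary: f)
  case 0
  then show ?case by (auto intro: continuous_on_subset)
next
  case (Suc N)
  from Suc.prems(1) obtain g where g: "\<And>i. line_derivative B f (axis i 1) (g i)"
    "\<And>i. C_partials N B (g i)" by auto
  have "line_derivative B' f (axis i 1) (g i) \<and> C_partials N B' (g i)" for i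
    using g(1)[of i] Suc.IH[OF g(2)] Suc.prems(2) unfolding line_derivative_def by blast
  moreover have "continuous_on B' f" using Suc.prems by (auto intro: continuous_on_subset)
  ultimately show ?case by auto
qed

text \<open>\<open>norm_order \<rho> s f\<close>: off the origin \<open>f\<close> is smooth in the ball of radius \<open>\<rho>\<close>, it is
  $O(\|z\|^s)$ at the origin, and differentiation lowers \<open>s\<close> by one.\<close>

inductive norm_order :: "real \<Rightarrow> int \<Rightarrow> ('a::real_inner \<Rightarrow> real) \<Rightarrow> bool" for \<rho> where
  const: "norm_order \<rho> 0 (\<lambda>z. c)"
| inner: "norm_order \<rho> 1 (\<lambda>z. inner z b)"
| norm_powi: "norm_order \<rho> q (\<lambda>z. norm z powi q)"
| series: "(\<And>t. \<bar>t\<bar> < \<rho> \<Longrightarrow> summable (\<lambda>m. c m * t ^ m)) \<Longrightarrow>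
    norm_order \<rho> 0 (\<lambda>z. \<Sum>m. c m * norm z ^ m)"
| mult: "norm_order \<rho> s f \<Longrightarrow> norm_order \<rho> t g \<Longrightarrow> norm_order \<rho> (s + t) (\<lambda>z. f z * g z)"
| add: "norm_order \<rho> s f \<Longrightarrow> norm_order \<rho> s g \<Longrightarrow> norm_order \<rho> s (\<lambda>z. f z + g z)"
| weaken: "norm_order \<rho> s f \<Longrightarrow> t \<le> s \<Longrightarrow> norm_order \<rho> t f"

lemma DERIV_norm_line:
  fixes z e :: "'a::real_inner"
  assumes "z \<noteq> 0"
  shows "((\<lambda>t. norm (z + t *\<^sub>R e)) has_real_derivative inner z e * norm z powi (-1)) (at 0)"
proof -
  have "((\<lambda>t::real. z + t *\<^sub>R e) has_derivative (\<lambda>h. h *\<^sub>R e)) (at 0)"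
    by (auto intro!: derivative_eq_intros)
  moreover have "(norm has_derivative (\<lambda>h. inner h (sgn z))) (at (z + 0 *\<^sub>R e))"
    using has_derivative_norm[OF assms] by simp
  ultimately have "((\<lambda>t. norm (z + t *\<^sub>R e)) has_derivative (\<lambda>h. inner (h *\<^sub>R e) (sgn z))) (at 0)"
    by (rule has_derivative_compose)
  moreover have "(\<lambda>h. inner (h *\<^sub>R e) (sgn z)) = (*) (inner z e * norm z powi (-1))"
    by (auto simp: fun_eq_iff sgn_div_norm inner_commute power_int_minus)
  ultimately show ?thesis unfolding has_field_derivative_def by simp
qed

lemma power_series_DERIV:
  fixes c :: "nat \<Rightarrow> real"
  assumes "\<And>t. \<bar>t\<bar> < \<rho> \<Longrightarrow> summable (\<lambda>m. c m * t ^ m)" "\<bar>t\<bar> < \<rho>"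
  shows "((\<lambda>t. \<Sum>m. c m * t ^ m) has_real_derivative (\<Sum>m. diffs c m * t ^ m)) (at t)"
proof -
  obtain K where "\<bar>t\<bar> < K" "K < \<rho>" using assms(2) dense by blast
  then show ?thesis using assms(1)[of K] by (intro termdiffs_strong[of c K]) auto
qed

text \<open>Each generator differentiates into generators. The line derivative of the norm is
  \<open>inner z e / norm z\<close>, of order 1 - 1 = 0, so the chain rule factor costs nothing
  beyond what the outer function loses; for constants and series the lower order is reached by
  weakening.\<close>

lemma norm_order_derivative:
  assumes "norm_order \<rho> s f"
  shows "\<exists>g. norm_order \<rho> (s - 1) g \<and> line_derivative {z. z \<noteq> 0 \<and> norm z < \<rho>} f e g"
  using assms
proof (induction rule: norm_order.induct)
  case (const c)
  have "line_derivative {z. z \<noteq> 0 \<and> norm z < \<rho>} (\<lambda>_. c) e (\<lambda>_. 0)"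
    unfolding line_derivative_def by simp
  then show ?case using norm_order.weaken[OF norm_order.const, of "0 - 1" \<rho> 0] by auto
next
  case (inner b)
  have "line_derivative {z. z \<noteq> 0 \<and> norm z < \<rho>} (\<lambda>z. inner z b) e (\<lambda>_. inner e b)"
    unfolding line_derivative_def by (auto simp: inner_add_left intro!: derivative_eq_intros)
  then show ?case using norm_order.const[of \<rho> "inner e b"] by auto
next
  case (norm_powi q)
  have "norm_order \<rho> (0 + (q - 1) + (1 + (-1)))
      (\<lambda>z :: 'a. of_int q * norm z powi (q - 1) * (inner z e * norm z powi (-1)))"
    by (intro norm_order.mult norm_order.const norm_order.norm_powi norm_order.inner)
  moreover have "line_derivative {z. z \<noteq> 0 \<and> norm z < \<rho>} (\<lambda>z. norm z powi q) e
      (\<lambda>z. of_int q * norm z powi (q - 1) * (inner z e * norm z powi (-1)))"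
    unfolding line_derivative_def
    by (auto intro!: DERIV_power_int[THEN DERIV_cong] DERIV_norm_line)
  ultimately show ?case by auto
next
  case (series c)
  have "norm_order \<rho> (0 + (1 + (-1)))
      (\<lambda>z :: 'a. (\<Sum>m. diffs c m * norm z ^ m) * (inner z e * norm z powi (-1)))"
  proof (intro norm_order.mult norm_order.series norm_order.norm_powi norm_order.inner)
    fix t :: real assume "\<bar>t\<bar> < \<rho>"
    then show "summable (\<lambda>m. diffs c m * t ^ m)"
      using termdiff_converges[of t \<rho> c] series by simp
  qed
  then have "norm_order \<rho> (0 - 1)
      (\<lambda>z :: 'a. (\<Sum>m. diffs c m * norm z ^ m) * (inner z e * norm z powi (-1)))"
    by (rule norm_order.weaken) simp
  moreover have "line_derivative {z. z \<noteq> 0 \<and> norm z < \<rho>} (\<lambda>z. \<Sum>m. c m * norm z ^ m) e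
      (\<lambda>z. (\<Sum>m. diffs c m * norm z ^ m) * (inner z e * norm z powi (-1)))"
    unfolding line_derivative_def
  proof
    fix z :: 'a assume "z \<in> {z. z \<noteq> 0 \<and> norm z < \<rho>}"
    then have z: "z \<noteq> 0" "norm z < \<rho>" by auto
    have "((\<lambda>t. \<Sum>m. c m * t ^ m) has_real_derivative (\<Sum>m. diffs c m * norm z ^ m))
        (at (norm (z + 0 *\<^sub>R e)))"
      using power_series_DERIV[of \<rho> c "norm z"] series z by simp
    from DERIV_chain2[OF this DERIV_norm_line[OF z(1)]]
    show "((\<lambda>t. \<Sum>m. c m * norm (z + t *\<^sub>R e) ^ m) has_real_derivative
       (\<Sum>m. diffs c m * norm z ^ m) * (inner z e * norm z powi (-1))) (at 0)" .
  qed
  ultimately show ?case by blast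
next
  case (mult s f t g)
  then obtain f' g' where *: "norm_order \<rho> (s - 1) f'" "line_derivative {z. z \<noteq> 0 \<and> norm z < \<rho>} f e f'"
    "norm_order \<rho> (t - 1) g'" "line_derivative {z. z \<noteq> 0 \<and> norm z < \<rho>} g e g'" by blast
  have "norm_order \<rho> (s - 1 + t) (\<lambda>z. f' z * g z)" "norm_order \<rho> (t - 1 + s) (\<lambda>z. g' z * f z)"
    using * mult by (auto intro!: norm_order.mult)
  then have "norm_order \<rho> (s + t - 1) (\<lambda>z. f' z * g z + g' z * f z)"
    by (intro norm_order.add) (simp_all add: algebra_simps)
  moreover have "line_derivative {z. z \<noteq> 0 \<and> norm z < \<rho>} (\<lambda>z. f z * g z) e (\<lambda>z. f' z * g z + g' z * f z)"
    using *(2,4) unfolding line_derivative_def by (auto intro!: DERIV_mult[THEN DERIV_cong])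
  ultimately show ?case by blast
next
  case (add s f g)
  then obtain f' g' where *: "norm_order \<rho> (s - 1) f'" "line_derivative {z. z \<noteq> 0 \<and> norm z < \<rho>} f e f'"
    "norm_order \<rho> (s - 1) g'" "line_derivative {z. z \<noteq> 0 \<and> norm z < \<rho>} g e g'" by blast
  show ?case
    using line_derivative_add[OF *(2,4)] norm_order.add[OF *(1,3)] by blast
next
  case (weaken s f t)
  then show ?case using norm_order.weaken[of \<rho> "s - 1" _ "t - 1"] by fastforce
qed

lemma norm_order_continuous_on:
  assumes "norm_order \<rho> s f"
  shows "continuous_on {z. z \<noteq> 0 \<and> norm z < \<rho>} f"
  using assms
proof (induction rule: norm_order.induct)
  case (series c)
  have "continuous_on {t. \<bar>t\<bar> < \<rho>} (\<lambda>t. \<Sum>m. c m * t ^ m)"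
    using power_series_DERIV[of \<rho> c] series
    by (intro DERIV_continuous_on[of _ _ "\<lambda>t. \<Sum>m. diffs c m * t ^ m"])
      (auto intro: has_field_derivative_at_within)
  then show ?case
    by (rule continuous_on_compose2) (auto intro!: continuous_on_norm continuous_on_id)
qed (auto intro!: continuous_intros)

lemma norm_order_bound:
  assumes "norm_order \<rho> s f" "\<rho> > 0"
  shows "\<exists>C\<ge>0. \<forall>\<^sub>F z in at 0. \<bar>f z\<bar> \<le> C * norm z powi s"
  using assms(1)
proof (induction rule: norm_order.induct)
  case (const c)
  show ?case by (intro exI[of _ "\<bar>c\<bar>"]) auto
next
  case (inner b)
  have "\<forall>\<^sub>F z in at 0. \<bar>inner z b\<bar> \<le> norm b * norm z powi 1"
    using Cauchy_Schwarz_ineq2[of _ b] by (simp add: mult.commute)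
  then show ?case by (intro exI[of _ "norm b"]) auto
next
  case (norm_powi q)
  show ?case by (intro exI[of _ 1]) auto
next
  case (series c)
  have "isCont (\<lambda>t. \<Sum>m. c m * t ^ m) 0"
    using power_series_DERIV[of \<rho> c 0] series assms(2) by (intro DERIV_isCont) auto
  moreover have "((\<lambda>z::'a. norm z) \<longlongrightarrow> 0) (at 0)"
    by (intro tendsto_norm_zero tendsto_ident_at)
  ultimately have "((\<lambda>z::'a. \<Sum>m. c m * norm z ^ m) \<longlongrightarrow> (\<Sum>m. c m * 0 ^ m)) (at 0)"
    by (rule isCont_tendsto_compose)
  then have "\<forall>\<^sub>F z::'a in at 0. dist (\<Sum>m. c m * norm z ^ m) (\<Sum>m. c m * 0 ^ m) < 1"
    by (rule tendstoD) simp
  then have "\<forall>\<^sub>F z::'a in at 0. \<bar>\<Sum>m. c m * norm z ^ m\<bar> \<le> (\<bar>\<Sum>m. c m * 0 ^ m\<bar> + 1) * norm z powi 0"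
    by eventually_elim (simp add: dist_real_def)
  then show ?case by (intro exI[of _ "\<bar>\<Sum>m. c m * 0 ^ m\<bar> + 1"]) auto
next
  case (mult s f t g)
  then obtain C D where C: "C \<ge> 0" "\<forall>\<^sub>F z in at 0. \<bar>f z\<bar> \<le> C * norm z powi s"
    and D: "D \<ge> 0" "\<forall>\<^sub>F z in at 0. \<bar>g z\<bar> \<le> D * norm z powi t" by blast
  have "\<forall>\<^sub>F z in at 0. \<bar>f z * g z\<bar> \<le> C * D * norm z powi (s + t)"
    using C(2) D(2) eventually_neq_at_within[of 0 0 UNIV]
  proof eventually_elim
    case (elim z)
    have "\<bar>f z\<bar> * \<bar>g z\<bar> \<le> (C * norm z powi s) * (D * norm z powi t)"
      using elim C D by (intro mult_mono) auto
    then show ?case using elim by (simp add: abs_mult power_int_add mult_ac)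
  qed
  then show ?case using C D by (intro exI[of _ "C * D"]) auto
next
  case (add s f g)
  then obtain C D where C: "C \<ge> 0" "\<forall>\<^sub>F z in at 0. \<bar>f z\<bar> \<le> C * norm z powi s"
    and D: "D \<ge> 0" "\<forall>\<^sub>F z in at 0. \<bar>g z\<bar> \<le> D * norm z powi s" by blast
  have "\<forall>\<^sub>F z in at 0. \<bar>f z + g z\<bar> \<le> (C + D) * norm z powi s"
    using C(2) D(2) by eventually_elim (auto simp: distrib_right)
  then show ?case using C D by (intro exI[of _ "C + D"]) auto
next
  case (weaken s f t)
  then obtain C where C: "C \<ge> 0" "\<forall>\<^sub>F z in at 0. \<bar>f z\<bar> \<le> C * norm z powi s" by blast
  have "\<forall>\<^sub>F z::'a in at 0. dist z 0 < 1" by (intro tendstoD[OF tendsto_ident_at]) simp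
  then have "\<forall>\<^sub>F z in at 0. \<bar>f z\<bar> \<le> C * norm z powi t"
    using C(2) eventually_neq_at_within[of 0 0 UNIV]
  proof eventually_elim
    case (elim z)
    \<comment> \<open>Inside the unit ball the smaller exponent gives the larger bound.\<close>
    have "norm z powi s \<le> norm z powi t"
      using elim weaken(2) by (intro power_int_decreasing) auto
    then have "C * norm z powi s \<le> C * norm z powi t" using C(1) by (rule mult_left_mono)
    then show ?case using elim by linarith
  qed
  then show ?case using C by blast
qed

text \<open>The order exceeds \<open>N\<close> by one: order at least 1 makes the extension by 0
  continuous at the origin, and order at least 2 makes its difference quotients there tend to 0. So
  the derivative is again a function extended by 0, with \<open>N\<close> and the order lowered
  together.\<close>

lemma norm_order_C_partials:
  fixes f :: "real ^ 'd::finite \<Rightarrow> real"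
  assumes "\<rho> > 0"
  shows "norm_order \<rho> s f \<Longrightarrow> s \<ge> int N + 1 \<Longrightarrow> C_partials N (ball 0 \<rho>) (\<lambda>z. if z = 0 then 0 else f z)"
proof (induction N arbitrary: s f)
  have cont: "continuous_on (ball 0 \<rho>) (\<lambda>z. if z = 0 then 0 else f z)"
    if f: "norm_order \<rho> s f" and s: "s \<ge> 1" for f :: "real ^ 'd \<Rightarrow> real" and s
  proof (rule continuous_at_imp_continuous_on, intro ballI)
    fix z :: "real ^ 'd" assume z: "z \<in> ball 0 \<rho>"
    show "isCont (\<lambda>z. if z = 0 then 0 else f z) z"
    proof (cases "z = 0")
      case True
      from norm_order_bound[OF norm_order.weaken[OF f s] assms] obtain C where
        C: "\<forall>\<^sub>F z in at 0. \<bar>f z\<bar> \<le> C * norm z powi 1" by blast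
      have "((\<lambda>z. if z = 0 then 0 else f z) \<longlongrightarrow> 0) (at 0)"
      proof (rule tendsto_rabs_zero_cancel, rule tendsto_sandwich[OF _ _ tendsto_const])
        show "((\<lambda>z. C * norm z) \<longlongrightarrow> 0) (at (0 :: real ^ 'd))"
          by (intro tendsto_mult_right_zero tendsto_norm_zero tendsto_ident_at)
        show "\<forall>\<^sub>F z in at 0. \<bar>if z = 0 then 0 else f z\<bar> \<le> C * norm z"
          using C eventually_neq_at_within[of 0 0 UNIV] by eventually_elim auto
      qed auto
      then show ?thesis unfolding True isCont_def by simp
    next
      case False
      have "open {z :: real ^ 'd. z \<noteq> 0 \<and> norm z < \<rho>}"
        by (intro open_Collect_conj open_Collect_neq open_Collect_less continuous_intros)
      moreover have "z \<in> {z. z \<noteq> 0 \<and> norm z < \<rho>}" using z False by simp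
      ultimately have "isCont f z"
        using norm_order_continuous_on[OF f] continuous_on_eq_continuous_at by blast
      moreover have "\<forall>\<^sub>F y in nhds z. y \<noteq> 0"
        using False by (rule t1_space_nhds)
      then have "\<forall>\<^sub>F y in nhds z. (if y = 0 then 0 else f y) = f y"
        by eventually_elim simp
      then have "isCont (\<lambda>y. if y = 0 then 0 else f y) z \<longleftrightarrow> isCont f z"
        by (rule isCont_cong)
      ultimately show ?thesis by blast
    qed
  qed
  {
    case 0
    then show ?case using cont by simp
  next
    case (Suc N)
    have "\<forall>i. \<exists>g. norm_order \<rho> (s - 1) g \<and> line_derivative {z. z \<noteq> 0 \<and> norm z < \<rho>} f (axis i 1) g"
      using norm_order_derivative[OF Suc.prems(1)] by blast
    then obtain g where g: "\<And>i. norm_order \<rho> (s - 1) (g i)"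
      "\<And>i. line_derivative {z. z \<noteq> 0 \<and> norm z < \<rho>} f (axis i 1) (g i)" by metis
    have "line_derivative (ball 0 \<rho>) (\<lambda>z. if z = 0 then 0 else f z) (axis i 1)
        (\<lambda>z. if z = 0 then 0 else g i z)" for i
      unfolding line_derivative_def
    proof
      fix z :: "real ^ 'd" assume z: "z \<in> ball 0 \<rho>"
      show "((\<lambda>t. if z + t *\<^sub>R axis i 1 = 0 then 0 else f (z + t *\<^sub>R axis i 1)) has_real_derivative
         (if z = 0 then 0 else g i z)) (at 0)"
      proof (cases "z = 0")
        case False
        have "open {z :: real ^ 'd. z \<noteq> 0}"
          by (intro open_Collect_neq continuous_intros)
        then have "\<forall>\<^sub>F t in nhds 0. z + t *\<^sub>R axis i 1 \<in> {z. z \<noteq> 0}"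
          by (rule eventually_on_line) (use False in simp)
        then have "\<forall>\<^sub>F t in nhds 0. (if z + t *\<^sub>R axis i 1 = 0 then 0 else f (z + t *\<^sub>R axis i 1)) =
            f (z + t *\<^sub>R axis i 1)"
          by eventually_elim simp
        moreover have "((\<lambda>t. f (z + t *\<^sub>R axis i 1)) has_real_derivative g i z) (at 0)"
          using g(2)[of i] z False unfolding line_derivative_def by auto
        moreover from calculation(1) have
          "((\<lambda>t. if z + t *\<^sub>R axis i 1 = 0 then 0 else f (z + t *\<^sub>R axis i 1)) has_real_derivative g i z) (at 0) \<longleftrightarrow>
           ((\<lambda>t. f (z + t *\<^sub>R axis i 1)) has_real_derivative g i z) (at 0)"
          by (intro DERIV_cong_ev refl)
        ultimately show ?thesis using False by (simp only: if_False)
      next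
        case True
        have "norm_order \<rho> 2 f" using Suc.prems by (auto intro: norm_order.weaken)
        from norm_order_bound[OF this assms] obtain C where
          C: "\<forall>\<^sub>F z in at 0. \<bar>f z\<bar> \<le> C * norm z powi 2" by blast
        have "((\<lambda>t. t *\<^sub>R axis i 1) \<longlongrightarrow> 0 *\<^sub>R axis i (1::real)) (at (0::real))"
          by (intro tendsto_intros)
        moreover have "\<forall>\<^sub>F t in at (0::real). t *\<^sub>R axis i (1::real) \<noteq> 0"
          using eventually_neq_at_within[of 0 0 UNIV] by eventually_elim (simp add: axis_eq_0_iff)
        ultimately have "filterlim (\<lambda>t. t *\<^sub>R axis i (1::real)) (at 0) (at (0::real))"
          by (intro filterlim_atI) auto
        from eventually_compose_filterlim[OF C this]
        have C': "\<forall>\<^sub>F t in at 0. \<bar>f (t *\<^sub>R axis i 1)\<bar> \<le> C * norm (t *\<^sub>R axis i (1::real)) powi 2" .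
        have "((\<lambda>t. (if t *\<^sub>R axis i (1::real) = 0 then 0 else f (t *\<^sub>R axis i 1)) / t) \<longlongrightarrow> 0) (at 0)"
        proof (rule tendsto_rabs_zero_cancel, rule tendsto_sandwich[OF _ _ tendsto_const])
          show "((\<lambda>t. C * \<bar>t\<bar>) \<longlongrightarrow> 0) (at (0 :: real))"
            by (intro tendsto_mult_right_zero tendsto_rabs_zero tendsto_ident_at)
          show "\<forall>\<^sub>F t in at 0. \<bar>(if t *\<^sub>R axis i (1::real) = 0 then 0 else f (t *\<^sub>R axis i 1)) / t\<bar> \<le> C * \<bar>t\<bar>"
            using C' eventually_neq_at_within[of 0 0 UNIV]
            by eventually_elim (auto simp: field_simps axis_eq_0_iff power2_eq_square)
        qed auto
        then show ?thesis unfolding True DERIV_def by (simp cong: if_cong)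
      qed
    qed
    moreover have "C_partials N (ball 0 \<rho>) (\<lambda>z. if z = 0 then 0 else g i z)" for i
      using Suc.IH[OF g(1)] Suc.prems by simp
    moreover have "continuous_on (ball 0 \<rho>) (\<lambda>z. if z = 0 then 0 else f z)"
      using cont[OF Suc.prems(1)] Suc.prems(2) by simp
    ultimately show ?case
      unfolding C_partials.simps
      by (intro conjI exI[of _ "\<lambda>i z. if z = 0 then 0 else g i z"] allI)
  }
qed

lemma summable_powser_shift:
  fixes c :: "nat \<Rightarrow> real"
  assumes "summable (\<lambda>m. c m * t ^ m)"
  shows "summable (\<lambda>m. c (m + k) * t ^ m)"
proof (cases "t = 0")
  case True
  show ?thesis unfolding True by (rule summable_0_powser)
next
  case False
  have "summable (\<lambda>m. c (m + k) * t ^ (m + k))"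
    using assms by (rule summable_ignore_initial_segment)
  then have "summable (\<lambda>m. c (m + k) * t ^ (m + k) / t ^ k)" by (rule summable_divide)
  then show ?thesis using False by (simp add: power_add)
qed

text \<open>The series is cut after degree 2p. Below the cut only even powers survive, which are
  polynomials in \<open>inner z z\<close>; the tail carries \<open>norm z\<close> to the power 2p+1,
  one more than the number of derivatives sought.\<close>

lemma radial_C_partials:
  assumes \<psi>: "has_power_series_0 \<psi> a" and odd: "\<And>c. 1 \<le> c \<Longrightarrow> c \<le> p \<Longrightarrow> a (2 * c - 1) = 0"
  shows "\<exists>\<rho>>0. C_partials (2 * p) (ball 0 \<rho>) (\<lambda>z :: real ^ 'd::finite. \<psi> (norm z))"
proof -
  obtain \<rho> where \<rho>: "\<rho> > 0" "\<And>t. \<bar>t\<bar> < \<rho> \<Longrightarrow> (\<lambda>m. a m * t ^ m) sums \<psi> t"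
    using \<psi> unfolding has_power_series_0_def by blast
  let ?c = "\<lambda>m. a (m + (2 * p + 1))"
  have summ: "summable (\<lambda>m. ?c m * t ^ m)" if "\<bar>t\<bar> < \<rho>" for t
    using sums_summable[OF \<rho>(2)[OF that]] by (rule summable_powser_shift)
  define poly where "poly z = (\<Sum>c\<le>p. a (2 * c) * (inner z z) ^ c)" for z :: "real ^ 'd"
  define rest where "rest z = norm z powi (2 * int p + 1) * (\<Sum>m. ?c m * norm z ^ m)" for z :: "real ^ 'd"
  have split: "\<psi> (norm z) = poly z + (if z = 0 then 0 else rest z)" if "z \<in> ball 0 \<rho>" for z
  proof -
    have z: "\<bar>norm z\<bar> < \<rho>" using that by simp
    have "\<psi> (norm z) = (\<Sum>m. a m * norm z ^ m)" using \<rho>(2)[OF z] by (rule sums_unique)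
    also have "\<dots> = (\<Sum>m. a (m + (2 * p + 1)) * norm z ^ (m + (2 * p + 1))) + (\<Sum>m<2 * p + 1. a m * norm z ^ m)"
      using sums_summable[OF \<rho>(2)[OF z]] by (rule suminf_split_initial_segment)
    also have "(\<Sum>m. a (m + (2 * p + 1)) * norm z ^ (m + (2 * p + 1))) =
        norm z ^ (2 * p + 1) * (\<Sum>m. ?c m * norm z ^ m)"
      using suminf_mult[OF summ[OF z], of "norm z ^ (2 * p + 1)"] by (simp add: power_add mult_ac)
    \<comment> \<open>The exponent is positive, so the tail vanishes at the origin and coincides
      with its patched form.\<close>
    also have "norm z ^ (2 * p + 1) * (\<Sum>m. ?c m * norm z ^ m) = (if z = 0 then 0 else rest z)"
    proof -
      have "norm z powi (2 * int p + 1) = norm z ^ (2 * p + 1)"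
        using power_int_of_nat[of "norm z" "2 * p + 1"] by (simp add: algebra_simps)
      then show ?thesis unfolding rest_def by simp
    qed
    also have "(\<Sum>m<2 * p + 1. a m * norm z ^ m) = (\<Sum>m\<in>(\<lambda>c. 2 * c) ` {..p}. a m * norm z ^ m)"
    proof (rule sum.mono_neutral_right)
      show "\<forall>m\<in>{..<2 * p + 1} - (\<lambda>c. 2 * c) ` {..p}. a m * norm z ^ m = 0"
      proof
        fix m assume m: "m \<in> {..<2 * p + 1} - (\<lambda>c. 2 * c) ` {..p}"
        have "odd m"
        proof
          assume "even m"
          then obtain c where "m = 2 * c" by blast
          then show False using m by auto
        qed
        then obtain c where "m = 2 * c + 1" by (rule oddE)
        then show "a m * norm z ^ m = 0" using odd[of "c + 1"] m by auto
      qed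
    qed auto
    also have "\<dots> = poly z"
      unfolding poly_def by (subst sum.reindex) (auto simp: inj_on_def power_mult dot_square_norm)
    finally show ?thesis by simp
  qed
  have "real_polynomial_function (\<lambda>z :: real ^ 'd. inner z z)"
    unfolding inner_vec_def inner_real_def
    by (intro real_polynomial_function_sum real_polynomial_function.intros(4) real_polynomial_function.intros(1))
      (auto intro: bounded_linear_vec_nth)
  then have "real_polynomial_function poly"
    unfolding poly_def
    by (intro real_polynomial_function_sum real_polynomial_function.intros(4)
        real_polynomial_function.intros(2) real_polynomial_function_power) auto
  then have "C_partials (2 * p) (ball 0 \<rho>) poly"
    using real_polynomial_function_C_partials C_partials_subset by blast
  moreover have "norm_order \<rho> (2 * int p + 1 + 0) rest"
    unfolding rest_def by (intro norm_order.mult norm_order.norm_powi norm_order.series summ)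
  then have "C_partials (2 * p) (ball 0 \<rho>) (\<lambda>z. if z = 0 then 0 else rest z)"
    by (intro norm_order_C_partials \<rho>(1)) auto
  ultimately have "C_partials (2 * p) (ball 0 \<rho>) (\<lambda>z. poly z + (if z = 0 then 0 else rest z))"
    by (rule C_partials_add)
  then have "C_partials (2 * p) (ball 0 \<rho>) (\<lambda>z :: real ^ 'd. \<psi> (norm z))"
    by (rule C_partials_cong[rotated 2]) (simp_all add: split)
  then show ?thesis using \<rho>(1) by blast
qed

text \<open>Only the difference of the arguments enters, so a letter of the first argument passes to
  a partial derivative of \<open>f\<close> and a letter of the second to its negative.\<close>

lemma translation_invariant_partial:
  fixes k :: "real ^ 'd::finite \<Rightarrow> real ^ 'd \<Rightarrow> real" and v :: "'d + 'd"
  assumes B: "open B" and k: "\<And>z. fst z - snd z \<in> B \<Longrightarrow> partial_fun k ws z = f (fst z - snd z)"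
    and D: "\<And>i. line_derivative B f (axis i 1) (g i)"
  defines "h \<equiv> case_sum (\<lambda>i. g i) (\<lambda>i z. - g i z) v"
  shows "line_derivative {z. fst z - snd z \<in> B} (partial_fun k ws) (partial_dir v) (\<lambda>z. h (fst z - snd z))"
    and "fst z - snd z \<in> B \<Longrightarrow> partial_fun k (v # ws) z = h (fst z - snd z)"
proof -
  let ?U = "{z :: (real ^ 'd) \<times> (real ^ 'd). fst z - snd z \<in> B}"
  have "?U = (\<lambda>z. fst z - snd z) -` B" by auto
  then have U: "open ?U" using B by (auto intro!: open_vimage continuous_intros)
  have "line_derivative ?U (\<lambda>z. f (fst z - snd z)) (partial_dir v) (\<lambda>z. h (fst z - snd z))"
    unfolding line_derivative_def
  proof
    fix z :: "(real ^ 'd) \<times> (real ^ 'd)" assume "z \<in> ?U"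
    then have z: "fst z - snd z \<in> B" by simp
    show "((\<lambda>t. f (fst (z + t *\<^sub>R partial_dir v) - snd (z + t *\<^sub>R partial_dir v))) has_real_derivative
        h (fst z - snd z)) (at 0)"
    proof (cases v)
      case (Inl i)
      have "((\<lambda>t. f (fst z - snd z + t *\<^sub>R axis i 1)) has_real_derivative g i (fst z - snd z)) (at 0)"
        using D z unfolding line_derivative_def by blast
      moreover have "fst (z + t *\<^sub>R partial_dir v) - snd (z + t *\<^sub>R partial_dir v) =
          fst z - snd z + t *\<^sub>R axis i 1" for t :: real
        unfolding Inl partial_dir_def by simp
      ultimately show ?thesis unfolding h_def by (simp only: Inl sum.case)
    next
      case (Inr i)
      have "((\<lambda>t. f (fst z - snd z + t *\<^sub>R axis i 1)) has_real_derivative g i (fst z - snd z)) (at (- 0))"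
        using D z unfolding line_derivative_def by simp
      then have "((\<lambda>t. f (fst z - snd z + (- t) *\<^sub>R axis i 1)) has_real_derivative - g i (fst z - snd z)) (at 0)"
        by (subst (asm) DERIV_mirror) simp
      moreover have "fst (z + t *\<^sub>R partial_dir v) - snd (z + t *\<^sub>R partial_dir v) =
          fst z - snd z + (- t) *\<^sub>R axis i 1" for t :: real
        unfolding Inr partial_dir_def by simp
      ultimately show ?thesis unfolding h_def by (simp only: Inr sum.case)
    qed
  qed
  then show L: "line_derivative ?U (partial_fun k ws) (partial_dir v) (\<lambda>z. h (fst z - snd z))"
    by (rule line_derivative_cong[OF U, rotated]) (simp add: k)
  assume "fst z - snd z \<in> B"
  then have "((\<lambda>t. partial_fun k ws (z + t *\<^sub>R partial_dir v)) has_real_derivative h (fst z - snd z)) (at 0)"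
    using L unfolding line_derivative_def by blast
  moreover have "(\<lambda>t. partial_fun k ws (z + t *\<^sub>R partial_dir v)) =
      partial_slice v (iter_partial ws k) (fst z) (snd z)"
    by (rule ext) (rule partial_slice_conv[symmetric])
  ultimately show "partial_fun k (v # ws) z = h (fst z - snd z)"
    by (simp add: DERIV_imp_deriv)
qed

lemma C_partials_uminus: "C_partials N B f \<Longrightarrow> C_partials N B (\<lambda>z. - f z)"
proof (induction N arbitrary: f)
  case 0
  then show ?case by (simp add: continuous_on_minus)
next
  case (Suc N)
  from Suc.prems obtain f' where f': "\<And>i. line_derivative B f (axis i 1) (f' i)"
    "\<And>i. C_partials N B (f' i)" by auto
  have "continuous_on B (\<lambda>z. - f z)" using Suc.prems by (simp add: continuous_on_minus)
  moreover have "line_derivative B (\<lambda>z. - f z) (axis i 1) (\<lambda>z. - f' i z)" for i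
    by (rule line_derivative_minus[OF f'(1)])
  moreover have "C_partials N B (\<lambda>z. - f' i z)" for i
    by (rule Suc.IH[OF f'(2)])
  ultimately show ?case
    unfolding C_partials.simps
    by (intro conjI exI[of _ "\<lambda>i z. - f' i z"] allI)
qed

text \<open>With at most \<open>q\<close> letters of each kind a word has length at most 2q, and
  each letter costs one derivative of \<open>f\<close>; this is the origin of the order
  \<open>2 * q\<close>.\<close>

lemma translation_invariant_Cqq:
  fixes k :: "real ^ 'd::finite \<Rightarrow> real ^ 'd \<Rightarrow> real"
  assumes B: "open B" "0 \<in> B" and k: "\<And>x y. k x y = f (x - y)" and f: "C_partials (2 * q) B f"
  shows "Cqq_near_0 q k"
proof -
  let ?U = "{z :: (real ^ 'd) \<times> (real ^ 'd). fst z - snd z \<in> B}"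
  have "?U = (\<lambda>z. fst z - snd z) -` B" by auto
  then have U: "open ?U" using B by (auto intro!: open_vimage continuous_intros)
  have main: "\<exists>g. C_partials (2 * q - length vs) B g \<and>
      (\<forall>z. fst z - snd z \<in> B \<longrightarrow> partial_fun k vs z = g (fst z - snd z))"
    if "length vs \<le> 2 * q" for vs
    using that
  proof (induction vs)
    case Nil
    then show ?case using f k by auto
  next
    case (Cons v vs)
    then obtain g where g: "C_partials (2 * q - length vs) B g"
      "\<And>z. fst z - snd z \<in> B \<Longrightarrow> partial_fun k vs z = g (fst z - snd z)" by auto
    have "2 * q - length vs = Suc (2 * q - length (v # vs))" using Cons.prems by simp
    then obtain g' where g': "\<And>i. line_derivative B g (axis i 1) (g' i)"
      "\<And>i. C_partials (2 * q - length (v # vs)) B (g' i)" using g(1) by auto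
    have "C_partials (2 * q - length (v # vs)) B (case_sum (\<lambda>i. g' i) (\<lambda>i z. - g' i z) v)"
      using g'(2) C_partials_uminus by (cases v) auto
    then show ?case using translation_invariant_partial(2)[OF B(1) g(2) g'(1)] by blast
  qed
  have len: "length vs \<le> 2 * q" if "partials_ok q vs" for vs :: "('d + 'd) list"
    using that sum_length_filter_compl[of isl vs] unfolding partials_ok_def by linarith
  have "Cqq_on q k ?U"
    unfolding Cqq_on_def
  proof (intro conjI allI impI)
    fix vs :: "('d + 'd) list" assume "partials_ok q vs"
    from main[OF len[OF this]] obtain g where g: "C_partials (2 * q - length vs) B g"
      "\<And>z. fst z - snd z \<in> B \<Longrightarrow> partial_fun k vs z = g (fst z - snd z)" by blast
    have "continuous_on ?U (\<lambda>z. g (fst z - snd z))"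
      by (rule continuous_on_compose2[OF C_partials_imp_continuous_on[OF g(1)]])
        (auto intro!: continuous_intros)
    then show "continuous_on ?U (partial_fun k vs)"
      by (rule continuous_on_eq) (simp add: g(2))
  next
    fix v :: "'d + 'd" and ws assume "partials_ok q (v # ws)"
    then have l: "length (v # ws) \<le> 2 * q" by (rule len)
    then obtain g where g: "C_partials (2 * q - length ws) B g"
      "\<And>z. fst z - snd z \<in> B \<Longrightarrow> partial_fun k ws z = g (fst z - snd z)" using main[of ws] by auto
    have "2 * q - length ws = Suc (2 * q - length (v # ws))" using l by simp
    then obtain g' where g': "\<And>i. line_derivative B g (axis i 1) (g' i)"
      using g(1) by auto
    note T = translation_invariant_partial[OF B(1) g(2) g', where v = v]
    show "line_derivative ?U (partial_fun k ws) (partial_dir v) (partial_fun k (v # ws))"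
      using T(1) T(2) unfolding line_derivative_def by (simp del: iter_partial.simps)
  qed (use U B in auto)
  then show ?thesis unfolding Cqq_near_0_iff by blast
qed

text \<open>Regularity index at least p+1 kills the odd coefficients up to 2p-1, so 2p+1 is the
  first odd power that may occur.\<close>

lemma radial_Cqq_near_0:
  fixes k :: "real ^ 'd::finite \<Rightarrow> real ^ 'd \<Rightarrow> real"
  assumes "\<And>x y. k x y = \<psi> (norm (x - y))" "has_power_series_0 \<psi> a" "regularity_index a r" "enat (p + 1) \<le> r"
  shows "Cqq_near_0 p k"
proof -
  have "a (2 * c - 1) = 0" if "1 \<le> c" "c \<le> p" for c
    using assms(3,4) that unfolding regularity_index_def by (cases r) auto
  from radial_C_partials[OF assms(2) this]
  obtain \<rho> where "\<rho> > 0" "C_partials (2 * p) (ball 0 \<rho>) (\<lambda>z :: real ^ 'd. \<psi> (norm z))" by blast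
  then show ?thesis
    by (intro translation_invariant_Cqq[of "ball 0 \<rho>" k "\<lambda>z. \<psi> (norm z)"]) (simp_all add: assms(1))
qed

subsection \<open>Indexing of block matrices\<close>

definition block_offset :: "(nat \<Rightarrow> nat) \<Rightarrow> nat \<Rightarrow> nat" where
  "block_offset b i = (\<Sum>l<i. b l)"

lemma block_offset_simps [simp]:
  "block_offset b 0 = 0" "block_offset b (Suc i) = block_offset b i + b i"
  by (simp_all add: block_offset_def)

lemma block_offset_mono: "i \<le> q \<Longrightarrow> block_offset b i \<le> block_offset b q"
  by (induction q) (auto simp: le_Suc_eq)

lemma block_offset_less: "i < q \<Longrightarrow> c < b i \<Longrightarrow> block_offset b i + c < block_offset b q"
  using block_offset_mono[of "Suc i" q b] by simp

lemma block_index_cases: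
  assumes "g < block_offset b q"
  obtains i c where "i < q" "c < b i" "g = block_offset b i + c"
proof -
  have "\<exists>i<q. \<exists>c<b i. g = block_offset b i + c"
    using assms
  proof (induction q)
    case (Suc q)
    show ?case
    proof (cases "g < block_offset b q")
      case True
      then show ?thesis using Suc.IH less_SucI by blast
    next
      case False
      then show ?thesis
        using Suc.prems by (intro exI[of _ q] conjI exI[of _ "g - block_offset b q"]) auto
    qed
  qed simp
  then show ?thesis using that by blast
qed

lemma sum_lessThan_add:
  fixes f :: "nat \<Rightarrow> real"
  shows "(\<Sum>g<m + k. f g) = (\<Sum>g<m. f g) + (\<Sum>c<k. f (m + c))"
  by (induction k) (simp_all add: add_ac)

lemma sum_block_offset:
  fixes f :: "nat \<Rightarrow> real"
  shows "(\<Sum>g<block_offset b q. f g) = (\<Sum>i<q. \<Sum>c<b i. f (block_offset b i + c))"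
  by (induction q) (simp_all add: sum_lessThan_add)

lemma block_row_carrier:
  assumes "\<And>i. i < q \<Longrightarrow> B i \<in> carrier_mat nr (cd i)"
  shows "block_row nr B q \<in> carrier_mat nr (block_offset cd q)"
  using assms
proof (induction q)
  case (Suc q)
  then have "block_row nr B q \<in> carrier_mat nr (block_offset cd q)" "B q \<in> carrier_mat nr (cd q)"
    by auto
  then show ?case by auto
qed simp

lemma block_row_index:
  assumes "\<And>i. i < q \<Longrightarrow> B i \<in> carrier_mat nr (cd i)" "r < nr" "l < q" "c < cd l"
  shows "block_row nr B q $$ (r, block_offset cd l + c) = B l $$ (r, c)"
  using assms
proof (induction q)
  case (Suc q)
  have 1: "block_row nr B q \<in> carrier_mat nr (block_offset cd q)"
    using block_row_carrier Suc.prems(1) by simp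
  have 2: "dim_row (B q) = nr" "dim_col (B q) = cd q" using Suc.prems(1)[of q] by auto
  have 3: "block_offset cd l + c < block_offset cd q + cd q"
    using block_offset_less[of l "Suc q" c cd] Suc.prems by simp
  show ?case
  proof (cases "l = q")
    case True
    then show ?thesis using 1 2 Suc.prems by simp
  next
    case False
    then have "l < q" using Suc.prems by simp
    then show ?thesis
      using 1 2 3 Suc block_offset_less[of l q c cd] by simp
  qed
qed simp

lemma block_col_carrier:
  assumes "\<And>i. i < q \<Longrightarrow> B i \<in> carrier_mat (rd i) nc"
  shows "block_col nc B q \<in> carrier_mat (block_offset rd q) nc"
  using assms
proof (induction q)
  case (Suc q)
  then have "block_col nc B q \<in> carrier_mat (block_offset rd q) nc" "B q \<in> carrier_mat (rd q) nc"
    by auto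
  then show ?case by (simp add: carrier_append_rows)
qed simp

lemma block_col_index:
  assumes "\<And>i. i < q \<Longrightarrow> B i \<in> carrier_mat (rd i) nc" "c < nc" "l < q" "r < rd l"
  shows "block_col nc B q $$ (block_offset rd l + r, c) = B l $$ (r, c)"
  using assms
proof (induction q)
  case (Suc q)
  have 1: "block_col nc B q \<in> carrier_mat (block_offset rd q) nc"
    using block_col_carrier Suc.prems(1) by simp
  have 2: "dim_row (B q) = rd q" "dim_col (B q) = nc" using Suc.prems(1)[of q] by auto
  have 3: "block_offset rd l + r < block_offset rd q + rd q"
    using block_offset_less[of l "Suc q" r rd] Suc.prems by simp
  show ?case
  proof (cases "l = q")
    case True
    then show ?thesis using 1 2 Suc.prems by (simp add: append_rows_def)
  next
    case False
    then have "l < q" using Suc.prems by simp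
    then show ?thesis
      using 1 2 3 Suc block_offset_less[of l q r rd] by (simp add: append_rows_def)
  qed
qed simp

lemma block_mat_carrier:
  assumes "\<And>i l. i < q \<Longrightarrow> l < q \<Longrightarrow> B i l \<in> carrier_mat (rd i) (cd l)"
  shows "block_mat rd cd B q \<in> carrier_mat (block_offset rd q) (block_offset cd q)"
  unfolding block_mat_def block_offset_def[of cd q, symmetric]
  by (intro block_col_carrier block_row_carrier assms)

lemma block_mat_index:
  assumes "\<And>i l. i < q \<Longrightarrow> l < q \<Longrightarrow> B i l \<in> carrier_mat (rd i) (cd l)"
    and "i < q" "r < rd i" "l < q" "c < cd l"
  shows "block_mat rd cd B q $$ (block_offset rd i + r, block_offset cd l + c) = B i l $$ (r, c)"
proof -
  have "block_mat rd cd B q $$ (block_offset rd i + r, block_offset cd l + c) =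
      block_row (rd i) (B i) q $$ (r, block_offset cd l + c)"
    unfolding block_mat_def block_offset_def[of cd q, symmetric]
    by (rule block_col_index) (use assms in \<open>auto intro: block_row_carrier block_offset_less\<close>)
  also have "\<dots> = B i l $$ (r, c)"
    by (rule block_row_index) (use assms in auto)
  finally show ?thesis .
qed

lemma mat_eq_blockI:
  assumes "A \<in> carrier_mat (block_offset rd q) (block_offset cd q')"
    and "B \<in> carrier_mat (block_offset rd q) (block_offset cd q')"
    and "\<And>i r l c. i < q \<Longrightarrow> r < rd i \<Longrightarrow> l < q' \<Longrightarrow> c < cd l \<Longrightarrow>
      A $$ (block_offset rd i + r, block_offset cd l + c) = B $$ (block_offset rd i + r, block_offset cd l + c)"
  shows "A = B"
proof (rule eq_matI)
  fix g g' assume "g < dim_row B" "g' < dim_col B"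
  then have "g < block_offset rd q" "g' < block_offset cd q'" using assms by auto
  then show "A $$ (g, g') = B $$ (g, g')"
    using assms(3) by (elim block_index_cases) auto
qed (use assms in auto)

lemma mult_mat_index:
  fixes A B :: "real mat"
  assumes "A \<in> carrier_mat m k" "B \<in> carrier_mat k l" "i < m" "j < l"
  shows "(A * B) $$ (i, j) = (\<Sum>g<k. A $$ (i, g) * B $$ (g, j))"
  using assms by (simp add: scalar_prod_def lessThan_atLeast0)

lemma mult_mat_vec_index:
  fixes A :: "real mat"
  assumes "A \<in> carrier_mat m k" "v \<in> carrier_vec k" "i < m"
  shows "(A *\<^sub>v v) $ i = (\<Sum>g<k. A $$ (i, g) * v $ g)"
  using assms by (simp add: scalar_prod_def lessThan_atLeast0)

subsection \<open>Invertible matrices and the rank\<close>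

text \<open>Invertibility makes \<open>A\<close> a unit of the matrix ring, so
  \<open>mat_inverse\<close> does not return \<open>None\<close> and \<open>inv_mat\<close> has a
  meaning.\<close>

lemma invertible_mat_inverse:
  fixes A :: "real mat"
  assumes "invertible_mat A" "A \<in> carrier_mat m m"
  shows "inv_mat A \<in> carrier_mat m m" "A * inv_mat A = 1\<^sub>m m" "inv_mat A * A = 1\<^sub>m m"
proof -
  obtain B where B: "inverts_mat A B" "inverts_mat B A"
    using assms(1) unfolding invertible_mat_def by blast
  then have AB: "A * B = 1\<^sub>m m" and BA: "B * A = 1\<^sub>m (dim_row B)"
    using assms(2) unfolding inverts_mat_def by auto
  from arg_cong[OF AB, of dim_col] arg_cong[OF BA, of dim_col] assms(2)
  have Bc: "B \<in> carrier_mat m m" by auto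
  then have "A \<in> Units (ring_mat TYPE(real) m ())"
    using AB BA assms(2) unfolding Units_def ring_mat_def by auto
  then obtain C where "mat_inverse A = Some C"
    using mat_inverse(1)[OF assms(2), of "()"] by (cases "mat_inverse A") auto
  then show "inv_mat A \<in> carrier_mat m m" "A * inv_mat A = 1\<^sub>m m" "inv_mat A * A = 1\<^sub>m m"
    using mat_inverse(2)[OF assms(2)] unfolding inv_mat_def by auto
qed

lemma invertible_mat_iff_det:
  fixes A :: "real mat"
  assumes "A \<in> carrier_mat m m"
  shows "invertible_mat A \<longleftrightarrow> det A \<noteq> 0"
proof
  assume "invertible_mat A"
  from invertible_mat_inverse[OF this assms] have "det A * det (inv_mat A) = 1"
    using det_mult[OF assms] by (metis det_one)
  then show "det A \<noteq> 0" by auto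
next
  assume "det A \<noteq> 0"
  then have "A \<in> Units (ring_mat TYPE(real) m ())"
    by (rule det_non_zero_imp_unit[OF assms])
  then obtain C where "C \<in> carrier_mat m m" "A * C = 1\<^sub>m m" "C * A = 1\<^sub>m m"
    unfolding Units_def ring_mat_def by auto
  then show "invertible_mat A"
    using assms unfolding invertible_mat_def inverts_mat_def square_mat.simps by auto
qed

lemma invertible_mat_iff_kernel:
  fixes A :: "real mat"
  assumes "A \<in> carrier_mat m m"
  shows "invertible_mat A \<longleftrightarrow> (\<forall>v\<in>carrier_vec m. A *\<^sub>v v = 0\<^sub>v m \<longrightarrow> v = 0\<^sub>v m)"
  using invertible_mat_iff_det[OF assms] det_0_iff_vec_prod_zero[OF assms] by blast

lemma invertible_mat_transpose:
  fixes A :: "real mat"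
  assumes "A \<in> carrier_mat m m"
  shows "invertible_mat (transpose_mat A) \<longleftrightarrow> invertible_mat A"
  using assms invertible_mat_iff_det[of A m] invertible_mat_iff_det[of "transpose_mat A" m] det_transpose[of A m]
  by auto

lemma invertible_mat_mult:
  fixes A B :: "real mat"
  assumes "A \<in> carrier_mat m m" "B \<in> carrier_mat m m"
  shows "invertible_mat (A * B) \<longleftrightarrow> invertible_mat A \<and> invertible_mat B"
  using assms invertible_mat_iff_det[of A m] invertible_mat_iff_det[of B m]
    invertible_mat_iff_det[of "A * B" m] det_mult[of A m B] by auto

lemma inv_mat_unique:
  fixes A C :: "real mat"
  assumes "A \<in> carrier_mat m m" "C \<in> carrier_mat m m" "A * C = 1\<^sub>m m"
  shows "inv_mat A = C"
proof -
  have "det A * det C = 1" using det_mult[OF assms(1,2)] assms(3) by simp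
  then have "invertible_mat A" using invertible_mat_iff_det[OF assms(1)] by auto
  note I = invertible_mat_inverse[OF this assms(1)]
  have "inv_mat A = inv_mat A * (A * C)" using I assms by simp
  also have "\<dots> = inv_mat A * A * C" by (rule assoc_mult_mat[symmetric]) (use I assms in auto)
  also have "\<dots> = C" using I assms by simp
  finally show ?thesis .
qed

context vec_space
begin

lemma rank_le_card_cols:
  assumes "A \<in> carrier_mat n nc"
  shows "\<exists>S. S \<subseteq> set (cols A) \<and> lin_indpt S \<and> rank A = card S"
proof -
  obtain S where S: "maximal S (\<lambda>T. T \<subseteq> set (cols A) \<and> lin_indpt T)"
    using maximal_exists[of "(\<lambda>T. T \<subseteq> set (cols A) \<and> lin_indpt T)" "card (set (cols A))" "{}"]
    by (meson List.finite_set card_mono empty_iff empty_subsetI finite_lin_indpt2 rev_finite_subset)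
  then show ?thesis using rank_card_indpt[OF assms S] unfolding maximal_def by blast
qed

text \<open>Linear independence speaks of the set of columns, so repetitions have to be excluded in
  both directions: by counting if the rank is \<open>nc\<close>, and because
  \<open>e_i - e_j\<close> would lie in the kernel if the columns \<open>i\<close> and
  \<open>j\<close> agreed.\<close>

lemma full_column_rank_iff_kernel:
  assumes A: "A \<in> carrier_mat n nc"
  shows "rank A = nc \<longleftrightarrow> (\<forall>v\<in>carrier_vec nc. A *\<^sub>v v = 0\<^sub>v n \<longrightarrow> v = 0\<^sub>v nc)"
proof
  assume r: "rank A = nc"
  obtain S where S: "S \<subseteq> set (cols A)" "rank A = card S" using rank_le_card_cols[OF A] by blast
  then have "nc \<le> card (set (cols A))" using r card_mono[OF _ S(1)] by auto
  moreover have "length (cols A) = nc" using A by simp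
  ultimately have dist: "distinct (cols A)"
    using card_length[of "cols A"] by (intro card_distinct) auto
  then have "lin_indpt (set (cols A))" using full_rank_lin_indpt[OF A r] by blast
  then show "\<forall>v\<in>carrier_vec nc. A *\<^sub>v v = 0\<^sub>v n \<longrightarrow> v = 0\<^sub>v nc"
    using lin_depI[OF A _ _ _ dist] by blast
next
  assume K: "\<forall>v\<in>carrier_vec nc. A *\<^sub>v v = 0\<^sub>v n \<longrightarrow> v = 0\<^sub>v nc"
  have dist: "distinct (cols A)"
  proof (rule ccontr)
    assume "\<not> distinct (cols A)"
    then obtain i j where ij: "i < nc" "j < nc" "i \<noteq> j" "cols A ! i = cols A ! j"
      using A unfolding distinct_conv_nth by auto
    then have c: "col A i = col A j" using A by simp
    have "A *\<^sub>v (unit_vec nc i - unit_vec nc j) = A *\<^sub>v unit_vec nc i - A *\<^sub>v unit_vec nc j"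
      using A by (intro mult_minus_distrib_mat_vec) auto
    also have "\<dots> = 0\<^sub>v n"
    proof (rule eq_vecI)
      fix a assume "a < dim_vec (0\<^sub>v n :: 'a vec)"
      then have a: "a < n" by simp
      have "col A i $ a = col A j $ a" using c by simp
      then show "(A *\<^sub>v unit_vec nc i - A *\<^sub>v unit_vec nc j) $ a = 0\<^sub>v n $ a"
        using A ij a by simp
    qed (use A in auto)
    finally have "unit_vec nc i - unit_vec nc j = (0\<^sub>v nc :: 'a vec)" using K by auto
    then have "(unit_vec nc i - unit_vec nc j) $ i = (0\<^sub>v nc :: 'a vec) $ i" by simp
    then show False using ij by simp
  qed
  have "lin_indpt (set (cols A))"
  proof (rule ccontr)
    assume "\<not> lin_indpt (set (cols A))"
    then obtain v where "v \<in> carrier_vec nc" "v \<noteq> 0\<^sub>v nc" "A *\<^sub>v v = 0\<^sub>v n"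
      using lin_depE[OF A _ dist] by blast
    then show False using K by blast
  qed
  then show "rank A = nc" using lin_indpt_full_rank[OF A dist] by blast
qed

text \<open>An independent set of \<open>n\<close> columns forms an invertible square matrix, and a
  vector orthogonal to all of its columns is zero.\<close>

lemma full_row_rank_left_kernel:
  assumes A: "A \<in> carrier_mat n nc" and r: "rank A = n"
    and y: "y \<in> carrier_vec n" and yA: "\<And>c. c < nc \<Longrightarrow> y \<bullet> col A c = 0"
  shows "y = 0\<^sub>v n"
proof -
  obtain S where S: "S \<subseteq> set (cols A)" "lin_indpt S" "rank A = card S"
    using rank_le_card_cols[OF A] by blast
  then have "finite S" using finite_subset by blast
  then obtain ss where ss: "set ss = S" "distinct ss" using finite_distinct_list by blast
  have Sc: "S \<subseteq> carrier_vec n" using S(1) A cols_dim by blast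
  define B where "B = mat_of_cols n ss"
  have len: "length ss = n" using ss S(3) r distinct_card by fastforce
  then have B: "B \<in> carrier_mat n n" unfolding B_def using mat_of_cols_carrier(1)[of n ss] by simp
  have cB: "cols B = ss" unfolding B_def using cols_mat_of_cols ss Sc by blast
  have "rank B = n" using lin_indpt_full_rank[OF B] cB ss S by simp
  then have "det B \<noteq> 0" using det_rank_iff[OF B] by simp
  then have dT: "det (transpose_mat B) \<noteq> 0" using det_transpose[OF B] by simp
  have "transpose_mat B *\<^sub>v y = 0\<^sub>v n"
  proof (rule eq_vecI)
    fix i assume "i < dim_vec (0\<^sub>v n :: 'a vec)"
    then have i: "i < n" by simp
    have "cols B ! i = col B i" using B i by simp
    then have "col B i \<in> set (cols A)" using cB ss S(1) len i nth_mem by (metis subsetD)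
    then obtain c where c: "c < nc" "col B i = col A c"
      using A by (metis carrier_matD(2) cols_length cols_nth in_set_conv_nth)
    have "(transpose_mat B *\<^sub>v y) $ i = col B i \<bullet> y" using B i by simp
    also have "\<dots> = y \<bullet> col B i" by (rule comm_scalar_prod[of _ n]) (use B y i in auto)
    finally show "(transpose_mat B *\<^sub>v y) $ i = 0\<^sub>v n $ i" using yA c i by simp
  qed (use B in auto)
  then show ?thesis
    using det_0_iff_vec_prod_zero[of "transpose_mat B" n] dT B y by auto
qed

end

subsection \<open>Block QR factorisation\<close>

declare block_row.simps(2) [simp del] block_col.simps(2) [simp del]

lemma right_inverse_imp_left_inverse:
  fixes A B :: "real mat"
  assumes "A \<in> carrier_mat m m" "B \<in> carrier_mat m m" "A * B = 1\<^sub>m m"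
  shows "B * A = 1\<^sub>m m"
  using mat_mult_left_right_inverse[OF assms] .

lemma vec_block_eqI:
  assumes "v \<in> carrier_vec (block_offset b q)" "w \<in> carrier_vec (block_offset b q)"
    and "\<And>i c. i < q \<Longrightarrow> c < b i \<Longrightarrow> v $ (block_offset b i + c) = w $ (block_offset b i + c)"
  shows "v = w"
proof (rule eq_vecI)
  fix g assume "g < dim_vec w"
  then have "g < block_offset b q" using assms by simp
  then show "v $ g = w $ g" using assms(3) by (elim block_index_cases) auto
qed (use assms in auto)

text \<open>Row and column sizes are kept apart because the diagonal blocks \<open>R_{i,i}\<close>
  of the factorisation are b_i by h_i.\<close>

definition block_diag :: "(nat \<Rightarrow> nat) \<Rightarrow> (nat \<Rightarrow> nat) \<Rightarrow> (nat \<Rightarrow> real mat) \<Rightarrow> nat \<Rightarrow> real mat" where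
  "block_diag rd cd D q = block_mat rd cd (\<lambda>i l. if i = l then D i else 0\<^sub>m (rd i) (cd l)) q"

lemma block_diag_carrier:
  assumes "\<And>i. i < q \<Longrightarrow> D i \<in> carrier_mat (rd i) (cd i)"
  shows "block_diag rd cd D q \<in> carrier_mat (block_offset rd q) (block_offset cd q)"
  unfolding block_diag_def by (intro block_mat_carrier) (use assms in auto)

lemma block_diag_index:
  assumes "\<And>i. i < q \<Longrightarrow> D i \<in> carrier_mat (rd i) (cd i)" "i < q" "r < rd i" "l < q" "c < cd l"
  shows "block_diag rd cd D q $$ (block_offset rd i + r, block_offset cd l + c) =
    (if i = l then D i $$ (r, c) else 0)"
  unfolding block_diag_def by (subst block_mat_index) (use assms in auto)

lemma sum_block_diag:
  fixes f :: "nat \<Rightarrow> real"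
  assumes "\<And>i. i < q \<Longrightarrow> D i \<in> carrier_mat (rd i) (cd i)" "i < q" "r < rd i"
  shows "(\<Sum>g<block_offset cd q. block_diag rd cd D q $$ (block_offset rd i + r, g) * f g) =
    (\<Sum>c<cd i. D i $$ (r, c) * f (block_offset cd i + c))"
proof -
  have "(\<Sum>g<block_offset cd q. block_diag rd cd D q $$ (block_offset rd i + r, g) * f g) =
      (\<Sum>l<q. if i = l then (\<Sum>c<cd i. D i $$ (r, c) * f (block_offset cd i + c)) else 0)"
    unfolding sum_block_offset using assms by (intro sum.cong) (auto simp: block_diag_index)
  then show ?thesis using assms(2) by simp
qed

lemma invertible_block_diag:
  assumes D: "\<And>i. i < q \<Longrightarrow> D i \<in> carrier_mat (b i) (b i)" and inv: "\<And>i. i < q \<Longrightarrow> invertible_mat (D i)"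
  shows "invertible_mat (block_diag b b D q)"
proof -
  have Dc: "block_diag b b D q \<in> carrier_mat (block_offset b q) (block_offset b q)"
    by (rule block_diag_carrier[OF D])
  show ?thesis
    unfolding invertible_mat_iff_kernel[OF Dc]
  proof (intro ballI impI)
    fix v assume v: "v \<in> carrier_vec (block_offset b q)"
      and eq: "block_diag b b D q *\<^sub>v v = 0\<^sub>v (block_offset b q)"
    show "v = 0\<^sub>v (block_offset b q)"
    proof (rule vec_block_eqI[OF v])
      fix i c assume ic: "i < q" "c < b i"
      define y where "y = vec (b i) (\<lambda>c. v $ (block_offset b i + c))"
      have "D i *\<^sub>v y = 0\<^sub>v (b i)"
      proof (rule eq_vecI)
        fix r assume "r < dim_vec (0\<^sub>v (b i))"
        then have r: "r < b i" by simp
        have "(D i *\<^sub>v y) $ r = (\<Sum>c<b i. D i $$ (r, c) * v $ (block_offset b i + c))"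
          using mult_mat_vec_index[OF D[OF ic(1)], of y r] r unfolding y_def by simp
        also have "\<dots> = (\<Sum>g<block_offset b q. block_diag b b D q $$ (block_offset b i + r, g) * v $ g)"
          using sum_block_diag[of q D b b i r "\<lambda>g. v $ g"] D ic(1) r by simp
        also have "\<dots> = (block_diag b b D q *\<^sub>v v) $ (block_offset b i + r)"
          by (rule mult_mat_vec_index[symmetric, OF Dc v]) (auto intro: block_offset_less ic r)
        finally show "(D i *\<^sub>v y) $ r = 0\<^sub>v (b i) $ r"
          using eq block_offset_less[of i q r b] ic r by simp
      qed (use D[OF ic(1)] in auto)
      then have "y = 0\<^sub>v (b i)"
        using inv[OF ic(1)] invertible_mat_iff_kernel[OF D[OF ic(1)]] unfolding y_def by auto
      then have "y $ c = 0" using ic by simp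
      then show "v $ (block_offset b i + c) = 0\<^sub>v (block_offset b q) $ (block_offset b i + c)"
        using ic block_offset_less[of i q c b] unfolding y_def by simp
    qed simp
  qed
qed

locale qr_blocks =
  fixes n p :: nat and h b :: "nat \<Rightarrow> nat" and V Q :: "nat \<Rightarrow> real mat" and R :: "nat \<Rightarrow> nat \<Rightarrow> real mat"
  assumes QR: "block_QR n p h b V Q R" and V: "\<And>s. V s \<in> carrier_mat n (h s)"
begin

lemma Q_carrier: "i \<le> p \<Longrightarrow> Q i \<in> carrier_mat n (b i)"
  and R_carrier: "i \<le> p \<Longrightarrow> l \<le> p \<Longrightarrow> R i l \<in> carrier_mat (b i) (h l)"
  and R_lower: "i \<le> p \<Longrightarrow> l < i \<Longrightarrow> R i l = 0\<^sub>m (b i) (h l)"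
  using QR unfolding block_QR_def by auto

definition Qf :: "real mat" where "Qf = block_row n Q (Suc p)"

lemma Qf_carrier: "Qf \<in> carrier_mat n n"
  using QR unfolding block_QR_def Qf_def by auto

lemma offset_n: "block_offset b (Suc p) = n"
  using block_row_carrier[of "Suc p" Q n b] Q_carrier Qf_carrier unfolding Qf_def
  by (metis carrier_matD(2) less_Suc_eq_le)

lemma offset_le_n: "i \<le> p \<Longrightarrow> block_offset b i + b i \<le> n"
  using block_offset_mono[of "Suc i" "Suc p" b] offset_n by simp

lemma Qf_index: "i \<le> p \<Longrightarrow> c < b i \<Longrightarrow> a < n \<Longrightarrow> Qf $$ (a, block_offset b i + c) = Q i $$ (a, c)"
  unfolding Qf_def by (rule block_row_index) (auto intro: Q_carrier)

lemma Qf_orthogonal: "transpose_mat Qf * Qf = 1\<^sub>m n" "Qf * transpose_mat Qf = 1\<^sub>m n"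
proof -
  show "transpose_mat Qf * Qf = 1\<^sub>m n" using QR unfolding block_QR_def Qf_def by auto
  then show "Qf * transpose_mat Qf = 1\<^sub>m n"
    by (intro right_inverse_imp_left_inverse[of "transpose_mat Qf"]) (use Qf_carrier in auto)
qed

lemma Qf_cols: "g < n \<Longrightarrow> g' < n \<Longrightarrow> (\<Sum>a<n. Qf $$ (a, g) * Qf $$ (a, g')) = (if g = g' then 1 else 0)"
proof -
  assume g: "g < n" "g' < n"
  have "(transpose_mat Qf * Qf) $$ (g, g') = (\<Sum>a<n. Qf $$ (a, g) * Qf $$ (a, g'))"
    using mult_mat_index[of "transpose_mat Qf" n n Qf n g g'] Qf_carrier g by simp
  then show ?thesis using Qf_orthogonal(1) g by simp
qed

lemma V_index_Qf: "s \<le> p \<Longrightarrow> c < h s \<Longrightarrow> a < n \<Longrightarrow>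
  V s $$ (a, c) = (\<Sum>i<Suc p. \<Sum>c'<b i. Qf $$ (a, block_offset b i + c') * R i s $$ (c', c))"
proof -
  assume s: "s \<le> p" "c < h s" "a < n"
  let ?R = "block_mat b h R (Suc p)"
  have Rc: "?R \<in> carrier_mat n (block_offset h (Suc p))"
    using block_mat_carrier[of "Suc p" R b h] R_carrier offset_n by simp
  have "V s $$ (a, c) = block_row n V (Suc p) $$ (a, block_offset h s + c)"
    by (rule block_row_index[symmetric]) (use V s in auto)
  also have "\<dots> = (Qf * ?R) $$ (a, block_offset h s + c)"
    using QR unfolding block_QR_def Qf_def by simp
  also have "\<dots> = (\<Sum>g<n. Qf $$ (a, g) * ?R $$ (g, block_offset h s + c))"
    by (rule mult_mat_index[OF Qf_carrier Rc]) (use s block_offset_less[of s "Suc p" c h] in auto)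
  also have "\<dots> = (\<Sum>i<Suc p. \<Sum>c'<b i. Qf $$ (a, block_offset b i + c') * ?R $$ (block_offset b i + c', block_offset h s + c))"
    unfolding offset_n[symmetric] sum_block_offset ..
  also have "\<dots> = (\<Sum>i<Suc p. \<Sum>c'<b i. Qf $$ (a, block_offset b i + c') * R i s $$ (c', c))"
  proof (intro sum.cong refl)
    fix i c' assume "i \<in> {..<Suc p}" "c' \<in> {..<b i}"
    then have "?R $$ (block_offset b i + c', block_offset h s + c) = R i s $$ (c', c)"
      by (intro block_mat_index) (use s R_carrier in auto)
    then show "Qf $$ (a, block_offset b i + c') * ?R $$ (block_offset b i + c', block_offset h s + c) =
        Qf $$ (a, block_offset b i + c') * R i s $$ (c', c)" by simp
  qed
  finally show ?thesis .
qed

lemma V_index: "s \<le> p \<Longrightarrow> c < h s \<Longrightarrow> a < n \<Longrightarrow>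
  V s $$ (a, c) = (\<Sum>i<Suc p. \<Sum>c'<b i. Q i $$ (a, c') * R i s $$ (c', c))"
  unfolding V_index_Qf by (intro sum.cong refl) (simp add: Qf_index)

text \<open>The orthonormal columns of \<open>Qf\<close> extract one block row of \<open>R\<close>.
  Together with \<open>R_lower\<close> this shows that the columns of \<open>Q_i\<close> annihilate
  all monomials of degree below \<open>i\<close>.\<close>

lemma Qf_V: "i \<le> p \<Longrightarrow> c' < b i \<Longrightarrow> s \<le> p \<Longrightarrow> c < h s \<Longrightarrow>
  (\<Sum>a<n. Qf $$ (a, block_offset b i + c') * V s $$ (a, c)) = R i s $$ (c', c)"
proof -
  assume i: "i \<le> p" "c' < b i" and s: "s \<le> p" "c < h s"
  let ?g = "block_offset b i + c'"
  have gn: "block_offset b l + c'' < n" if "l \<le> p" "c'' < b l" for l c''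
    using offset_le_n[OF that(1)] that(2) by simp
  have "(\<Sum>a<n. Qf $$ (a, ?g) * V s $$ (a, c)) =
      (\<Sum>a<n. \<Sum>l<Suc p. \<Sum>c''<b l. Qf $$ (a, ?g) * Qf $$ (a, block_offset b l + c'') * R l s $$ (c'', c))"
    by (intro sum.cong refl) (simp add: V_index_Qf s sum_distrib_left mult.assoc del: sum.lessThan_Suc)
  also have "\<dots> = (\<Sum>l<Suc p. \<Sum>c''<b l. \<Sum>a<n. Qf $$ (a, ?g) * Qf $$ (a, block_offset b l + c'') * R l s $$ (c'', c))"
    by (rule trans[OF sum.swap], rule sum.cong[OF refl], rule sum.swap)
  also have "\<dots> = (\<Sum>l<Suc p. \<Sum>c''<b l. if ?g = block_offset b l + c'' then R l s $$ (c'', c) else 0)"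
    by (intro sum.cong refl) (auto simp: Qf_cols gn i simp flip: sum_distrib_right)
  also have "\<dots> = (\<Sum>l<Suc p. if l = i then R i s $$ (c', c) else 0)"
  proof (intro sum.cong refl)
    fix l assume l: "l \<in> {..<Suc p}"
    show "(\<Sum>c''<b l. if ?g = block_offset b l + c'' then R l s $$ (c'', c) else 0) =
        (if l = i then R i s $$ (c', c) else 0)"
    proof (cases "l = i")
      case True
      then show ?thesis using i by simp
    next
      case False
      \<comment> \<open>Different blocks occupy disjoint index ranges.\<close>
      have "?g \<noteq> block_offset b l + c''" if "c'' < b l" for c''
        using False block_offset_mono[of "Suc i" l b] block_offset_mono[of "Suc l" i b] i that
        by (cases "i < l") auto
      then show ?thesis using False by (intro sum.neutral[THEN trans]) auto
    qed
  qed
  also have "\<dots> = R i s $$ (c', c)" using i by simp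
  finally show ?thesis .
qed

lemma transpose_Q_V: "i \<le> p \<Longrightarrow> s \<le> p \<Longrightarrow> transpose_mat (Q i) * V s = R i s"
proof -
  assume i: "i \<le> p" and s: "s \<le> p"
  have d: "dim_row (R i s) = b i" "dim_col (R i s) = h s" using R_carrier[OF i s] by auto
  show ?thesis
  proof (rule eq_matI)
    fix c' c assume "c' < dim_row (R i s)" "c < dim_col (R i s)"
    then have c: "c' < b i" "c < h s" using d by auto
    have "(transpose_mat (Q i) * V s) $$ (c', c) = (\<Sum>a<n. Q i $$ (a, c') * V s $$ (a, c))"
      using mult_mat_index[of "transpose_mat (Q i)" "b i" n "V s" "h s" c' c] Q_carrier[OF i] V[of s] c
      by simp
    then show "(transpose_mat (Q i) * V s) $$ (c', c) = R i s $$ (c', c)"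
      using Qf_V[OF i c(1) s c(2)] Qf_index[OF i c(1)] by simp
  qed (use Q_carrier[OF i] V[of s] d in auto)
qed

text \<open>The factorisation can be truncated because the block rows of \<open>R\<close> beyond
  \<open>q\<close> vanish on the columns of degree at most \<open>q\<close>.\<close>

lemma block_row_QR:
  assumes q: "q \<le> p"
  shows "block_row n V (Suc q) = block_row n Q (Suc q) * block_mat b h R (Suc q)"
proof -
  let ?R = "block_mat b h R (Suc q)" and ?Q = "block_row n Q (Suc q)"
  have Rc: "?R \<in> carrier_mat (block_offset b (Suc q)) (block_offset h (Suc q))"
    using block_mat_carrier[of "Suc q" R b h] R_carrier q by simp
  have Qc: "?Q \<in> carrier_mat n (block_offset b (Suc q))"
    by (rule block_row_carrier) (use Q_carrier q in auto)
  have Vc: "block_row n V (Suc q) \<in> carrier_mat n (block_offset h (Suc q))"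
    by (rule block_row_carrier) (rule V)
  show ?thesis
  proof (rule eq_matI)
    fix a g assume "a < dim_row (?Q * ?R)" "g < dim_col (?Q * ?R)"
    then have a: "a < n" and "g < block_offset h (Suc q)" using Rc Qc by auto
    then obtain s c where s: "s < Suc q" "c < h s" "g = block_offset h s + c"
      using block_index_cases by blast
    have "(?Q * ?R) $$ (a, g) = (\<Sum>i<Suc q. \<Sum>c'<b i. ?Q $$ (a, block_offset b i + c') * ?R $$ (block_offset b i + c', g))"
      using mult_mat_index[OF Qc Rc a] block_offset_less[of s "Suc q" c h] s(1,2) unfolding s(3) sum_block_offset by simp
    also have "\<dots> = (\<Sum>i<Suc q. \<Sum>c'<b i. Q i $$ (a, c') * R i s $$ (c', c))"
    proof (intro sum.cong refl)
      fix i c' assume i: "i \<in> {..<Suc q}" "c' \<in> {..<b i}"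
      have "?R $$ (block_offset b i + c', g) = R i s $$ (c', c)"
        unfolding s(3) by (rule block_mat_index) (use i s q R_carrier in auto)
      moreover have "?Q $$ (a, block_offset b i + c') = Q i $$ (a, c')"
        by (rule block_row_index) (use i q a Q_carrier in auto)
      ultimately show "?Q $$ (a, block_offset b i + c') * ?R $$ (block_offset b i + c', g) =
          Q i $$ (a, c') * R i s $$ (c', c)" by simp
    qed
    also have "\<dots> = (\<Sum>i<Suc p. \<Sum>c'<b i. Q i $$ (a, c') * R i s $$ (c', c))"
    proof (rule sum.mono_neutral_left)
      show "\<forall>i\<in>{..<Suc p} - {..<Suc q}. (\<Sum>c'<b i. Q i $$ (a, c') * R i s $$ (c', c)) = 0"
        using R_lower s by (auto intro!: sum.neutral)
    qed (use q in auto)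
    also have "\<dots> = V s $$ (a, c)" using V_index[of s c a] s q a by simp
    also have "\<dots> = block_row n V (Suc q) $$ (a, g)"
      unfolding s(3) by (rule block_row_index[symmetric]) (use V s a in auto)
    finally show "block_row n V (Suc q) $$ (a, g) = (?Q * ?R) $$ (a, g)" by simp
  qed (use Rc Qc Vc in auto)
qed

text \<open>Padding a kernel vector of the shorter matrix with zeros gives one of the longer
  matrix.\<close>

lemma kernel_block_row_mono:
  assumes K: "\<forall>v\<in>carrier_vec (block_offset h q). block_row n V q *\<^sub>v v = 0\<^sub>v n \<longrightarrow> v = 0\<^sub>v (block_offset h q)"
    and q: "q' \<le> q" and v: "v \<in> carrier_vec (block_offset h q')" "block_row n V q' *\<^sub>v v = 0\<^sub>v n"
  shows "v = 0\<^sub>v (block_offset h q')"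
proof -
  have Vc: "block_row n V i \<in> carrier_mat n (block_offset h i)" for i
    by (rule block_row_carrier) (rule V)
  have le: "block_offset h q' \<le> block_offset h q" using q by (rule block_offset_mono)
  define w where "w = vec (block_offset h q) (\<lambda>g. if g < block_offset h q' then v $ g else 0)"
  have "block_row n V q *\<^sub>v w = 0\<^sub>v n"
  proof (rule eq_vecI)
    fix a assume "a < dim_vec (0\<^sub>v n)"
    then have a: "a < n" by simp
    have "(block_row n V q *\<^sub>v w) $ a = (\<Sum>g<block_offset h q. block_row n V q $$ (a, g) * w $ g)"
      by (rule mult_mat_vec_index[OF Vc _ a]) (simp add: w_def)
    also have "\<dots> = (\<Sum>g<block_offset h q'. block_row n V q $$ (a, g) * w $ g)"
      by (rule sum.mono_neutral_right) (use le in \<open>auto simp: w_def\<close>)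
    also have "\<dots> = (\<Sum>g<block_offset h q'. block_row n V q' $$ (a, g) * v $ g)"
    proof (intro sum.cong refl)
      fix g assume "g \<in> {..<block_offset h q'}"
      then have g: "g < block_offset h q'" by simp
      then obtain s c where s: "s < q'" "c < h s" "g = block_offset h s + c"
        by (rule block_index_cases)
      have "block_row n V q $$ (a, g) = V s $$ (a, c)" "block_row n V q' $$ (a, g) = V s $$ (a, c)"
        unfolding s(3) by (rule block_row_index; use V s a q in auto)+
      then show "block_row n V q $$ (a, g) * w $ g = block_row n V q' $$ (a, g) * v $ g"
        using g le unfolding w_def by simp
    qed
    also have "\<dots> = (block_row n V q' *\<^sub>v v) $ a"
      by (rule mult_mat_vec_index[OF Vc v(1) a, symmetric])
    finally show "(block_row n V q *\<^sub>v w) $ a = 0\<^sub>v n $ a" using v(2) by simp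
  qed (use Vc[of q] in auto)
  then have "w = 0\<^sub>v (block_offset h q)" using K unfolding w_def by simp
  then have "w $ g = 0" if "g < block_offset h q'" for g using that le by simp
  then have "v $ g = 0" if "g < block_offset h q'" for g
    using that le unfolding w_def by simp
  then show ?thesis using v(1) by (intro eq_vecI) auto
qed

end

text \<open>\<open>rk\<close> is shifted by one: \<open>rk i\<close> belongs to the first
  \<open>i\<close> column blocks, that is, to degrees below \<open>i\<close>, so \<open>rk 0\<close>
  is the rank for degree -1 and full column rank up to degree \<open>j\<close> is a condition at
  \<open>Suc j\<close>.\<close>

locale qr_blocks_full = qr_blocks +
  fixes j :: nat and rk :: "nat \<Rightarrow> nat"
  assumes rk_def: "rk = (\<lambda>s. vec_space.rank n (block_row n V s))"
    and b_def: "b = (\<lambda>i. rk (Suc i) - rk i)"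
    and j: "j \<le> p"
    and full: "rk (Suc j) = dim_col (block_row n V (Suc j))"
begin

lemma V_row_carrier: "block_row n V i \<in> carrier_mat n (block_offset h i)"
  by (rule block_row_carrier) (rule V)

lemma kernel_V:
  assumes "i \<le> Suc j" "v \<in> carrier_vec (block_offset h i)" "block_row n V i *\<^sub>v v = 0\<^sub>v n"
  shows "v = 0\<^sub>v (block_offset h i)"
proof -
  have "vec_space.rank n (block_row n V (Suc j)) = block_offset h (Suc j)"
    using full V_row_carrier[of "Suc j"] unfolding rk_def by simp
  then show ?thesis
    using kernel_block_row_mono[OF _ assms] vec_space.full_column_rank_iff_kernel[OF V_row_carrier] by blast
qed

lemma rk_eq: "i \<le> Suc j \<Longrightarrow> rk i = block_offset h i"
  unfolding rk_def vec_space.full_column_rank_iff_kernel[OF V_row_carrier] using kernel_V by blast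

lemma b_eq_h: "i \<le> j \<Longrightarrow> b i = h i"
  unfolding b_def by (simp add: rk_eq)

lemma offset_eq: "i \<le> Suc j \<Longrightarrow> block_offset b i = block_offset h i"
  unfolding block_offset_def by (intro sum.cong) (auto simp: b_eq_h)

text \<open>Up to degree \<open>i\<close> the triangular factor is square, and it is injective since
  \<open>V\<close> has full column rank. Its last block row is \<open>(0 ... 0 R_{i,i})\<close>, so
  a kernel vector of the transpose of \<open>R_{i,i}\<close>, padded with zeros in front, lies in
  the kernel of the transposed factor.\<close>

lemma invertible_R:
  assumes i: "i \<le> j"
  shows "invertible_mat (R i i)"
proof -
  have ip: "i \<le> p" using i j by simp
  define m where "m = block_offset b (Suc i)"
  have mh: "m = block_offset h (Suc i)" unfolding m_def using i by (intro offset_eq) simp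
  let ?D = "block_mat b h R (Suc i)"
  have Dc: "?D \<in> carrier_mat m m"
    using block_mat_carrier[of "Suc i" R b h] R_carrier ip mh unfolding m_def by simp
  have Qc: "block_row n Q (Suc i) \<in> carrier_mat n m"
    unfolding m_def by (rule block_row_carrier) (use Q_carrier ip in auto)
  have "invertible_mat ?D"
    unfolding invertible_mat_iff_kernel[OF Dc]
  proof (intro ballI impI)
    fix v assume v: "v \<in> carrier_vec m" "?D *\<^sub>v v = 0\<^sub>v m"
    have "block_row n V (Suc i) *\<^sub>v v = block_row n Q (Suc i) *\<^sub>v (?D *\<^sub>v v)"
      unfolding block_row_QR[OF ip] by (rule assoc_mult_mat_vec[OF Qc Dc v(1)])
    also have "\<dots> = 0\<^sub>v n" unfolding v(2) using Qc by auto
    finally show "v = 0\<^sub>v m" using kernel_V[of "Suc i" v] i v(1) unfolding mh by simp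
  qed
  then have "invertible_mat (transpose_mat ?D)" using invertible_mat_transpose[OF Dc] by blast
  moreover have "transpose_mat ?D \<in> carrier_mat m m" using Dc by simp
  ultimately have inj: "y = 0\<^sub>v m" if "y \<in> carrier_vec m" "transpose_mat ?D *\<^sub>v y = 0\<^sub>v m" for y
    using that invertible_mat_iff_kernel by blast
  have Rc: "R i i \<in> carrier_mat (b i) (b i)" using R_carrier[OF ip ip] b_eq_h[OF i] by simp
  then have RTc: "transpose_mat (R i i) \<in> carrier_mat (b i) (b i)" by simp
  have "invertible_mat (transpose_mat (R i i))"
    unfolding invertible_mat_iff_kernel[OF RTc]
  proof (intro ballI impI)
    fix y assume y: "y \<in> carrier_vec (b i)" "transpose_mat (R i i) *\<^sub>v y = 0\<^sub>v (b i)"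
    define z where "z = vec m (\<lambda>g. if g < block_offset b i then 0 else y $ (g - block_offset b i))"
    have z: "z \<in> carrier_vec m" unfolding z_def by simp
    have zy: "z $ (block_offset b i + c) = y $ c" if "c < b i" for c
      using that unfolding z_def m_def by simp
    have Dz: "transpose_mat ?D *\<^sub>v z \<in> carrier_vec m" using Dc z by auto
    have "transpose_mat ?D *\<^sub>v z = 0\<^sub>v m"
    proof (rule vec_block_eqI[of _ h "Suc i"])
      fix l c assume lc: "l < Suc i" "c < h l"
      let ?g = "block_offset h l + c"
      have gm: "?g < m" unfolding mh using block_offset_less[of l "Suc i" c h] lc by simp
      have "(transpose_mat ?D *\<^sub>v z) $ ?g = (\<Sum>g<block_offset b (Suc i). transpose_mat ?D $$ (?g, g) * z $ g)"
        using mult_mat_vec_index[of "transpose_mat ?D" m m z ?g] Dc z gm unfolding m_def by simp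
      also have "\<dots> = (\<Sum>g<block_offset b i. transpose_mat ?D $$ (?g, g) * z $ g) +
          (\<Sum>c'<b i. transpose_mat ?D $$ (?g, block_offset b i + c') * z $ (block_offset b i + c'))"
        by (simp add: sum_lessThan_add)
      also have "(\<Sum>g<block_offset b i. transpose_mat ?D $$ (?g, g) * z $ g) = 0"
        by (rule sum.neutral) (auto simp: z_def m_def)
      also have "(\<Sum>c'<b i. transpose_mat ?D $$ (?g, block_offset b i + c') * z $ (block_offset b i + c')) =
          (\<Sum>c'<b i. R i l $$ (c', c) * y $ c')"
      proof (intro sum.cong refl)
        fix c' assume c': "c' \<in> {..<b i}"
        have "?D $$ (block_offset b i + c', ?g) = R i l $$ (c', c)"
          by (rule block_mat_index) (use c' lc R_carrier ip in auto)
        moreover have "block_offset b i + c' < m" using c' unfolding m_def by simp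
        ultimately show "transpose_mat ?D $$ (?g, block_offset b i + c') * z $ (block_offset b i + c') =
            R i l $$ (c', c) * y $ c'" using Dc gm zy c' by simp
      qed
      also have "\<dots> = 0"
      proof (cases "l = i")
        case True
        have c: "c < b i" using lc True b_eq_h[OF i] by simp
        have "(\<Sum>c'<b i. R i l $$ (c', c) * y $ c') = (transpose_mat (R i i) *\<^sub>v y) $ c"
          using mult_mat_vec_index[OF RTc y(1) c] Rc c True by simp
        then show ?thesis using y(2) c by simp
      next
        case False
        then have "R i l = 0\<^sub>m (b i) (h l)" using lc R_lower[OF ip] by simp
        then show ?thesis using lc by (intro sum.neutral) auto
      qed
      finally show "(transpose_mat ?D *\<^sub>v z) $ ?g = 0\<^sub>v m $ ?g" using gm by simp
    qed (use Dz in \<open>simp_all only: mh[symmetric] zero_carrier_vec\<close>)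
    then have "z = 0\<^sub>v m" using inj z by blast
    then have "y $ c = 0" if "c < b i" for c
      using zy[OF that] that unfolding m_def by simp
    then show "y = 0\<^sub>v (b i)" using y(1) by (intro eq_vecI) auto
  qed
  then show ?thesis using invertible_mat_transpose[OF Rc] by simp
qed

end

locale qr_schur = qr_blocks_full +
  fixes W H :: "nat \<Rightarrow> nat \<Rightarrow> real mat"
  assumes W: "\<And>i l. W i l \<in> carrier_mat (h i) (h l)"
    and H_def: "H = (\<lambda>i l. R i i * W i l * transpose_mat (R l l))"
begin

text \<open>Congruence by this matrix takes \<open>W\<close> to \<open>H\<close>, as
  \<open>H\<close> is built from the diagonal blocks of \<open>R\<close> alone.\<close>

definition D :: "nat \<Rightarrow> real mat" where "D q = block_diag b h (\<lambda>i. R i i) q"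

lemma R_diag_carrier: "i \<le> j \<Longrightarrow> R i i \<in> carrier_mat (b i) (h i)"
  using R_carrier j by simp

lemma H_carrier: "i \<le> p \<Longrightarrow> l \<le> p \<Longrightarrow> H i l \<in> carrier_mat (b i) (b l)"
  unfolding H_def using R_carrier[of i i] R_carrier[of l l] W[of i l] by auto

lemma H_index:
  assumes "i \<le> p" "l \<le> p" "r < b i" "c < b l"
  shows "H i l $$ (r, c) = (\<Sum>c1<h i. \<Sum>c2<h l. R i i $$ (r, c1) * W i l $$ (c1, c2) * R l l $$ (c, c2))"
proof -
  have Ri: "R i i \<in> carrier_mat (b i) (h i)" and Rl: "transpose_mat (R l l) \<in> carrier_mat (h l) (b l)"
    using R_carrier assms by auto
  have "H i l $$ (r, c) = (\<Sum>c2<h l. (R i i * W i l) $$ (r, c2) * transpose_mat (R l l) $$ (c2, c))"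
    unfolding H_def by (rule mult_mat_index[OF mult_carrier_mat[OF Ri W] Rl]) (use assms in auto)
  also have "\<dots> = (\<Sum>c2<h l. \<Sum>c1<h i. R i i $$ (r, c1) * W i l $$ (c1, c2) * R l l $$ (c, c2))"
    using mult_mat_index[OF Ri W] Rl assms by (auto intro!: sum.cong simp: sum_distrib_right)
  finally show ?thesis by (subst sum.swap)
qed

lemma D_carrier: "q \<le> Suc j \<Longrightarrow> D q \<in> carrier_mat (block_offset b q) (block_offset h q)"
  unfolding D_def by (intro block_diag_carrier R_diag_carrier) simp

lemma invertible_D: "q \<le> Suc j \<Longrightarrow> invertible_mat (D q)"
proof -
  assume q: "q \<le> Suc j"
  have "invertible_mat (block_diag b b (\<lambda>i. R i i) q)"
    using R_diag_carrier b_eq_h invertible_R q by (intro invertible_block_diag) (auto simp: less_Suc_eq_le)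
  \<comment> \<open>Up to degree \<open>j\<close> the sizes b_i and h_i agree, so the rectangular
    block diagonal matrix is the square one.\<close>
  moreover have "block_diag b b (\<lambda>i. R i i) q = D q"
  proof (rule mat_eq_blockI[of _ b q b q])
    show "block_diag b b (\<lambda>i. R i i) q \<in> carrier_mat (block_offset b q) (block_offset b q)"
      using R_diag_carrier b_eq_h q by (intro block_diag_carrier) (auto simp: less_Suc_eq_le)
    show "D q \<in> carrier_mat (block_offset b q) (block_offset b q)"
      using D_carrier[OF q] offset_eq[OF q] by simp
    fix i r l c assume a: "i < q" "r < b i" "l < q" "c < b l"
    have ho: "block_offset h l = block_offset b l" "b l = h l"
      using offset_eq[of l] b_eq_h[of l] a q by auto
    have Rb: "R i' i' \<in> carrier_mat (b i') (b i')" if "i' < q" for i'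
      using R_diag_carrier[of i'] b_eq_h[of i'] that q by simp
    have "D q $$ (block_offset b i + r, block_offset h l + c) = (if i = l then R i i $$ (r, c) else 0)"
      unfolding D_def by (rule block_diag_index) (use R_diag_carrier a q ho in auto)
    then show "block_diag b b (\<lambda>i. R i i) q $$ (block_offset b i + r, block_offset b l + c) =
        D q $$ (block_offset b i + r, block_offset b l + c)"
      using block_diag_index[of q "\<lambda>i. R i i" b b i r l c] Rb a ho by simp
  qed
  ultimately show ?thesis by simp
qed

lemma W_block_carrier: "block_mat h h W q \<in> carrier_mat (block_offset h q) (block_offset h q)"
  by (intro block_mat_carrier W)

lemma H_block_carrier: "q \<le> Suc j \<Longrightarrow> block_mat b b H q \<in> carrier_mat (block_offset b q) (block_offset b q)"
  using j by (intro block_mat_carrier H_carrier) auto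

lemma H_block: 
  assumes q: "q \<le> Suc j"
  shows "block_mat b b H q = D q * block_mat h h W q * transpose_mat (D q)"
proof (rule mat_eq_blockI[of _ b q b q])
  note Dc = D_carrier[OF q] and Wc = W_block_carrier[of q]
  show "block_mat b b H q \<in> carrier_mat (block_offset b q) (block_offset b q)"
    by (rule H_block_carrier[OF q])
  show "D q * block_mat h h W q * transpose_mat (D q) \<in> carrier_mat (block_offset b q) (block_offset b q)"
    using Dc Wc by auto
  fix i r l c assume a: "i < q" "r < b i" "l < q" "c < b l"
  let ?g = "block_offset b i + r" and ?g' = "block_offset b l + c"
  have g: "?g < block_offset b q" "?g' < block_offset b q" using a by (auto intro: block_offset_less)
  have Rd: "R i' i' \<in> carrier_mat (b i') (h i')" if "i' < q" for i' using R_diag_carrier[of i'] that q by simp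
  have DT: "transpose_mat (D q) \<in> carrier_mat (block_offset h q) (block_offset b q)" using Dc by simp
  have "(D q * block_mat h h W q * transpose_mat (D q)) $$ (?g, ?g') =
     (\<Sum>m<block_offset h q. (D q * block_mat h h W q) $$ (?g, m) * transpose_mat (D q) $$ (m, ?g'))"
    by (rule mult_mat_index[OF mult_carrier_mat[OF Dc Wc] DT g])
  also have "\<dots> =
     (\<Sum>m<block_offset h q. D q $$ (?g', m) * (\<Sum>m'<block_offset h q. D q $$ (?g, m') * block_mat h h W q $$ (m', m)))"
    using Dc g by (intro sum.cong refl) (simp add: mult_mat_index[OF Dc Wc] mult.commute del: index_mult_mat(1))
  also have "\<dots> = (\<Sum>c2<h l. R l l $$ (c, c2) *
      (\<Sum>c1<h i. R i i $$ (r, c1) * block_mat h h W q $$ (block_offset h i + c1, block_offset h l + c2)))"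
    unfolding D_def using sum_block_diag[of q "\<lambda>i. R i i" b h] Rd a by simp
  also have "\<dots> = (\<Sum>c2<h l. \<Sum>c1<h i. R i i $$ (r, c1) * W i l $$ (c1, c2) * R l l $$ (c, c2))"
    using block_mat_index[of q W h h i _ l] W a by (auto intro!: sum.cong simp: sum_distrib_left mult_ac)
  also have "\<dots> = (\<Sum>c1<h i. \<Sum>c2<h l. R i i $$ (r, c1) * W i l $$ (c1, c2) * R l l $$ (c, c2))"
    by (rule sum.swap)
  also have "\<dots> = H i l $$ (r, c)" using H_index[of i l r c] a q j by simp
  also have "\<dots> = block_mat b b H q $$ (?g, ?g')"
    by (rule block_mat_index[symmetric]) (use H_carrier a q j in auto)
  finally show "block_mat b b H q $$ (?g, ?g') = (D q * block_mat h h W q * transpose_mat (D q)) $$ (?g, ?g')" ..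
qed

lemma H_row: "block_row (b j) (H j) j = R j j * block_row (h j) (W j) j * transpose_mat (D j)"
proof -
  have Dc: "D j \<in> carrier_mat (block_offset b j) (block_offset h j)" by (rule D_carrier) simp
  have Wc: "block_row (h j) (W j) j \<in> carrier_mat (h j) (block_offset h j)"
    by (intro block_row_carrier W)
  have Hc: "block_row (b j) (H j) j \<in> carrier_mat (b j) (block_offset b j)"
    using j by (intro block_row_carrier H_carrier) auto
  have Rc: "R j j \<in> carrier_mat (b j) (h j)" by (rule R_diag_carrier) simp
  have Rd: "R i' i' \<in> carrier_mat (b i') (h i')" if "i' < j" for i' using R_diag_carrier[of i'] that by simp
  show ?thesis
  proof (rule eq_matI)
    fix r g assume "r < dim_row (R j j * block_row (h j) (W j) j * transpose_mat (D j))"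
      "g < dim_col (R j j * block_row (h j) (W j) j * transpose_mat (D j))"
    then have r: "r < b j" and "g < block_offset b j" using Rc Dc by auto
    then obtain l c where l: "l < j" "c < b l" "g = block_offset b l + c" by (elim block_index_cases)
    have g: "g < block_offset b j" unfolding l(3) using block_offset_less[of l j c b] l(1,2) by simp
    have DT: "transpose_mat (D j) \<in> carrier_mat (block_offset h j) (block_offset b j)" using Dc by simp
    have "(R j j * block_row (h j) (W j) j * transpose_mat (D j)) $$ (r, g) =
       (\<Sum>m<block_offset h j. (R j j * block_row (h j) (W j) j) $$ (r, m) * transpose_mat (D j) $$ (m, g))"
      by (rule mult_mat_index[OF mult_carrier_mat[OF Rc Wc] DT r g])
    also have "\<dots> =
       (\<Sum>m<block_offset h j. D j $$ (g, m) * (\<Sum>c1<h j. R j j $$ (r, c1) * block_row (h j) (W j) j $$ (c1, m)))"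
      using Dc g r by (intro sum.cong refl) (simp add: mult_mat_index[OF Rc Wc] mult.commute del: index_mult_mat(1))
    also have "\<dots> = (\<Sum>c2<h l. R l l $$ (c, c2) *
        (\<Sum>c1<h j. R j j $$ (r, c1) * block_row (h j) (W j) j $$ (c1, block_offset h l + c2)))"
      unfolding D_def l(3) using sum_block_diag[of j "\<lambda>i. R i i" b h] Rd l by simp
    also have "\<dots> = (\<Sum>c2<h l. \<Sum>c1<h j. R j j $$ (r, c1) * W j l $$ (c1, c2) * R l l $$ (c, c2))"
      using block_row_index[of j "W j" "h j" h _ l] W l by (auto intro!: sum.cong simp: sum_distrib_left mult_ac)
    also have "\<dots> = (\<Sum>c1<h j. \<Sum>c2<h l. R j j $$ (r, c1) * W j l $$ (c1, c2) * R l l $$ (c, c2))"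
      by (rule sum.swap)
    also have "\<dots> = H j l $$ (r, c)" using H_index[of j l r c] l r j by simp
    also have "\<dots> = block_row (b j) (H j) j $$ (r, g)"
      unfolding l(3) by (rule block_row_index[symmetric]) (use H_carrier l r j in auto)
    finally show "block_row (b j) (H j) j $$ (r, g) = (R j j * block_row (h j) (W j) j * transpose_mat (D j)) $$ (r, g)" ..
  qed (use Rc Dc Hc in auto)
qed

lemma invertible_H_block:
  assumes q: "q \<le> Suc j"
  shows "invertible_mat (block_mat b b H q) \<longleftrightarrow> invertible_mat (block_mat h h W q)"
proof -
  have o: "block_offset h q = block_offset b q" using offset_eq[OF q] by simp
  have Dc: "D q \<in> carrier_mat (block_offset b q) (block_offset b q)" using D_carrier[OF q] o by simp
  have Wc: "block_mat h h W q \<in> carrier_mat (block_offset b q) (block_offset b q)"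
    using W_block_carrier[of q] o by simp
  show ?thesis
    unfolding H_block[OF q]
    using invertible_mat_mult[OF Dc Wc] invertible_mat_mult[OF mult_carrier_mat[OF Dc Wc], of "transpose_mat (D q)"]
      invertible_mat_transpose[OF Dc] invertible_D[OF q] Dc by auto
qed

text \<open>Schur complements are compatible with block diagonal congruence. The inverse of
  \<open>D\<close> is never formed: with \<open>X\<close> the inverse of the \<open>H\<close>-block,
  \<open>D (W D^T X) = 1\<close> implies \<open>(W D^T X) D = 1\<close>, so \<open>D^T X D\<close>
  inverts the \<open>W\<close>-block, and the factors \<open>D\<close> in \<open>H_{j,<j}\<close>
  are absorbed into it.\<close>

lemma schur_complement_H:
  assumes inv: "invertible_mat (block_mat h h W j)"
  shows "H j j - block_row (b j) (H j) j * inv_mat (block_mat b b H j) * transpose_mat (block_row (b j) (H j) j) =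
    R j j * (W j j - block_row (h j) (W j) j * inv_mat (block_mat h h W j) *
      transpose_mat (block_row (h j) (W j) j)) * transpose_mat (R j j)"
proof -
  define m where "m = block_offset b j"
  have o: "block_offset h j = m" unfolding m_def using offset_eq[of j] by simp
  let ?D = "D j" and ?W = "block_mat h h W j" and ?H = "block_mat b b H j" and ?w = "block_row (h j) (W j) j"
  define X where "X = inv_mat ?H"
  have Dc: "?D \<in> carrier_mat m m" using D_carrier[of j] o unfolding m_def by simp
  have Wc: "?W \<in> carrier_mat m m" using W_block_carrier[of j] o by simp
  have wc: "?w \<in> carrier_mat (h j) m" using block_row_carrier[of j "W j" "h j" h] W o by simp
  have Hc: "?H \<in> carrier_mat m m" using H_block_carrier[of j] unfolding m_def by simp
  have Rc: "R j j \<in> carrier_mat (b j) (h j)" by (rule R_diag_carrier) simp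
  have "invertible_mat ?H" using invertible_H_block[of j] inv by simp
  note X = invertible_mat_inverse[OF this Hc, folded X_def]
  have WDX: "?W * transpose_mat ?D * X \<in> carrier_mat m m" using Wc Dc X by auto
  have "?D * (?W * transpose_mat ?D * X) = ?H * X"
    unfolding H_block[of j, simplified] using Dc Wc X(1)
    by (simp add: assoc_mult_mat[of _ m m _ m _ m])
  then have "?D * (?W * transpose_mat ?D * X) = 1\<^sub>m m" using X by simp
  then have "?W * transpose_mat ?D * X * ?D = 1\<^sub>m m"
    by (rule right_inverse_imp_left_inverse[OF Dc WDX])
  moreover have "?W * transpose_mat ?D * X * ?D = ?W * (transpose_mat ?D * X * ?D)"
    using Dc Wc X(1) by (simp add: assoc_mult_mat[of _ m m _ m _ m])
  ultimately have Wi: "inv_mat ?W = transpose_mat ?D * X * ?D"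
    using Dc Wc X(1) by (intro inv_mat_unique[of _ m]) auto
  let ?A = "?w * inv_mat ?W * transpose_mat ?w"
  have Ac: "?A \<in> carrier_mat (h j) (h j)" using wc Wi Dc X by auto
  have "block_row (b j) (H j) j * X * transpose_mat (block_row (b j) (H j) j) =
      R j j * ?w * transpose_mat ?D * X * transpose_mat (R j j * ?w * transpose_mat ?D)"
    unfolding H_row ..
  also have "transpose_mat (R j j * ?w * transpose_mat ?D) = ?D * (transpose_mat ?w * transpose_mat (R j j))"
    using transpose_mult[OF mult_carrier_mat[OF Rc wc], of "transpose_mat ?D" m] transpose_mult[OF Rc wc] Dc by simp
  also have "R j j * ?w * transpose_mat ?D * X * (?D * (transpose_mat ?w * transpose_mat (R j j))) =
      R j j * ?w * inv_mat ?W * (transpose_mat ?w * transpose_mat (R j j))"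
  proof -
    have Y: "transpose_mat ?w * transpose_mat (R j j) \<in> carrier_mat m (b j)" using wc Rc by auto
    have Rw: "R j j * ?w \<in> carrier_mat (b j) m" using wc Rc by auto
    have DT: "transpose_mat ?D \<in> carrier_mat m m" using Dc by simp
    have "R j j * ?w * transpose_mat ?D * X * (?D * (transpose_mat ?w * transpose_mat (R j j))) =
        R j j * ?w * transpose_mat ?D * X * ?D * (transpose_mat ?w * transpose_mat (R j j))"
      by (rule assoc_mult_mat[symmetric, OF _ Dc Y]) (use Rw DT X(1) in auto)
    also have "R j j * ?w * transpose_mat ?D * X * ?D = R j j * ?w * (transpose_mat ?D * X * ?D)"
      using assoc_mult_mat[OF Rw DT X(1)] assoc_mult_mat[OF Rw mult_carrier_mat[OF DT X(1)] Dc] by simp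
    finally show ?thesis unfolding Wi .
  qed
  also have "\<dots> = R j j * ?A * transpose_mat (R j j)"
  proof -
    have Wic: "inv_mat ?W \<in> carrier_mat m m" using Wi Dc X by auto
    have wT: "transpose_mat ?w \<in> carrier_mat m (h j)" and RT: "transpose_mat (R j j) \<in> carrier_mat (h j) (b j)"
      using wc Rc by auto
    have Rw: "R j j * ?w \<in> carrier_mat (b j) m" using wc Rc by auto
    have "R j j * ?w * inv_mat ?W * (transpose_mat ?w * transpose_mat (R j j)) =
        R j j * ?w * inv_mat ?W * transpose_mat ?w * transpose_mat (R j j)"
      by (rule assoc_mult_mat[symmetric, OF mult_carrier_mat[OF Rw Wic] wT RT])
    also have "R j j * ?w * inv_mat ?W * transpose_mat ?w = R j j * ?A"
      using assoc_mult_mat[OF Rc wc Wic] assoc_mult_mat[OF Rc mult_carrier_mat[OF wc Wic] wT] by simp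
    finally show ?thesis .
  qed
  finally have 1: "block_row (b j) (H j) j * X * transpose_mat (block_row (b j) (H j) j) =
      R j j * ?A * transpose_mat (R j j)" .
  have "R j j * (W j j - ?A) * transpose_mat (R j j) = (R j j * W j j - R j j * ?A) * transpose_mat (R j j)"
    using mult_minus_distrib_mat[OF Rc W Ac] by simp
  also have "\<dots> = H j j - R j j * ?A * transpose_mat (R j j)"
    unfolding H_def by (rule minus_mult_distrib_mat[of _ "b j" "h j"]) (use Rc W[of j j] Ac in auto)
  finally show ?thesis using 1 unfolding X_def by simp
qed

end

subsection \<open>Limits of linear systems\<close>

text \<open>By the Leibniz formula a determinant is a polynomial in the entries.\<close>

lemma tendsto_det_mat:
  fixes f :: "'a \<Rightarrow> nat \<Rightarrow> nat \<Rightarrow> real"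
  assumes "\<And>i j. i < m \<Longrightarrow> j < m \<Longrightarrow> ((\<lambda>\<epsilon>. f \<epsilon> i j) \<longlongrightarrow> g i j) F"
  shows "((\<lambda>\<epsilon>. det (mat m m (\<lambda>(i, j). f \<epsilon> i j))) \<longlongrightarrow> det (mat m m (\<lambda>(i, j). g i j))) F"
proof -
  have *: "det (mat m m (\<lambda>(i, j). h i j)) =
      (\<Sum>p\<in>{p. p permutes {0..<m}}. signof p * (\<Prod>i = 0..<m. h i (p i)))" for h :: "nat \<Rightarrow> nat \<Rightarrow> real"
    unfolding det_def by (auto intro!: sum.cong prod.cong simp: permutes_in_image)
  show ?thesis
    unfolding * by (intro tendsto_intros assms) (auto simp: permutes_in_image)
qed

lemma cofactor_mat:
  assumes "i < m" "j < m"
  shows "cofactor (mat m m (\<lambda>(a, b). h a b)) i j = (-1) ^ (i + j) *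
    det (mat (m - 1) (m - 1) (\<lambda>(a, b). h (if a < i then a else Suc a) (if b < j then b else Suc b)))"
proof -
  have "mat_delete (mat m m (\<lambda>(a, b). h a b)) i j =
      mat (m - 1) (m - 1) (\<lambda>(a, b). h (if a < i then a else Suc a) (if b < j then b else Suc b))"
    by (rule eq_matI) (use assms in \<open>auto simp: mat_delete_def\<close>)
  then show ?thesis unfolding cofactor_def by simp
qed

text \<open>Nothing is known beforehand about the size of \<open>w\<close>. Cramer's rule expresses
  it through cofactors, the determinant and the right-hand side, all of which converge, and the
  limiting determinant is nonzero.\<close>

lemma tendsto_linear_system:
  fixes f :: "'a \<Rightarrow> nat \<Rightarrow> nat \<Rightarrow> real"
  assumes f: "\<And>i j. i < m \<Longrightarrow> j < m \<Longrightarrow> ((\<lambda>\<epsilon>. f \<epsilon> i j) \<longlongrightarrow> g i j) F"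
    and r: "\<And>i. i < m \<Longrightarrow> ((\<lambda>\<epsilon>. r \<epsilon> i) \<longlongrightarrow> r0 i) F"
    and sys: "\<And>i. i < m \<Longrightarrow> \<forall>\<^sub>F \<epsilon> in F. (\<Sum>j<m. f \<epsilon> i j * w \<epsilon> j) = r \<epsilon> i"
    and g: "det (mat m m (\<lambda>(i, j). g i j)) \<noteq> 0"
  shows "\<exists>w0. \<forall>i<m. ((\<lambda>\<epsilon>. w \<epsilon> i) \<longlongrightarrow> w0 i) F"
proof -
  define A where "A \<epsilon> = mat m m (\<lambda>(i, j). f \<epsilon> i j)" for \<epsilon>
  define A0 where "A0 = mat m m (\<lambda>(i, j). g i j)"
  have Ac: "A \<epsilon> \<in> carrier_mat m m" for \<epsilon> unfolding A_def by simp
  have det: "((\<lambda>\<epsilon>. det (A \<epsilon>)) \<longlongrightarrow> det A0) F"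
    unfolding A_def A0_def by (rule tendsto_det_mat[OF f])
  have cof: "((\<lambda>\<epsilon>. cofactor (A \<epsilon>) i j) \<longlongrightarrow> cofactor A0 i j) F" if "i < m" "j < m" for i j
    unfolding A_def A0_def cofactor_mat[OF that]
    by (intro tendsto_mult tendsto_const tendsto_det_mat f) auto
  have cramer: "(\<Sum>k<m. cofactor (A \<epsilon>) k i * (\<Sum>j<m. f \<epsilon> k j * w \<epsilon> j)) = det (A \<epsilon>) * w \<epsilon> i"
    if i: "i < m" for \<epsilon> i
  proof -
    have adj: "(\<Sum>k<m. cofactor (A \<epsilon>) k i * f \<epsilon> k j) = (if i = j then det (A \<epsilon>) else 0)" if j: "j < m" for j
    proof -
      have "(adj_mat (A \<epsilon>) * A \<epsilon>) $$ (i, j) = (\<Sum>k<m. cofactor (A \<epsilon>) k i * f \<epsilon> k j)"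
        using i j adj_mat(1)[OF Ac] Ac[of \<epsilon>]
        by (simp add: scalar_prod_def lessThan_atLeast0 adj_mat_def A_def)
      then show ?thesis using adj_mat(3)[OF Ac] i j by (cases "i = j") auto
    qed
    have "(\<Sum>k<m. cofactor (A \<epsilon>) k i * (\<Sum>j<m. f \<epsilon> k j * w \<epsilon> j)) =
        (\<Sum>k<m. \<Sum>j<m. cofactor (A \<epsilon>) k i * f \<epsilon> k j * w \<epsilon> j)"
      by (simp add: sum_distrib_left mult_ac)
    also have "\<dots> = (\<Sum>j<m. \<Sum>k<m. cofactor (A \<epsilon>) k i * f \<epsilon> k j * w \<epsilon> j)" by (rule sum.swap)
    also have "\<dots> = (\<Sum>j<m. (if i = j then det (A \<epsilon>) else 0) * w \<epsilon> j)"
      by (intro sum.cong refl) (simp add: adj flip: sum_distrib_right)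
    also have "\<dots> = det (A \<epsilon>) * w \<epsilon> i"
      using i by (simp add: if_distrib[of "\<lambda>x. x * _"] cong: if_cong)
    finally show ?thesis .
  qed
  have "((\<lambda>\<epsilon>. w \<epsilon> i) \<longlongrightarrow> (\<Sum>k<m. cofactor A0 k i * r0 k) / det A0) F" if i: "i < m" for i
  proof -
    have "((\<lambda>\<epsilon>. (\<Sum>k<m. cofactor (A \<epsilon>) k i * r \<epsilon> k) / det (A \<epsilon>)) \<longlongrightarrow>
        (\<Sum>k<m. cofactor A0 k i * r0 k) / det A0) F"
      using g unfolding A0_def[symmetric]
      by (intro tendsto_divide tendsto_sum tendsto_mult cof r det) (use i in auto)
    moreover have "\<forall>\<^sub>F \<epsilon> in F. det (A \<epsilon>) \<noteq> 0"
      using tendsto_imp_eventually_ne[OF det] g unfolding A0_def by blast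
    moreover have "\<forall>\<^sub>F \<epsilon> in F. \<forall>k\<in>{..<m}. (\<Sum>j<m. f \<epsilon> k j * w \<epsilon> j) = r \<epsilon> k"
      using sys by (intro eventually_ball_finite) auto
    ultimately show ?thesis
    proof (elim Lim_transform_eventually)
      assume "\<forall>\<^sub>F \<epsilon> in F. det (A \<epsilon>) \<noteq> 0"
        "\<forall>\<^sub>F \<epsilon> in F. \<forall>k\<in>{..<m}. (\<Sum>j<m. f \<epsilon> k j * w \<epsilon> j) = r \<epsilon> k"
      then show "\<forall>\<^sub>F \<epsilon> in F. (\<Sum>k<m. cofactor (A \<epsilon>) k i * r \<epsilon> k) / det (A \<epsilon>) = w \<epsilon> i"
      proof eventually_elim
        case (elim \<epsilon>)
        have "(\<Sum>k<m. cofactor (A \<epsilon>) k i * r \<epsilon> k) = det (A \<epsilon>) * w \<epsilon> i"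
          unfolding cramer[OF i, symmetric] using elim(2) by (intro sum.cong) auto
        then show ?case using elim(1) by simp
      qed
    qed
  qed
  then show ?thesis
    by (intro exI[of _ "\<lambda>i. (\<Sum>k<m. cofactor A0 k i * r0 k) / det A0"] allI impI)
qed

subsection \<open>Limiting eigenvectors of graded matrices\<close>

text \<open>In the decomposition of the diagonal entry all summands are nonnegative, so each one is
  at most \<open>M\<close>; dividing by the eigenvalue bounds the squared component by a multiple of
  eps^(2j - a).\<close>

lemma eigenvector_limit_small_order:
  fixes M :: "real \<Rightarrow> real" and lam v :: "nat \<Rightarrow> real \<Rightarrow> real"
  assumes M: "((\<lambda>\<epsilon>. M \<epsilon> / \<epsilon> ^ (2 * j)) \<longlongrightarrow> H) (at_right 0)"
    and dec: "\<forall>\<^sub>F \<epsilon> in at_right 0. M \<epsilon> = (\<Sum>k<n. lam k \<epsilon> * (v k \<epsilon>)\<^sup>2)"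
    and pos: "\<And>k. k < n \<Longrightarrow> \<forall>\<^sub>F \<epsilon> in at_right 0. lam k \<epsilon> > 0"
    and k: "k < n"
    and lead: "((\<lambda>\<epsilon>. lam k \<epsilon> / \<epsilon> ^ a) \<longlongrightarrow> c) (at_right 0)" "c > 0" "a < 2 * j"
    and v: "(v k \<longlongrightarrow> v0) (at_right 0)"
  shows "v0 = 0"
proof -
  have ev0: "\<forall>\<^sub>F \<epsilon> in at_right 0. (0 :: real) < \<epsilon>" by (rule eventually_at_right_less)
  have posall: "\<forall>\<^sub>F \<epsilon> in at_right 0. \<forall>k\<in>{..<n}. lam k \<epsilon> > 0"
    using pos by (intro eventually_ball_finite) auto
  have "((\<lambda>\<epsilon>. (v k \<epsilon>)\<^sup>2) \<longlongrightarrow> 0) (at_right 0)"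
  proof (rule tendsto_sandwich[OF _ _ tendsto_const])
    show "\<forall>\<^sub>F \<epsilon> in at_right 0. (v k \<epsilon>)\<^sup>2 \<le> M \<epsilon> / \<epsilon> ^ (2 * j) / (lam k \<epsilon> / \<epsilon> ^ a) * \<epsilon> ^ (2 * j - a)"
      using dec posall ev0
    proof eventually_elim
      case (elim \<epsilon>)
      have "lam k \<epsilon> * (v k \<epsilon>)\<^sup>2 \<le> M \<epsilon>"
        unfolding elim(1)
        by (rule member_le_sum[of k "{..<n}" "\<lambda>k. lam k \<epsilon> * (v k \<epsilon>)\<^sup>2"])
          (use elim k in \<open>auto intro!: mult_nonneg_nonneg simp: less_imp_le\<close>)
      then have "(v k \<epsilon>)\<^sup>2 \<le> M \<epsilon> / lam k \<epsilon>"
        using elim k by (simp add: field_simps)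
      also have "\<dots> = M \<epsilon> / \<epsilon> ^ (2 * j) / (lam k \<epsilon> / \<epsilon> ^ a) * \<epsilon> ^ (2 * j - a)"
      proof -
        have p: "\<epsilon> ^ (2 * j) = \<epsilon> ^ a * \<epsilon> ^ (2 * j - a)"
          using lead(3) by (simp flip: power_add)
        have "lam k \<epsilon> > 0" using elim(2) k by simp
        then show ?thesis unfolding p using elim(3) by (simp add: field_simps)
      qed
      finally show ?case .
    qed
    have "((\<lambda>\<epsilon>. \<epsilon> ^ (2 * j - a)) \<longlongrightarrow> (0 :: real) ^ (2 * j - a)) (at_right 0)"
      by (intro tendsto_power tendsto_ident_at)
    then have "((\<lambda>\<epsilon>. M \<epsilon> / \<epsilon> ^ (2 * j) / (lam k \<epsilon> / \<epsilon> ^ a) * \<epsilon> ^ (2 * j - a)) \<longlongrightarrow>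
        H / c * 0 ^ (2 * j - a)) (at_right 0)"
      using lead(2) by (intro tendsto_mult tendsto_divide M lead) auto
    then show "((\<lambda>\<epsilon>. M \<epsilon> / \<epsilon> ^ (2 * j) / (lam k \<epsilon> / \<epsilon> ^ a) * \<epsilon> ^ (2 * j - a)) \<longlongrightarrow> 0) (at_right 0)"
      using lead(3) by (simp add: power_0_left)
  qed auto
  moreover have "((\<lambda>\<epsilon>. (v k \<epsilon>)\<^sup>2) \<longlongrightarrow> v0\<^sup>2) (at_right 0)" by (intro tendsto_power v)
  ultimately have "v0\<^sup>2 = 0"
    using tendsto_unique trivial_limit_at_right_real by blast
  then show ?thesis by simp
qed

text \<open>The components of an eigenvector of low degree are rescaled to remain of order 1; then the
  eigenvalue equation has a limit in which the eigenvalue only survives in degree \<open>j\<close>.\<close>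

lemma eigenvector_limit_large_order:
  fixes M :: "real \<Rightarrow> nat \<Rightarrow> nat \<Rightarrow> real" and lam :: "real \<Rightarrow> real" and v :: "real \<Rightarrow> nat \<Rightarrow> real"
  assumes M: "\<And>g h. g < n \<Longrightarrow> h < n \<Longrightarrow> ((\<lambda>\<epsilon>. M \<epsilon> g h / \<epsilon> ^ (m g + m h)) \<longlongrightarrow> H g h) (at_right 0)"
    and m: "\<And>g. g < N \<Longrightarrow> m g < j" "\<And>g. N \<le> g \<Longrightarrow> g < n \<Longrightarrow> m g = j" and N: "N \<le> n"
    and eig: "\<And>g. g < n \<Longrightarrow> \<forall>\<^sub>F \<epsilon> in at_right 0. (\<Sum>h<n. M \<epsilon> g h * v \<epsilon> h) = lam \<epsilon> * v \<epsilon> g"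
    and lam: "((\<lambda>\<epsilon>. lam \<epsilon> / \<epsilon> ^ (2 * j)) \<longlongrightarrow> \<mu>) (at_right 0)"
    and v: "\<And>g. g < n \<Longrightarrow> ((\<lambda>\<epsilon>. v \<epsilon> g) \<longlongrightarrow> v0 g) (at_right 0)"
    and H: "det (mat N N (\<lambda>(g, h). H g h)) \<noteq> 0"
  shows "(\<forall>g<N. v0 g = 0) \<and> (\<exists>w0.
    (\<forall>g<N. (\<Sum>h<N. H g h * w0 h) + (\<Sum>h=N..<n. H g h * v0 h) = 0) \<and>
    (\<forall>g\<in>{N..<n}. (\<Sum>h<N. H g h * w0 h) + (\<Sum>h=N..<n. H g h * v0 h) = \<mu> * v0 g))"
proof -
  define w where "w \<epsilon> g = v \<epsilon> g / \<epsilon> ^ (j - m g)" for \<epsilon> g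
  have ev0: "\<forall>\<^sub>F \<epsilon> in at_right 0. (0 :: real) < \<epsilon>" by (rule eventually_at_right_less)
  have pow0: "((\<lambda>\<epsilon>. \<epsilon> ^ i) \<longlongrightarrow> (0 :: real)) (at_right 0)" if "i > 0" for i :: nat
  proof -
    have "((\<lambda>\<epsilon>. \<epsilon> ^ i) \<longlongrightarrow> (0 :: real) ^ i) (at_right 0)"
      by (intro tendsto_power tendsto_ident_at)
    then show ?thesis using that by (simp add: power_0_left)
  qed
  have mj: "m g \<le> j" if "g < n" for g using m[of g] that by (cases "g < N") auto
  have scaled: "\<forall>\<^sub>F \<epsilon> in at_right 0.
      (\<Sum>h<N. M \<epsilon> g h / \<epsilon> ^ (m g + m h) * w \<epsilon> h) + (\<Sum>h=N..<n. M \<epsilon> g h / \<epsilon> ^ (m g + m h) * v \<epsilon> h) =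
      lam \<epsilon> / \<epsilon> ^ (2 * j) * \<epsilon> ^ (j - m g) * v \<epsilon> g" if g: "g < n" for g
    using eig[OF g] ev0
  proof eventually_elim
    case (elim \<epsilon>)
    have h1: "M \<epsilon> g h / \<epsilon> ^ (m g + m h) * w \<epsilon> h = M \<epsilon> g h * v \<epsilon> h / \<epsilon> ^ (m g + j)" if "h < N" for h
      using m(1)[OF that] elim(2) unfolding w_def by (simp flip: power_add)
    have h2: "M \<epsilon> g h / \<epsilon> ^ (m g + m h) * v \<epsilon> h = M \<epsilon> g h * v \<epsilon> h / \<epsilon> ^ (m g + j)" if "h \<in> {N..<n}" for h
      using m(2)[of h] that by simp
    have "{..<n} = {..<N} \<union> {N..<n}" "{..<N} \<inter> {N..<n} = {}" using N by auto
    then have "(\<Sum>h<n. M \<epsilon> g h * v \<epsilon> h / \<epsilon> ^ (m g + j)) =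
        (\<Sum>h<N. M \<epsilon> g h * v \<epsilon> h / \<epsilon> ^ (m g + j)) + (\<Sum>h=N..<n. M \<epsilon> g h * v \<epsilon> h / \<epsilon> ^ (m g + j))"
      by (simp add: sum.union_disjoint)
    moreover have "(\<Sum>h<n. M \<epsilon> g h * v \<epsilon> h / \<epsilon> ^ (m g + j)) = lam \<epsilon> * v \<epsilon> g / \<epsilon> ^ (m g + j)"
      unfolding elim(1)[symmetric] by (simp add: sum_divide_distrib)
    moreover have "lam \<epsilon> * v \<epsilon> g / \<epsilon> ^ (m g + j) = lam \<epsilon> / \<epsilon> ^ (2 * j) * \<epsilon> ^ (j - m g) * v \<epsilon> g"
    proof -
      have "\<epsilon> ^ (2 * j) = \<epsilon> ^ (m g + j) * \<epsilon> ^ (j - m g)"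
        using mj[OF g] by (simp add: mult_2 flip: power_add)
      then show ?thesis using elim(2) by simp
    qed
    moreover have "(\<Sum>h<N. M \<epsilon> g h / \<epsilon> ^ (m g + m h) * w \<epsilon> h) = (\<Sum>h<N. M \<epsilon> g h * v \<epsilon> h / \<epsilon> ^ (m g + j))"
      by (intro sum.cong refl h1) simp
    moreover have "(\<Sum>h=N..<n. M \<epsilon> g h / \<epsilon> ^ (m g + m h) * v \<epsilon> h) = (\<Sum>h=N..<n. M \<epsilon> g h * v \<epsilon> h / \<epsilon> ^ (m g + j))"
      by (intro sum.cong refl h2)
    ultimately show ?case by presburger
  qed
  \<comment> \<open>The eigenvalue term is moved into the matrix. Since v_g = w_g eps^(j - m_g), it
    becomes a diagonal entry carrying eps^(2(j - m_g)), which tends to 0 for g < N, so the matrix of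
    the system converges to the invertible leading part of \<open>H\<close>.\<close>
  have sys: "\<forall>\<^sub>F \<epsilon> in at_right 0.
      (\<Sum>h<N. (M \<epsilon> g h / \<epsilon> ^ (m g + m h) -
          (if g = h then lam \<epsilon> / \<epsilon> ^ (2 * j) * \<epsilon> ^ (j - m g) * \<epsilon> ^ (j - m g) else 0)) * w \<epsilon> h) =
      - (\<Sum>h=N..<n. M \<epsilon> g h / \<epsilon> ^ (m g + m h) * v \<epsilon> h)" if g: "g < N" for g
    using scaled[of g] ev0
  proof (rule eventually_elim2)
    show "g < n" using g N by simp
  next
    fix \<epsilon> :: real
    assume e: "(\<Sum>h<N. M \<epsilon> g h / \<epsilon> ^ (m g + m h) * w \<epsilon> h) + (\<Sum>h=N..<n. M \<epsilon> g h / \<epsilon> ^ (m g + m h) * v \<epsilon> h) =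
        lam \<epsilon> / \<epsilon> ^ (2 * j) * \<epsilon> ^ (j - m g) * v \<epsilon> g" and e0: "0 < \<epsilon>"
    let ?c = "lam \<epsilon> / \<epsilon> ^ (2 * j) * \<epsilon> ^ (j - m g) * \<epsilon> ^ (j - m g)"
    have "(\<Sum>h<N. (M \<epsilon> g h / \<epsilon> ^ (m g + m h) - (if g = h then ?c else 0)) * w \<epsilon> h) =
        (\<Sum>h<N. M \<epsilon> g h / \<epsilon> ^ (m g + m h) * w \<epsilon> h) - (\<Sum>h<N. if g = h then ?c * w \<epsilon> h else 0)"
      unfolding sum_subtractf[symmetric] by (intro sum.cong) (auto simp: algebra_simps)
    also have "(\<Sum>h<N. if g = h then ?c * w \<epsilon> h else 0) = ?c * w \<epsilon> g" using g by simp
    also have "\<dots> = lam \<epsilon> / \<epsilon> ^ (2 * j) * \<epsilon> ^ (j - m g) * v \<epsilon> g"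
      unfolding w_def using e0 by simp
    finally show "(\<Sum>h<N. (M \<epsilon> g h / \<epsilon> ^ (m g + m h) - (if g = h then ?c else 0)) * w \<epsilon> h) =
      - (\<Sum>h=N..<n. M \<epsilon> g h / \<epsilon> ^ (m g + m h) * v \<epsilon> h)" using e by simp
  qed
  have "\<exists>w0. \<forall>g<N. ((\<lambda>\<epsilon>. w \<epsilon> g) \<longlongrightarrow> w0 g) (at_right 0)"
  proof (rule tendsto_linear_system[OF _ _ sys H])
    fix g h assume gh: "g < N" "h < N"
    have "((\<lambda>\<epsilon>. lam \<epsilon> / \<epsilon> ^ (2 * j) * \<epsilon> ^ (j - m g) * \<epsilon> ^ (j - m g)) \<longlongrightarrow> \<mu> * 0 * 0) (at_right 0)"
      using m(1)[OF gh(1)] by (intro tendsto_mult lam pow0) auto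
    then have "((\<lambda>\<epsilon>. if g = h then lam \<epsilon> / \<epsilon> ^ (2 * j) * \<epsilon> ^ (j - m g) * \<epsilon> ^ (j - m g) else 0) \<longlongrightarrow> 0) (at_right 0)"
      by (cases "g = h") auto
    from tendsto_diff[OF M this, of g h] gh N
    show "((\<lambda>\<epsilon>. M \<epsilon> g h / \<epsilon> ^ (m g + m h) -
        (if g = h then lam \<epsilon> / \<epsilon> ^ (2 * j) * \<epsilon> ^ (j - m g) * \<epsilon> ^ (j - m g) else 0)) \<longlongrightarrow> H g h) (at_right 0)"
      by simp
  next
    fix g assume g: "g < N"
    show "((\<lambda>\<epsilon>. - (\<Sum>h=N..<n. M \<epsilon> g h / \<epsilon> ^ (m g + m h) * v \<epsilon> h)) \<longlongrightarrow> - (\<Sum>h=N..<n. H g h * v0 h)) (at_right 0)"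
      using g N by (intro tendsto_minus tendsto_sum tendsto_mult M v) auto
  qed
  then obtain w0 where w0: "\<And>g. g < N \<Longrightarrow> ((\<lambda>\<epsilon>. w \<epsilon> g) \<longlongrightarrow> w0 g) (at_right 0)" by blast
  \<comment> \<open>The rescaled component converges, and the original one is it times a positive
    power of \<epsilon>.\<close>
  have low: "v0 g = 0" if g: "g < N" for g
  proof -
    have "((\<lambda>\<epsilon>. w \<epsilon> g * \<epsilon> ^ (j - m g)) \<longlongrightarrow> w0 g * 0) (at_right 0)"
      using m(1)[OF g] by (intro tendsto_mult w0[OF g] pow0) auto
    moreover have "\<forall>\<^sub>F \<epsilon> in at_right 0. w \<epsilon> g * \<epsilon> ^ (j - m g) = v \<epsilon> g"
      using ev0 by eventually_elim (simp add: w_def)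
    ultimately have "((\<lambda>\<epsilon>. v \<epsilon> g) \<longlongrightarrow> w0 g * 0) (at_right 0)" by (rule Lim_transform_eventually)
    then show ?thesis
      using tendsto_unique[OF trivial_limit_at_right_real v[of g]] g N by simp
  qed
  have lhs: "((\<lambda>\<epsilon>. (\<Sum>h<N. M \<epsilon> g h / \<epsilon> ^ (m g + m h) * w \<epsilon> h) + (\<Sum>h=N..<n. M \<epsilon> g h / \<epsilon> ^ (m g + m h) * v \<epsilon> h)) \<longlongrightarrow>
      (\<Sum>h<N. H g h * w0 h) + (\<Sum>h=N..<n. H g h * v0 h)) (at_right 0)" if "g < n" for g
    using that N by (intro tendsto_add tendsto_sum tendsto_mult M v w0) auto
  have rhs: "((\<lambda>\<epsilon>. lam \<epsilon> / \<epsilon> ^ (2 * j) * \<epsilon> ^ (j - m g) * v \<epsilon> g) \<longlongrightarrow>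
      \<mu> * (if g < N then 0 else 1) * v0 g) (at_right 0)" if "g < n" for g
  proof -
    have "((\<lambda>\<epsilon>. \<epsilon> ^ (j - m g)) \<longlongrightarrow> (if g < N then 0 else 1 :: real)) (at_right 0)"
      using m[of g] that by (cases "g < N") (auto intro: pow0)
    then show ?thesis by (intro tendsto_mult lam v that)
  qed
  have "(\<Sum>h<N. H g h * w0 h) + (\<Sum>h=N..<n. H g h * v0 h) = \<mu> * (if g < N then 0 else 1) * v0 g"
    if "g < n" for g
    using tendsto_unique[OF trivial_limit_at_right_real Lim_transform_eventually[OF lhs[OF that] scaled[OF that]] rhs[OF that]] .
  then show ?thesis using low N by (intro conjI exI[of _ w0]) auto
qed

subsection \<open>Leading terms of analytic functions\<close>

text \<open>Used with \<open>k = 0\<close> for continuity at 0, and with \<open>k\<close> one above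
  the first nonzero coefficient for the leading term.\<close>

lemma power_series_remainder:
  fixes c :: "nat \<Rightarrow> real"
  assumes \<rho>: "\<rho> > 0" and f: "\<And>t. \<bar>t\<bar> < \<rho> \<Longrightarrow> (\<lambda>m. c m * t ^ m) sums f t"
  shows "\<exists>q. isCont q 0 \<and> q 0 = c k \<and> (\<forall>t. \<bar>t\<bar> < \<rho> \<longrightarrow> f t = (\<Sum>m<k. c m * t ^ m) + t ^ k * q t)"
proof -
  have summ: "summable (\<lambda>m. c (m + k) * t ^ m)" if "\<bar>t\<bar> < \<rho>" for t
    using sums_summable[OF f[OF that]] by (rule summable_powser_shift)
  define q where "q t = (\<Sum>m. c (m + k) * t ^ m)" for t
  have "isCont q 0"
    unfolding q_def by (rule isCont_powser[of _ "\<rho> / 2"]) (use summ[of "\<rho> / 2"] \<rho> in auto)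
  moreover have "q 0 = c k" unfolding q_def by (subst powser_zero) simp
  moreover have "f t = (\<Sum>m<k. c m * t ^ m) + t ^ k * q t" if t: "\<bar>t\<bar> < \<rho>" for t
  proof -
    have "f t = (\<Sum>m. c (m + k) * t ^ (m + k)) + (\<Sum>m<k. c m * t ^ m)"
      using suminf_split_initial_segment[OF sums_summable[OF f[OF t]], of k] sums_unique[OF f[OF t]] by simp
    also have "(\<Sum>m. c (m + k) * t ^ (m + k)) = t ^ k * q t"
      unfolding q_def using suminf_mult[OF summ[OF t], of "t ^ k"] by (simp add: power_add mult_ac)
    finally show ?thesis by simp
  qed
  ultimately show ?thesis by blast
qed

lemma analytic_0_isCont: "analytic_0 f \<Longrightarrow> isCont f 0"
proof -
  assume "analytic_0 f"
  then obtain c \<rho> where \<rho>: "\<rho> > 0" and f: "\<And>t. \<bar>t\<bar> < \<rho> \<Longrightarrow> (\<lambda>m. c m * t ^ m) sums f t"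
    unfolding analytic_0_def has_power_series_0_def by blast
  obtain q where q: "isCont q 0" "\<And>t. \<bar>t\<bar> < \<rho> \<Longrightarrow> f t = q t"
    using power_series_remainder[OF \<rho> f, of 0] by auto
  have "\<forall>\<^sub>F t in nhds 0. t \<in> {-\<rho><..<\<rho>}"
    by (rule eventually_nhds_in_open) (use \<rho> in auto)
  then have "\<forall>\<^sub>F t in nhds 0. f t = q t" by eventually_elim (auto intro: q(2))
  then show "isCont f 0" using isCont_cong q(1) by metis
qed

lemma leading_asymptotic_tendsto:
  assumes "leading_asymptotic f a c"
  shows "((\<lambda>\<epsilon>. f \<epsilon> / \<epsilon> ^ a) \<longlongrightarrow> c) (at_right 0)"
proof -
  obtain C where C: "\<forall>\<^sub>F \<epsilon> in at 0. norm (f \<epsilon> - c * \<epsilon> ^ a) \<le> C * norm (\<epsilon> ^ (a + 1))"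
    using assms unfolding leading_asymptotic_def by (auto elim: landau_o.bigE)
  then have C': "\<forall>\<^sub>F \<epsilon> in at_right 0. norm (f \<epsilon> - c * \<epsilon> ^ a) \<le> C * norm (\<epsilon> ^ (a + 1))"
    unfolding eventually_at_split by simp
  have "((\<lambda>\<epsilon>. f \<epsilon> / \<epsilon> ^ a - c) \<longlongrightarrow> 0) (at_right 0)"
  proof (rule tendsto_rabs_zero_cancel, rule tendsto_sandwich[OF _ _ tendsto_const])
    have "((\<lambda>\<epsilon>. C * \<epsilon>) \<longlongrightarrow> C * 0) (at_right 0)" by (intro tendsto_intros)
    then show "((\<lambda>\<epsilon>. C * \<epsilon>) \<longlongrightarrow> 0) (at_right 0)" by simp
    show "\<forall>\<^sub>F \<epsilon> in at_right 0. \<bar>f \<epsilon> / \<epsilon> ^ a - c\<bar> \<le> C * \<epsilon>"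
      using C' eventually_at_right_less[of 0]
    proof eventually_elim
      case (elim \<epsilon>)
      have "f \<epsilon> / \<epsilon> ^ a - c = (f \<epsilon> - c * \<epsilon> ^ a) / \<epsilon> ^ a" using elim(2) by (simp add: field_simps)
      then have "\<bar>f \<epsilon> / \<epsilon> ^ a - c\<bar> = \<bar>f \<epsilon> - c * \<epsilon> ^ a\<bar> / \<epsilon> ^ a" using elim(2) by (simp add: abs_div)
      also have "\<dots> \<le> C * \<epsilon> ^ (a + 1) / \<epsilon> ^ a"
        using elim by (intro divide_right_mono) auto
      also have "\<dots> = C * \<epsilon>" using elim(2) by simp
      finally show ?case .
    qed
  qed auto
  then show ?thesis using tendsto_add[OF _ tendsto_const[of c]] by fastforce
qed

lemma leading_asymptotic_unique:
  assumes "leading_asymptotic f a c" "leading_asymptotic f a' c'"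
  shows "a = a' \<and> c = c'"
proof -
  \<comment> \<open>If a' were larger, f / eps^a would be a convergent factor times a positive power
    of \<epsilon> and tend to 0, against the nonzero coefficient \<open>c\<close>.\<close>
  have le: "a' \<le> a" if L: "leading_asymptotic f a c" "leading_asymptotic f a' c'" for a a' c c'
  proof (rule ccontr)
    assume "\<not> a' \<le> a"
    then have a: "a < a'" by simp
    have "((\<lambda>\<epsilon>. \<epsilon> ^ (a' - a)) \<longlongrightarrow> (0 :: real) ^ (a' - a)) (at_right 0)"
      by (intro tendsto_power tendsto_ident_at)
    then have "((\<lambda>\<epsilon>. f \<epsilon> / \<epsilon> ^ a' * \<epsilon> ^ (a' - a)) \<longlongrightarrow> c' * 0 ^ (a' - a)) (at_right 0)"
      by (intro tendsto_mult leading_asymptotic_tendsto L)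
    moreover have "\<forall>\<^sub>F \<epsilon> in at_right 0. f \<epsilon> / \<epsilon> ^ a' * \<epsilon> ^ (a' - a) = f \<epsilon> / \<epsilon> ^ a"
      using eventually_at_right_less[of 0]
    proof eventually_elim
      case (elim \<epsilon>)
      have "\<epsilon> ^ a' = \<epsilon> ^ a * \<epsilon> ^ (a' - a)" using a by (simp flip: power_add)
      then show ?case using elim by simp
    qed
    ultimately have "((\<lambda>\<epsilon>. f \<epsilon> / \<epsilon> ^ a) \<longlongrightarrow> c' * 0 ^ (a' - a)) (at_right 0)"
      by (rule Lim_transform_eventually)
    then have "c = c' * 0 ^ (a' - a)"
      using tendsto_unique[OF trivial_limit_at_right_real leading_asymptotic_tendsto[OF L(1)]] by blast
    then show False using a L(1) unfolding leading_asymptotic_def by (simp add: power_0_left)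
  qed
  have "a = a'" using le assms by (meson le_antisym)
  then show ?thesis
    using tendsto_unique[OF trivial_limit_at_right_real] leading_asymptotic_tendsto assms by blast
qed

lemma lead_term_eq:
  assumes "leading_asymptotic f a c"
  shows "lead_term f = Polynomial.monom c a"
proof -
  have "\<not> (\<forall>\<^sub>F \<epsilon> in nhds 0. f \<epsilon> = 0)"
  proof
    assume "\<forall>\<^sub>F \<epsilon> in nhds 0. f \<epsilon> = 0"
    then have "\<forall>\<^sub>F \<epsilon> in at_right 0. f \<epsilon> = 0"
      by (simp add: eventually_at_filter eventually_mono)
    then have "\<forall>\<^sub>F \<epsilon> in at_right 0. f \<epsilon> / \<epsilon> ^ a = 0" by eventually_elim simp
    then have "((\<lambda>\<epsilon>. f \<epsilon> / \<epsilon> ^ a) \<longlongrightarrow> 0) (at_right 0)" by (rule tendsto_eventually)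
    then have "c = 0"
      using tendsto_unique[OF trivial_limit_at_right_real leading_asymptotic_tendsto[OF assms]] by blast
    then show False using assms unfolding leading_asymptotic_def by simp
  qed
  moreover have "(THE q. \<exists>a c. q = Polynomial.monom c a \<and> leading_asymptotic f a c) = Polynomial.monom c a"
  proof (rule the_equality)
    show "\<exists>a' c'. Polynomial.monom c a = Polynomial.monom c' a' \<and> leading_asymptotic f a' c'"
      using assms by blast
  next
    fix q assume "\<exists>a c. q = Polynomial.monom c a \<and> leading_asymptotic f a c"
    then obtain a' c' where q: "q = Polynomial.monom c' a'" "leading_asymptotic f a' c'" by blast
    then show "q = Polynomial.monom c a" using leading_asymptotic_unique[OF assms q(2)] by simp
  qed
  ultimately show ?thesis unfolding lead_term_def by simp
qed

text \<open>Positivity to the right of 0 excludes the zero series, so there is a first nonzero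
  coefficient; as a limit of positive quotients it cannot be negative.\<close>

lemma analytic_positive_leading_asymptotic:
  assumes "analytic_0 f" and pos: "\<forall>\<^sub>F \<epsilon> in at_right 0. f \<epsilon> > 0"
  shows "\<exists>a c. c > 0 \<and> leading_asymptotic f a c"
proof -
  obtain c \<rho> where \<rho>: "\<rho> > 0" and f: "\<And>t. \<bar>t\<bar> < \<rho> \<Longrightarrow> (\<lambda>m. c m * t ^ m) sums f t"
    using assms(1) unfolding analytic_0_def has_power_series_0_def by blast
  have ev: "\<forall>\<^sub>F t in nhds 0. t \<in> {-\<rho><..<\<rho>}"
    by (rule eventually_nhds_in_open) (use \<rho> in auto)
  have "\<exists>m. c m \<noteq> 0"
  proof (rule ccontr)
    assume "\<nexists>m. c m \<noteq> 0"
    then have z: "f t = 0" if "\<bar>t\<bar> < \<rho>" for t using sums_unique[OF f[OF that]] by simp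
    have "\<forall>\<^sub>F t in at_right 0. t \<in> {-\<rho><..<\<rho>}"
      using ev by (simp add: eventually_at_filter eventually_mono)
    with pos have "\<forall>\<^sub>F t in at_right (0::real). False"
      by eventually_elim (use z in force)
    then show False by (simp add: trivial_limit_at_right_real eventually_False)
  qed
  then have a: "c (LEAST m. c m \<noteq> 0) \<noteq> 0" by (rule LeastI_ex)
  define a where "a = (LEAST m. c m \<noteq> 0)"
  have below: "c m = 0" if "m < a" for m using not_less_Least that unfolding a_def by blast
  obtain q where q: "isCont q 0"
    "\<And>t. \<bar>t\<bar> < \<rho> \<Longrightarrow> f t = (\<Sum>m<Suc a. c m * t ^ m) + t ^ Suc a * q t"
    using power_series_remainder[OF \<rho> f, of "Suc a"] by blast
  have eq: "f t - c a * t ^ a = t ^ (a + 1) * q t" if "\<bar>t\<bar> < \<rho>" for t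
    using q(2)[OF that] below by simp
  have "\<forall>\<^sub>F t in at 0. t \<in> {-\<rho><..<\<rho>}"
    using ev by (simp add: eventually_at_filter eventually_mono)
  then have "\<forall>\<^sub>F t in at 0. t ^ (a + 1) * q t = f t - c a * t ^ a"
    by eventually_elim (use eq in auto)
  moreover have "(\<lambda>t. t ^ (a + 1) * q t) \<in> O[at 0](\<lambda>t. t ^ (a + 1) * 1)"
  proof (intro landau_o.big.mult landau_o.big_refl)
    have "(q \<longlongrightarrow> q 0) (at 0)" using q(1) unfolding isCont_def .
    then show "q \<in> O[at 0](\<lambda>_. 1)"
      by (intro bigoI_tendsto[of _ _ "q 0"]) simp_all
  qed
  ultimately have "(\<lambda>t. f t - c a * t ^ a) \<in> O[at 0](\<lambda>t. t ^ (a + 1))"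
    using landau_o.big.in_cong by fastforce
  then have L: "leading_asymptotic f a (c a)"
    using a unfolding leading_asymptotic_def a_def by simp
  have "\<forall>\<^sub>F \<epsilon> in at_right 0. 0 \<le> f \<epsilon> / \<epsilon> ^ a"
    using pos eventually_at_right_less[of 0] by eventually_elim simp
  then have "0 \<le> c a"
    using tendsto_lowerbound[OF leading_asymptotic_tendsto[OF L]] trivial_limit_at_right_real by blast
  then have "c a > 0" using a unfolding a_def by simp
  then show ?thesis using L by blast
qed

subsection \<open>Orthonormal eigenbases\<close>

definition orthonormal_family :: "nat \<Rightarrow> (nat \<Rightarrow> real vec) \<Rightarrow> bool" where
  "orthonormal_family n w \<longleftrightarrow> (\<forall>k<n. w k \<in> carrier_vec n) \<and>
     (\<forall>k<n. \<forall>l<n. (\<Sum>a<n. w k $ a * w l $ a) = (if k = l then 1 else 0))"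

lemma orthonormal_family_matrix:
  assumes "orthonormal_family n w"
  defines "U \<equiv> mat n n (\<lambda>(a, k). w k $ a)"
  shows "transpose_mat U * U = 1\<^sub>m n" "U * transpose_mat U = 1\<^sub>m n"
proof -
  have U: "U \<in> carrier_mat n n" "transpose_mat U \<in> carrier_mat n n" unfolding U_def by auto
  show "transpose_mat U * U = 1\<^sub>m n"
  proof (rule eq_matI)
    fix k l assume "k < dim_row (1\<^sub>m n)" "l < dim_col (1\<^sub>m n)"
    then have kl: "k < n" "l < n" by auto
    have "(transpose_mat U * U) $$ (k, l) = (\<Sum>a<n. w k $ a * w l $ a)"
      using mult_mat_index[OF U(2,1) kl] kl unfolding U_def by simp
    then show "(transpose_mat U * U) $$ (k, l) = 1\<^sub>m n $$ (k, l)"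
      using assms(1) kl unfolding orthonormal_family_def by simp
  qed (use U in auto)
  then show "U * transpose_mat U = 1\<^sub>m n"
    by (rule right_inverse_imp_left_inverse[OF U(2,1)])
qed

text \<open>The rows of an orthogonal matrix are orthonormal as well as its columns.\<close>

lemma orthonormal_family_complete:
  assumes w: "orthonormal_family n w" and "a < n" "b < n"
  shows "(\<Sum>k<n. w k $ a * w k $ b) = (if a = b then 1 else 0)"
proof -
  let ?U = "mat n n (\<lambda>(a, k). w k $ a)"
  have "(?U * transpose_mat ?U) $$ (a, b) = (\<Sum>k<n. w k $ a * w k $ b)"
    using mult_mat_index[of ?U n n "transpose_mat ?U" n a b] assms by simp
  then show ?thesis using orthonormal_family_matrix(2)[OF w] assms by simp
qed

lemma spectral_decomposition:
  assumes A: "A \<in> carrier_mat n n" and w: "orthonormal_family n w"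
    and eig: "\<And>k. k < n \<Longrightarrow> A *\<^sub>v w k = \<mu> k \<cdot>\<^sub>v w k" and ab: "a < n" "b < n"
  shows "A $$ (a, b) = (\<Sum>k<n. \<mu> k * (w k $ a * w k $ b))"
proof -
  have wc: "w k \<in> carrier_vec n" if "k < n" for k using w that unfolding orthonormal_family_def by simp
  have "(\<Sum>k<n. \<mu> k * (w k $ a * w k $ b)) = (\<Sum>k<n. (\<Sum>c<n. A $$ (a, c) * w k $ c) * w k $ b)"
  proof (intro sum.cong refl)
    fix k assume "k \<in> {..<n}"
    then have k: "k < n" by simp
    have "(A *\<^sub>v w k) $ a = (\<Sum>c<n. A $$ (a, c) * w k $ c)"
      by (rule mult_mat_vec_index[OF A wc[OF k] ab(1)])
    moreover have "(A *\<^sub>v w k) $ a = \<mu> k * w k $ a" unfolding eig[OF k] using wc[OF k] ab by simp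
    ultimately show "\<mu> k * (w k $ a * w k $ b) = (\<Sum>c<n. A $$ (a, c) * w k $ c) * w k $ b" by simp
  qed
  also have "\<dots> = (\<Sum>k<n. \<Sum>c<n. A $$ (a, c) * (w k $ c * w k $ b))"
    by (simp only: sum_distrib_right mult.assoc)
  also have "\<dots> = (\<Sum>c<n. \<Sum>k<n. A $$ (a, c) * (w k $ c * w k $ b))"
    by (rule sum.swap)
  also have "\<dots> = (\<Sum>c<n. A $$ (a, c) * (if c = b then 1 else 0))"
    by (intro sum.cong refl) (simp add: orthonormal_family_complete[OF w] ab flip: sum_distrib_left)
  also have "\<dots> = (\<Sum>c<n. if c = b then A $$ (a, b) else 0)" by (intro sum.cong) auto
  also have "\<dots> = A $$ (a, b)" using ab by simp
  finally show ?thesis ..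
qed

text \<open>The matrix with columns \<open>w k\<close> is orthogonal and makes \<open>A\<close>
  similar to the diagonal matrix of the \<open>\<mu> k\<close>.\<close>

lemma char_poly_orthonormal_eigenbasis:
  assumes A: "A \<in> carrier_mat n n" and w: "orthonormal_family n w"
    and eig: "\<And>k. k < n \<Longrightarrow> A *\<^sub>v w k = \<mu> k \<cdot>\<^sub>v w k"
  shows "char_poly A = (\<Prod>k<n. [:- \<mu> k, 1:])"
proof -
  let ?U = "mat n n (\<lambda>(a, k). w k $ a)" and ?D = "mat n n (\<lambda>(k, l). if k = l then \<mu> k else 0)"
  have U: "?U \<in> carrier_mat n n" "transpose_mat ?U \<in> carrier_mat n n" and D: "?D \<in> carrier_mat n n" by auto
  have eq: "A = ?U * ?D * transpose_mat ?U"
  proof (rule eq_matI)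
    fix a b assume "a < dim_row (?U * ?D * transpose_mat ?U)" "b < dim_col (?U * ?D * transpose_mat ?U)"
    then have ab: "a < n" "b < n" by auto
    have "(?U * ?D * transpose_mat ?U) $$ (a, b) = (\<Sum>k<n. (?U * ?D) $$ (a, k) * transpose_mat ?U $$ (k, b))"
      by (rule mult_mat_index[OF mult_carrier_mat[OF U(1) D] U(2) ab])
    also have "\<dots> = (\<Sum>k<n. \<mu> k * (w k $ a * w k $ b))"
    proof (intro sum.cong refl)
      fix k assume "k \<in> {..<n}"
      then have k: "k < n" by simp
      have "(?U * ?D) $$ (a, k) = (\<Sum>l<n. w l $ a * (if l = k then \<mu> l else 0))"
        using mult_mat_index[OF U(1) D ab(1) k] ab k by simp
      also have "\<dots> = (\<Sum>l<n. if l = k then w k $ a * \<mu> k else 0)" by (intro sum.cong) auto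
      also have "\<dots> = w k $ a * \<mu> k" using k by simp
      finally show "(?U * ?D) $$ (a, k) * transpose_mat ?U $$ (k, b) = \<mu> k * (w k $ a * w k $ b)"
        using k ab by simp
    qed
    finally show "A $$ (a, b) = (?U * ?D * transpose_mat ?U) $$ (a, b)"
      using spectral_decomposition[OF A w eig ab] by simp
  qed (use A in auto)
  have "similar_mat A ?D"
    by (rule similar_matI[OF _ orthonormal_family_matrix(2,1)[OF w] eq]) (use A in auto)
  then have "char_poly A = char_poly ?D" by (rule char_poly_similar)
  also have "\<dots> = (\<Prod>a\<leftarrow>diag_mat ?D. [:- a, 1:])"
    by (rule char_poly_upper_triangular[of _ n]) (auto simp: upper_triangular_def)
  also have "\<dots> = (\<Prod>k\<leftarrow>[0..<n]. [:- \<mu> k, 1:])"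
    by (intro arg_cong[of _ _ prod_list] nth_equalityI) (auto simp: diag_mat_def)
  also have "\<dots> = (\<Prod>k<n. [:- \<mu> k, 1:])"
    by (subst prod.distinct_set_conv_list[symmetric]) (auto simp: lessThan_atLeast0)
  finally show ?thesis .
qed

lemma char_poly_block_diagonal:
  fixes A D :: "real mat"
  assumes A: "A \<in> carrier_mat m m" and D: "D \<in> carrier_mat k k"
  shows "char_poly (four_block_mat A (0\<^sub>m m k) (0\<^sub>m k m) D) = char_poly A * char_poly D"
proof -
  have "char_poly_matrix (four_block_mat A (0\<^sub>m m k) (0\<^sub>m k m) D) =
      four_block_mat (char_poly_matrix A) (0\<^sub>m m k) (0\<^sub>m k m) (char_poly_matrix D)"
    using A D by (intro eq_matI) (auto simp: char_poly_matrix_def)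
  then show ?thesis
    unfolding char_poly_def using A D
    by (simp add: det_four_block_mat_lower_left_zero[of _ m _ k])
qed

lemma char_poly_zero_mat: "char_poly (0\<^sub>m m m :: real mat) = Polynomial.monom 1 m"
proof -
  have "char_poly (0\<^sub>m m m :: real mat) = (\<Prod>a\<leftarrow>diag_mat (0\<^sub>m m m :: real mat). [:- a, 1:])"
    by (rule char_poly_upper_triangular[of _ m]) (auto simp: upper_triangular_def)
  also have "diag_mat (0\<^sub>m m m :: real mat) = replicate m 0"
    by (intro nth_equalityI) (auto simp: diag_mat_def)
  also have "(\<Prod>a\<leftarrow>replicate m 0. [:- a, 1 :: real:]) = Polynomial.monom 1 m"
    by (simp add: monom_altdef)
  finally show ?thesis .
qed

text \<open>Block elimination: the first equation gives x = - A^{-1} C^T y, and inserting this into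
  the second leaves the Schur complement applied to \<open>y\<close>.\<close>

lemma schur_complement_eigenvector:
  fixes A C B :: "real mat"
  assumes A: "A \<in> carrier_mat m m" "invertible_mat A" and C: "C \<in> carrier_mat k m" and B: "B \<in> carrier_mat k k"
    and x: "x \<in> carrier_vec m" and y: "y \<in> carrier_vec k"
    and Ax: "A *\<^sub>v x + transpose_mat C *\<^sub>v y = 0\<^sub>v m"
    and Cx: "C *\<^sub>v x + B *\<^sub>v y = \<mu> \<cdot>\<^sub>v y"
  shows "(B - C * inv_mat A * transpose_mat C) *\<^sub>v y = \<mu> \<cdot>\<^sub>v y"
proof -
  note I = invertible_mat_inverse[OF A(2,1)]
  have CT: "transpose_mat C \<in> carrier_mat m k" using C by simp
  define z where "z = transpose_mat C *\<^sub>v y"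
  have z: "z \<in> carrier_vec m" unfolding z_def using CT y by auto
  have "inv_mat A *\<^sub>v (A *\<^sub>v x + z) = 0\<^sub>v m" unfolding z_def Ax using I(1) by auto
  moreover have "inv_mat A *\<^sub>v (A *\<^sub>v x + z) = inv_mat A *\<^sub>v (A *\<^sub>v x) + inv_mat A *\<^sub>v z"
    by (rule mult_add_distrib_mat_vec[OF I(1)]) (use A x z in auto)
  moreover have "inv_mat A *\<^sub>v (A *\<^sub>v x) = x"
    using assoc_mult_mat_vec[OF I(1) A(1) x] I(3) x by simp
  ultimately have xz: "x + inv_mat A *\<^sub>v z = 0\<^sub>v m" by simp
  have Iz: "inv_mat A *\<^sub>v z \<in> carrier_vec m" using I z by auto
  have "C *\<^sub>v x + C *\<^sub>v (inv_mat A *\<^sub>v z) = C *\<^sub>v (x + inv_mat A *\<^sub>v z)"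
    by (rule mult_add_distrib_mat_vec[OF C x Iz, symmetric])
  moreover have "C *\<^sub>v 0\<^sub>v m = 0\<^sub>v k" using C by (intro eq_vecI) auto
  ultimately have CC: "C *\<^sub>v x + C *\<^sub>v (inv_mat A *\<^sub>v z) = 0\<^sub>v k" unfolding xz by simp
  have "(C * inv_mat A * transpose_mat C) *\<^sub>v y = C *\<^sub>v (inv_mat A *\<^sub>v z)"
    unfolding z_def using assoc_mult_mat_vec[OF mult_carrier_mat[OF C I(1)] CT y]
      assoc_mult_mat_vec[OF C I(1), of "transpose_mat C *\<^sub>v y"] CT y by simp
  moreover have "(B - C * inv_mat A * transpose_mat C) *\<^sub>v y = B *\<^sub>v y - (C * inv_mat A * transpose_mat C) *\<^sub>v y"
    by (rule minus_mult_distrib_mat_vec[OF B _ y]) (use C I CT in auto)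
  ultimately have eq: "(B - C * inv_mat A * transpose_mat C) *\<^sub>v y = B *\<^sub>v y - C *\<^sub>v (inv_mat A *\<^sub>v z)" by simp
  show ?thesis
  proof (rule eq_vecI)
    fix i assume "i < dim_vec (\<mu> \<cdot>\<^sub>v y)"
    then have i: "i < k" using y by simp
    have "(C *\<^sub>v x + C *\<^sub>v (inv_mat A *\<^sub>v z)) $ i = 0" unfolding CC using i by simp
    moreover have "(C *\<^sub>v x + B *\<^sub>v y) $ i = (\<mu> \<cdot>\<^sub>v y) $ i" unfolding Cx ..
    ultimately show "((B - C * inv_mat A * transpose_mat C) *\<^sub>v y) $ i = (\<mu> \<cdot>\<^sub>v y) $ i"
      unfolding eq using C B i by (simp del: index_mult_mat_vec)
  qed (use B C y in auto)
qed

subsection \<open>Monomials of a given degree\<close>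

text \<open>Enumerating the coordinates turns multi-indices into lists of length d with sum s, which
  stars and bars counts.\<close>

lemma card_multi_indices:
  "card {\<alpha> :: 'd::finite \<Rightarrow> nat. mi_degree \<alpha> = s} = (s + CARD('d) - 1) choose (CARD('d) - 1)"
proof -
  obtain xs :: "'d list" where xs: "set xs = UNIV" "distinct xs"
    using finite_distinct_list[of "UNIV :: 'd set"] by auto
  have len: "length xs = CARD('d)" using distinct_card[OF xs(2)] xs(1) by simp
  have deg: "mi_degree \<alpha> = sum_list (map \<alpha> xs)" for \<alpha>
    unfolding mi_degree_def xs(1)[symmetric] by (rule sum.distinct_set_conv_list[OF xs(2)])
  have inj: "inj_on (\<lambda>\<alpha>. map \<alpha> xs) {\<alpha>. mi_degree \<alpha> = s}"
    using xs(1) by (auto simp: inj_on_def fun_eq_iff)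
  have "(\<lambda>\<alpha>. map \<alpha> xs) ` {\<alpha>. mi_degree \<alpha> = s} = {l :: nat list. length l = CARD('d) \<and> sum_list l = s}"
  proof (intro equalityI subsetI)
    fix l :: "nat list" assume l: "l \<in> {l. length l = CARD('d) \<and> sum_list l = s}"
    define \<alpha> where "\<alpha> x = the (map_of (zip xs l) x)" for x
    have "map \<alpha> xs = l"
      unfolding \<alpha>_def using l len xs(2) by (intro nth_equalityI) (auto simp: map_of_zip_nth)
    then show "l \<in> (\<lambda>\<alpha>. map \<alpha> xs) ` {\<alpha>. mi_degree \<alpha> = s}"
      using l by (intro image_eqI[of _ _ \<alpha>]) (auto simp: deg)
  qed (auto simp: deg len)
  then have "card {\<alpha> :: 'd \<Rightarrow> nat. mi_degree \<alpha> = s} = card {l :: nat list. length l = CARD('d) \<and> sum_list l = s}"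
    using card_image[OF inj] by simp
  also have "\<dots> = (s + CARD('d) - 1) choose s" by (rule card_length_sum_list)
  also have "\<dots> = (s + CARD('d) - 1) choose (CARD('d) - 1)"
  proof -
    have "CARD('d) > 0" by simp
    then have "s \<le> s + CARD('d) - 1" "s + CARD('d) - 1 - s = CARD('d) - 1" by linarith+
    then show ?thesis using binomial_symmetric by metis
  qed
  finally show ?thesis .
qed

lemma length_monomial_ordering:
  fixes mi :: "nat \<Rightarrow> ('d::finite \<Rightarrow> nat) list"
  assumes "monomial_ordering mi"
  shows "length (mi s) = (s + CARD('d) - 1) choose (CARD('d) - 1)"
  using assms distinct_card[of "mi s"] card_multi_indices[where 'd = 'd, of s]
  unfolding monomial_ordering_def by simp

lemma sum_monomial_ordering:
  fixes mi :: "nat \<Rightarrow> ('d::finite \<Rightarrow> nat) list" and f :: "('d \<Rightarrow> nat) \<Rightarrow> real"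
  assumes "monomial_ordering mi"
  shows "(\<Sum>c<length (mi s). f (mi s ! c)) = (\<Sum>\<alpha> | mi_degree \<alpha> = s. f \<alpha>)"
proof (rule sum.reindex_bij_betw)
  show "bij_betw ((!) (mi s)) {..<length (mi s)} {\<alpha>. mi_degree \<alpha> = s}"
    using assms unfolding monomial_ordering_def by (intro bij_betw_nth) auto
qed

subsection \<open>The kernel matrix for small positive scaling\<close>

text \<open>The common content of the two smoothness assumptions. The sign of \<epsilon> matters in
  the radial case, where \<epsilon> times a positive distance is the distance of the scaled points
  only if \<epsilon> is not negative.\<close>

lemma scaled_kernel_matrix:
  assumes "(\<exists>r. enat (p + 1) \<le> r \<and> radial_kernel_matrix r k n x K) \<or> smooth_kernel_matrix (p + 1) k n x K"
  shows "Cqq_near_0 p k" and "\<epsilon> > 0 \<Longrightarrow> K \<epsilon> = mat n n (\<lambda>(i, l). k (\<epsilon> *\<^sub>R x i) (\<epsilon> *\<^sub>R x l))"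
proof -
  consider (radial) r \<psi> a where "enat (p + 1) \<le> r" "\<And>y z. k y z = \<psi> (norm (y - z))" "has_power_series_0 \<psi> a"
      "regularity_index a r" "K = (\<lambda>\<epsilon>. mat n n (\<lambda>(i, l). \<psi> (\<epsilon> * norm (x i - x l))))"
    | (smooth) "Cqq_near_0 (p + 1) k" "K = (\<lambda>\<epsilon>. mat n n (\<lambda>(i, l). k (\<epsilon> *\<^sub>R x i) (\<epsilon> *\<^sub>R x l)))"
    using assms unfolding radial_kernel_matrix_def smooth_kernel_matrix_def by blast
  note cases = this
  show "Cqq_near_0 p k"
    using cases by cases (auto intro: radial_Cqq_near_0 Cqq_near_0_mono)
  assume e: "\<epsilon> > 0"
  show "K \<epsilon> = mat n n (\<lambda>(i, l). k (\<epsilon> *\<^sub>R x i) (\<epsilon> *\<^sub>R x l))"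
    using cases
  proof cases
    case radial
    have "\<epsilon> * norm (x i - x l) = norm (\<epsilon> *\<^sub>R x i - \<epsilon> *\<^sub>R x l)" for i l
      using e by (simp flip: scaleR_right_diff_distrib)
    then show ?thesis unfolding radial(5) radial(2) by simp
  next
    case smooth
    then show ?thesis by simp
  qed
qed

lemma kernel_functional_limit_vandermonde:
  fixes k :: "real ^ 'd::{finite,linorder} \<Rightarrow> real ^ 'd::{finite,linorder} \<Rightarrow> real"
  assumes k: "Cqq_near_0 q k" and il: "i \<le> q" "l \<le> q" and mi: "monomial_ordering mi"
    and c: "annihilates n x c i" "annihilates n x c' l"
  defines "V \<equiv> vandermonde mi n x" and "W \<equiv> wronskian mi k"
  shows "((\<lambda>\<epsilon>. (\<Sum>a<n. \<Sum>b<n. c a * c' b * k (\<epsilon> *\<^sub>R x a) (\<epsilon> *\<^sub>R x b)) / \<epsilon> ^ (i + l)) \<longlongrightarrow>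
    (\<Sum>c1<length (mi i). \<Sum>c2<length (mi l).
       (\<Sum>a<n. c a * V i $$ (a, c1)) * W i l $$ (c1, c2) * (\<Sum>b<n. c' b * V l $$ (b, c2)))) (at_right 0)"
proof -
  let ?F = "\<lambda>\<alpha> \<beta>. (\<Sum>a<n. c a * monomial (x a) \<alpha>) * (mixed_partial \<alpha> \<beta> k 0 0 / (mi_fact \<alpha> * mi_fact \<beta>)) *
       (\<Sum>b<n. c' b * monomial (x b) \<beta>)"
  have "(\<Sum>c1<length (mi i). \<Sum>c2<length (mi l).
       (\<Sum>a<n. c a * V i $$ (a, c1)) * W i l $$ (c1, c2) * (\<Sum>b<n. c' b * V l $$ (b, c2))) =
     (\<Sum>c1<length (mi i). \<Sum>c2<length (mi l). ?F (mi i ! c1) (mi l ! c2))"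
    unfolding V_def W_def by (intro sum.cong refl) (simp add: vandermonde_def wronskian_def)
  also have "\<dots> = (\<Sum>\<alpha> | mi_degree \<alpha> = i. \<Sum>\<beta> | mi_degree \<beta> = l. ?F \<alpha> \<beta>)"
    unfolding sum_monomial_ordering[OF mi, of "\<lambda>\<beta>. ?F _ \<beta>"]
    by (rule sum_monomial_ordering[OF mi])
  finally show ?thesis using kernel_functional_limit[OF k il c] by simp
qed

lemma annihilates_vandermonde:
  fixes mi :: "nat \<Rightarrow> ('d::finite \<Rightarrow> nat) list"
  assumes mi: "monomial_ordering mi"
    and "\<And>s c'. s < i \<Longrightarrow> c' < length (mi s) \<Longrightarrow> (\<Sum>a<n. c a * vandermonde mi n x s $$ (a, c')) = 0"
  shows "annihilates n x c i"
  unfolding annihilates_def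
proof (intro allI impI)
  fix \<alpha> :: "'d \<Rightarrow> nat" assume a: "mi_degree \<alpha> < i"
  have "\<alpha> \<in> set (mi (mi_degree \<alpha>))" using mi unfolding monomial_ordering_def by simp
  then obtain c' where c': "c' < length (mi (mi_degree \<alpha>))" "mi (mi_degree \<alpha>) ! c' = \<alpha>"
    unfolding in_set_conv_nth by blast
  then show "(\<Sum>a<n. c a * monomial (x a) \<alpha>) = 0"
    using assms(2)[OF a c'(1)] by (simp add: vandermonde_def)
qed

lemma annihilates_mono: "annihilates n x c i \<Longrightarrow> l \<le> i \<Longrightarrow> annihilates n x c l"
  unfolding annihilates_def by simp

text \<open>Coinciding points give equal rows, hence a nonzero vector in the left kernel, against
  row rank \<open>n\<close>. Distinctness is what makes the kernel matrix positive definite.\<close>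

lemma distinct_points:
  fixes mi :: "nat \<Rightarrow> ('d::finite \<Rightarrow> nat) list"
  assumes "vec_space.rank n (block_row n (vandermonde mi n x) q) = n"
  shows "inj_on x {..<n}"
proof (rule inj_onI, rule ccontr)
  fix a a' assume a: "a \<in> {..<n}" "a' \<in> {..<n}" "x a = x a'" "a \<noteq> a'"
  let ?V = "vandermonde mi n x"
  have Vc: "?V s \<in> carrier_mat n (length (mi s))" for s by (simp add: vandermonde_def)
  have A: "block_row n ?V q \<in> carrier_mat n (block_offset (\<lambda>s. length (mi s)) q)"
    by (rule block_row_carrier) (rule Vc)
  have "unit_vec n a - unit_vec n a' = (0\<^sub>v n :: real vec)"
  proof (rule vec_space.full_row_rank_left_kernel[OF A assms])
    fix c assume c: "c < block_offset (\<lambda>s. length (mi s)) q"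
    then obtain s c' where s: "s < q" "c' < length (mi s)" "c = block_offset (\<lambda>s. length (mi s)) s + c'"
      by (rule block_index_cases)
    have idx: "block_row n ?V q $$ (i, c) = monomial (x i) (mi s ! c')" if "i < n" for i
      unfolding s(3) using block_row_index[of q ?V n "\<lambda>s. length (mi s)" i s c'] Vc that s
      by (simp add: vandermonde_def)
    have "scalar_prod (unit_vec n a - unit_vec n a') (col (block_row n ?V q) c) =
        scalar_prod (unit_vec n a) (col (block_row n ?V q) c) - scalar_prod (unit_vec n a') (col (block_row n ?V q) c)"
      by (rule minus_scalar_prod_distrib[of _ n]) (use A in \<open>auto intro!: carrier_vecI\<close>)
    also have "\<dots> = block_row n ?V q $$ (a, c) - block_row n ?V q $$ (a', c)"
      using A a c by simp
    also have "\<dots> = 0" using idx a by simp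
    finally show "scalar_prod (unit_vec n a - unit_vec n a') (col (block_row n ?V q) c) = 0" .
  qed simp
  then have "(unit_vec n a - unit_vec n a') $ a = (0\<^sub>v n :: real vec) $ a" by simp
  then show False using a by simp
qed

subsection \<open>The limiting eigenvectors of the block of order \<open>j\<close>\<close>

context qr_schur
begin

text \<open>The block, i.e. the polynomial degree, to which column \<open>g\<close> of
  \<open>Qf\<close> belongs.\<close>

definition degree_of :: "nat \<Rightarrow> nat" where
  "degree_of g = (LEAST i. g < block_offset b (Suc i))"

lemma degree_of_offset: "c < b i \<Longrightarrow> degree_of (block_offset b i + c) = i"
  unfolding degree_of_def
proof (rule Least_equality)
  fix l assume c: "c < b i" and l: "block_offset b i + c < block_offset b (Suc l)"
  show "i \<le> l"
  proof (rule ccontr)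
    assume "\<not> i \<le> l"
    then show False using block_offset_mono[of "Suc l" i b] l by simp
  qed
qed simp

text \<open>The limit of the rescaled matrix, in which all degrees above \<open>j\<close> are scaled like \<open>j\<close>.\<close>

definition H_limit :: "nat \<Rightarrow> nat \<Rightarrow> real" where
  "H_limit g g' = (if degree_of g \<le> j \<and> degree_of g' \<le> j
     then H (degree_of g) (degree_of g') $$
       (g - block_offset b (degree_of g), g' - block_offset b (degree_of g')) else 0)"

text \<open>One formula for all \<open>j\<close>: for \<open>j = 0\<close> the subtracted product
  has inner dimension 0 and is the zero matrix.\<close>

definition S :: "real mat" where
  "S = H j j - block_row (b j) (H j) j * inv_mat (block_mat b b H j) * transpose_mat (block_row (b j) (H j) j)"

lemma H_limit_offset:
  "c < b i \<Longrightarrow> c' < b l \<Longrightarrow> i \<le> j \<Longrightarrow> l \<le> j \<Longrightarrow>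
   H_limit (block_offset b i + c) (block_offset b l + c') = H i l $$ (c, c')"
  unfolding H_limit_def by (simp add: degree_of_offset)

lemma degree_of_less: "g < block_offset b q \<Longrightarrow> degree_of g < q"
  by (elim block_index_cases) (simp add: degree_of_offset)

lemma degree_of_ge: "block_offset b q \<le> g \<Longrightarrow> g < n \<Longrightarrow> q \<le> degree_of g"
proof -
  assume g: "block_offset b q \<le> g" "g < n"
  then have "g < block_offset b (Suc p)" using offset_n by simp
  then obtain i c where i: "i < Suc p" "c < b i" "g = block_offset b i + c" by (rule block_index_cases)
  have "q \<le> i"
  proof (rule ccontr)
    assume "\<not> q \<le> i"
    then show False using block_offset_less[of i q c b] i g by simp
  qed
  then show ?thesis using i by (simp add: degree_of_offset)
qed

lemma H_limit_block:
  assumes "q \<le> Suc j" "g < block_offset b q" "g' < block_offset b q"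
  shows "block_mat b b H q $$ (g, g') = H_limit g g'"
proof -
  obtain i c where i: "i < q" "c < b i" "g = block_offset b i + c" using assms(2) by (rule block_index_cases)
  obtain l c' where l: "l < q" "c' < b l" "g' = block_offset b l + c'" using assms(3) by (rule block_index_cases)
  have "block_mat b b H q $$ (g, g') = H i l $$ (c, c')"
    unfolding i(3) l(3) by (rule block_mat_index) (use i l assms(1) j H_carrier in auto)
  then show ?thesis unfolding i(3) l(3) using H_limit_offset i l assms(1) by simp
qed

lemma H_limit_row:
  assumes "r < b j" "g < block_offset b j"
  shows "block_row (b j) (H j) j $$ (r, g) = H_limit (block_offset b j + r) g"
proof -
  obtain l c where l: "l < j" "c < b l" "g = block_offset b l + c" using assms(2) by (rule block_index_cases)
  have "block_row (b j) (H j) j $$ (r, g) = H j l $$ (r, c)"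
    unfolding l(3) by (rule block_row_index) (use l assms(1) j H_carrier in auto)
  then show ?thesis unfolding l(3) using H_limit_offset l assms(1) by simp
qed

lemma H_row_carrier: "block_row (b j) (H j) j \<in> carrier_mat (b j) (block_offset b j)"
  using j by (intro block_row_carrier H_carrier) auto

lemma det_H_limit:
  assumes "invertible_mat (block_mat h h W j)"
  shows "det (mat (block_offset b j) (block_offset b j) (\<lambda>(g, g'). H_limit g g')) \<noteq> 0"
proof -
  have "mat (block_offset b j) (block_offset b j) (\<lambda>(g, g'). H_limit g g') = block_mat b b H j"
    using H_block_carrier[of j] H_limit_block[of j] by (intro eq_matI) auto
  then show ?thesis
    using invertible_H_block[of j] assms invertible_mat_iff_det[OF H_block_carrier[of j]] by simp
qed

lemma sum_H_limit_high:
  assumes "g < n" "y = vec (b j) (\<lambda>c. v (block_offset b j + c))"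
  shows "(\<Sum>g'=block_offset b j..<n. H_limit g g' * v g') =
    (\<Sum>c<b j. H_limit g (block_offset b j + c) * y $ c)"
proof -
  let ?N = "block_offset b j"
  have "(\<Sum>g'=?N..<n. H_limit g g' * v g') = (\<Sum>g'=?N..<?N + b j. H_limit g g' * v g')"
  proof (rule sum.mono_neutral_right)
    show "\<forall>g'\<in>{?N..<n} - {?N..<?N + b j}. H_limit g g' * v g' = 0"
    proof
      fix g' assume "g' \<in> {?N..<n} - {?N..<?N + b j}"
      then have "Suc j \<le> degree_of g'" by (intro degree_of_ge) auto
      then show "H_limit g g' * v g' = 0" unfolding H_limit_def by simp
    qed
  qed (use offset_le_n[OF j] in auto)
  also have "\<dots> = (\<Sum>c<b j. H_limit g (?N + c) * v (?N + c))"
    using sum.shift_bounds_nat_ivl[of "\<lambda>g'. H_limit g g' * v g'" 0 ?N "b j"]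
    by (simp add: lessThan_atLeast0 add.commute)
  finally show ?thesis using assms(2) by simp
qed

lemma S_carrier: "S \<in> carrier_mat (b j) (b j)"
proof -
  have "dim_row S = b j" "dim_col S = b j"
    unfolding S_def using H_row_carrier by auto
  then show ?thesis by auto
qed

lemma H_limit_mult_vec:
  assumes x: "x \<in> carrier_vec (block_offset b j)" and y: "y \<in> carrier_vec (b j)"
  shows "g < block_offset b j \<Longrightarrow>
      (block_mat b b H j *\<^sub>v x) $ g = (\<Sum>g'<block_offset b j. H_limit g g' * x $ g')"
    and "r < b j \<Longrightarrow> (block_row (b j) (H j) j *\<^sub>v x) $ r =
      (\<Sum>g'<block_offset b j. H_limit (block_offset b j + r) g' * x $ g')"
    and "r < b j \<Longrightarrow> (H j j *\<^sub>v y) $ r =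
      (\<Sum>c<b j. H_limit (block_offset b j + r) (block_offset b j + c) * y $ c)"
    and "(\<And>g g'. g < n \<Longrightarrow> g' < n \<Longrightarrow> H_limit g g' = H_limit g' g) \<Longrightarrow> g < block_offset b j \<Longrightarrow>
      (transpose_mat (block_row (b j) (H j) j) *\<^sub>v y) $ g = (\<Sum>c<b j. H_limit g (block_offset b j + c) * y $ c)"
proof -
  note A = H_block_carrier[of j, simplified] and C = H_row_carrier
  have Hjj: "H j j \<in> carrier_mat (b j) (b j)" using H_carrier j by simp
  show "(block_mat b b H j *\<^sub>v x) $ g = (\<Sum>g'<block_offset b j. H_limit g g' * x $ g')"
    if "g < block_offset b j"
    using mult_mat_vec_index[OF A x that] H_limit_block[of j g] that by simp
  show "(block_row (b j) (H j) j *\<^sub>v x) $ r =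
      (\<Sum>g'<block_offset b j. H_limit (block_offset b j + r) g' * x $ g')" if "r < b j"
    using mult_mat_vec_index[OF C x that] H_limit_row[OF that] by simp
  show "(H j j *\<^sub>v y) $ r = (\<Sum>c<b j. H_limit (block_offset b j + r) (block_offset b j + c) * y $ c)" if "r < b j"
    using mult_mat_vec_index[OF Hjj y that] H_limit_offset[OF that] by simp
  assume sym: "\<And>g g'. g < n \<Longrightarrow> g' < n \<Longrightarrow> H_limit g g' = H_limit g' g" and g: "g < block_offset b j"
  have "(transpose_mat (block_row (b j) (H j) j) *\<^sub>v y) $ g =
      (\<Sum>c<b j. transpose_mat (block_row (b j) (H j) j) $$ (g, c) * y $ c)"
    by (rule mult_mat_vec_index[OF _ y g]) (use C in simp)
  also have "\<dots> = (\<Sum>c<b j. H_limit g (block_offset b j + c) * y $ c)"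
    using C g H_limit_row sym[of g] offset_le_n[OF j] by (intro sum.cong refl) simp
  finally show "(transpose_mat (block_row (b j) (H j) j) *\<^sub>v y) $ g =
      (\<Sum>c<b j. H_limit g (block_offset b j + c) * y $ c)" .
qed

text \<open>The hypotheses \<open>e1\<close> and \<open>e2\<close> have the form produced by
  \<open>eigenvector_limit_large_order\<close>. The rows of \<open>H_limit\<close> of degree above
  \<open>j\<close> are zero, so there \<open>e2\<close> reads 0 = \<mu> v_g, which is the second
  claim.\<close>

lemma limiting_eigenvector:
  assumes inv: "invertible_mat (block_mat h h W j)"
    and sym: "\<And>g g'. g < n \<Longrightarrow> g' < n \<Longrightarrow> H_limit g g' = H_limit g' g"
    and e1: "\<And>g. g < block_offset b j \<Longrightarrow>
      (\<Sum>g'<block_offset b j. H_limit g g' * w g') + (\<Sum>g'=block_offset b j..<n. H_limit g g' * v g') = 0"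
    and e2: "\<And>g. block_offset b j \<le> g \<Longrightarrow> g < n \<Longrightarrow>
      (\<Sum>g'<block_offset b j. H_limit g g' * w g') + (\<Sum>g'=block_offset b j..<n. H_limit g g' * v g') = \<mu> * v g"
    and y: "y = vec (b j) (\<lambda>c. v (block_offset b j + c))"
  shows "S *\<^sub>v y = \<mu> \<cdot>\<^sub>v y" and "\<mu> \<noteq> 0 \<Longrightarrow> block_offset b (Suc j) \<le> g \<Longrightarrow> g < n \<Longrightarrow> v g = 0"
proof -
  let ?N = "block_offset b j" and ?A = "block_mat b b H j" and ?C = "block_row (b j) (H j) j"
  have Nn: "?N + b j \<le> n" using offset_le_n[OF j] .
  define x where "x = vec ?N w"
  have xc: "x \<in> carrier_vec ?N" and yc: "y \<in> carrier_vec (b j)" unfolding x_def y by auto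
  have A: "?A \<in> carrier_mat ?N ?N" by (rule H_block_carrier) simp
  have C: "?C \<in> carrier_mat (b j) ?N" by (rule H_row_carrier)
  have Hjj: "H j j \<in> carrier_mat (b j) (b j)" using H_carrier j by simp
  have invA: "invertible_mat ?A" using invertible_H_block[of j] inv by simp
  have Ax: "?A *\<^sub>v x + transpose_mat ?C *\<^sub>v y = 0\<^sub>v ?N"
  proof (rule eq_vecI)
    fix g assume "g < dim_vec (0\<^sub>v ?N)"
    then have g: "g < ?N" by simp
    have "(?A *\<^sub>v x) $ g = (\<Sum>g'<?N. H_limit g g' * w g')"
      using H_limit_mult_vec(1)[OF xc yc g] unfolding x_def by simp
    moreover have "(transpose_mat ?C *\<^sub>v y) $ g = (\<Sum>c<b j. H_limit g (?N + c) * y $ c)"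
      by (rule H_limit_mult_vec(4)[OF xc yc sym g])
    moreover have "g < n" using g Nn by simp
    ultimately have "(?A *\<^sub>v x) $ g + (transpose_mat ?C *\<^sub>v y) $ g = 0"
      using e1[OF g] sum_H_limit_high[OF _ y, of g] by simp
    then show "(?A *\<^sub>v x + transpose_mat ?C *\<^sub>v y) $ g = 0\<^sub>v ?N $ g"
      using C g by simp
  qed (use C in auto)
  have Cx: "?C *\<^sub>v x + H j j *\<^sub>v y = \<mu> \<cdot>\<^sub>v y"
  proof (rule eq_vecI)
    fix r assume "r < dim_vec (\<mu> \<cdot>\<^sub>v y)"
    then have r: "r < b j" using yc by simp
    have "(?C *\<^sub>v x) $ r = (\<Sum>g'<?N. H_limit (?N + r) g' * w g')"
      using H_limit_mult_vec(2)[OF xc yc r] unfolding x_def by simp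
    moreover note H_limit_mult_vec(3)[OF xc yc r]
    moreover have "?N + r < n" using r Nn by simp
    ultimately have "(?C *\<^sub>v x) $ r + (H j j *\<^sub>v y) $ r = \<mu> * v (?N + r)"
      using e2[of "?N + r"] sum_H_limit_high[OF _ y, of "?N + r"] by simp
    then show "(?C *\<^sub>v x + H j j *\<^sub>v y) $ r = (\<mu> \<cdot>\<^sub>v y) $ r"
      using Hjj r y by (simp del: index_mult_mat_vec)
  qed (use Hjj y in auto)
  show "S *\<^sub>v y = \<mu> \<cdot>\<^sub>v y"
    unfolding S_def by (rule schur_complement_eigenvector[OF A invA C Hjj xc yc Ax Cx])
  assume mu: "\<mu> \<noteq> 0" and g: "block_offset b (Suc j) \<le> g" "g < n"
  have "Suc j \<le> degree_of g" using degree_of_ge[OF g] .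
  then have z: "H_limit g g' = 0" for g' unfolding H_limit_def by simp
  show "v g = 0" using e2[of g] g mu unfolding z by simp
qed

text \<open>If S y = 0 and x = A^{-1} C^T y, then (x, -y) lies in the kernel of the
  \<open>H\<close>-block of all degrees up to \<open>j\<close>, which is congruent to the invertible
  \<open>W\<close>-block.\<close>

lemma S_injective:
  assumes inv: "invertible_mat (block_mat h h W j)" and inv': "invertible_mat (block_mat h h W (Suc j))"
    and sym: "\<And>g g'. g < n \<Longrightarrow> g' < n \<Longrightarrow> H_limit g g' = H_limit g' g"
    and y: "y \<in> carrier_vec (b j)" "S *\<^sub>v y = 0\<^sub>v (b j)"
  shows "y = 0\<^sub>v (b j)"
proof -
  let ?N = "block_offset b j" and ?A = "block_mat b b H j" and ?C = "block_row (b j) (H j) j"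
    and ?H = "block_mat b b H (Suc j)"
  have Nn: "?N + b j \<le> n" using offset_le_n[OF j] .
  have A: "?A \<in> carrier_mat ?N ?N" by (rule H_block_carrier) simp
  have C: "?C \<in> carrier_mat (b j) ?N" and CT: "transpose_mat ?C \<in> carrier_mat ?N (b j)"
    using H_row_carrier by auto
  have Hjj: "H j j \<in> carrier_mat (b j) (b j)" using H_carrier j by simp
  have Hc: "?H \<in> carrier_mat (?N + b j) (?N + b j)" using H_block_carrier[of "Suc j"] by simp
  have "invertible_mat ?A" using invertible_H_block[of j] inv by simp
  note I = invertible_mat_inverse[OF this A]
  define z where "z = transpose_mat ?C *\<^sub>v y"
  define x where "x = inv_mat ?A *\<^sub>v z"
  have z: "z \<in> carrier_vec ?N" unfolding z_def using CT y(1) by auto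
  have x: "x \<in> carrier_vec ?N" unfolding x_def using I(1) z by auto
  have Ax: "?A *\<^sub>v x = z"
    unfolding x_def using assoc_mult_mat_vec[OF A I(1) z] I(2) z by simp
  have Cx: "?C *\<^sub>v x = H j j *\<^sub>v y"
  proof -
    have "(?C * inv_mat ?A * transpose_mat ?C) *\<^sub>v y = ?C *\<^sub>v x"
      unfolding x_def z_def using assoc_mult_mat_vec[OF mult_carrier_mat[OF C I(1)] CT y(1)]
        assoc_mult_mat_vec[OF C I(1) z[unfolded z_def]] by simp
    moreover have "S *\<^sub>v y = H j j *\<^sub>v y - (?C * inv_mat ?A * transpose_mat ?C) *\<^sub>v y"
      unfolding S_def by (rule minus_mult_distrib_mat_vec[OF Hjj _ y(1)]) (use C I CT in auto)
    ultimately have eq: "H j j *\<^sub>v y - ?C *\<^sub>v x = 0\<^sub>v (b j)" using y(2) by simp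
    show ?thesis
    proof (rule eq_vecI)
      fix r assume "r < dim_vec (H j j *\<^sub>v y)"
      then have r: "r < b j" using Hjj by simp
      have "(H j j *\<^sub>v y - ?C *\<^sub>v x) $ r = 0" unfolding eq using r by simp
      then show "(?C *\<^sub>v x) $ r = (H j j *\<^sub>v y) $ r" using C Hjj r by (simp del: index_mult_mat_vec)
    qed (use C Hjj in auto)
  qed
  define t where "t = vec (?N + b j) (\<lambda>g. if g < ?N then x $ g else - y $ (g - ?N))"
  have t: "t \<in> carrier_vec (?N + b j)" unfolding t_def by simp
  have row: "(?H *\<^sub>v t) $ g = (\<Sum>g'<?N. H_limit g g' * x $ g') - (\<Sum>c<b j. H_limit g (?N + c) * y $ c)"
    if g: "g < ?N + b j" for g
  proof -
    have "(?H *\<^sub>v t) $ g = (\<Sum>g'<?N + b j. H_limit g g' * t $ g')"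
      using mult_mat_vec_index[OF Hc t g] H_limit_block[of "Suc j" g] g by simp
    also have "\<dots> = (\<Sum>g'<?N. H_limit g g' * x $ g') + (\<Sum>c<b j. H_limit g (?N + c) * - y $ c)"
      unfolding sum_lessThan_add by (intro arg_cong2[of _ _ _ _ "(+)"] sum.cong) (auto simp: t_def)
    finally show ?thesis by (simp add: sum_negf)
  qed
  have "?H *\<^sub>v t = 0\<^sub>v (?N + b j)"
  proof (rule eq_vecI)
    fix g assume "g < dim_vec (0\<^sub>v (?N + b j))"
    then have g: "g < ?N + b j" by simp
    show "(?H *\<^sub>v t) $ g = 0\<^sub>v (?N + b j) $ g"
    proof (cases "g < ?N")
      case True
      have "(\<Sum>g'<?N. H_limit g g' * x $ g') = (?A *\<^sub>v x) $ g"
        by (rule H_limit_mult_vec(1)[OF x y(1) True, symmetric])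
      moreover have "(\<Sum>c<b j. H_limit g (?N + c) * y $ c) = z $ g"
        unfolding z_def by (rule H_limit_mult_vec(4)[OF x y(1) sym True, symmetric])
      ultimately show ?thesis using row[OF g] Ax g by simp
    next
      case False
      define r where "r = g - ?N"
      have r: "r < b j" "g = ?N + r" using False g unfolding r_def by auto
      have "(\<Sum>g'<?N. H_limit g g' * x $ g') = (?C *\<^sub>v x) $ r"
        unfolding r(2) by (rule H_limit_mult_vec(2)[OF x y(1) r(1), symmetric])
      moreover have "(\<Sum>c<b j. H_limit g (?N + c) * y $ c) = (H j j *\<^sub>v y) $ r"
        unfolding r(2) by (rule H_limit_mult_vec(3)[OF x y(1) r(1), symmetric])
      ultimately show ?thesis using row[OF g] Cx g by simp
    qed
  qed (use Hc in auto)
  moreover have "invertible_mat ?H" using invertible_H_block[of "Suc j"] inv' by simp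
  ultimately have "t = 0\<^sub>v (?N + b j)" using invertible_mat_iff_kernel[OF Hc] t by blast
  then have "t $ (?N + c) = 0" if "c < b j" for c using that by simp
  then have "y $ c = 0" if "c < b j" for c using that unfolding t_def by simp
  then show ?thesis using y(1) by (intro eq_vecI) auto
qed

lemma sum_block_support:
  assumes "\<And>g. g < n \<Longrightarrow> g < block_offset b j \<or> block_offset b (Suc j) \<le> g \<Longrightarrow> f g = 0"
  shows "(\<Sum>g<n. f g) = (\<Sum>c<b j. f (block_offset b j + c) :: real)"
proof -
  have "(\<Sum>g<n. f g) = (\<Sum>g\<in>{block_offset b j..<block_offset b j + b j}. f g)"
    by (rule sum.mono_neutral_right) (use offset_le_n[OF j] assms in auto)
  also have "\<dots> = (\<Sum>c<b j. f (block_offset b j + c))"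
    using sum.shift_bounds_nat_ivl[of f 0 "block_offset b j" "b j"]
    by (simp add: lessThan_atLeast0 add.commute)
  finally show ?thesis .
qed

lemma Q_S_Q_carrier: "Q j * S * transpose_mat (Q j) \<in> carrier_mat n n"
  using Q_carrier[OF j] S_carrier by auto

text \<open>In the full orthogonal basis \<open>Qf\<close> the matrix becomes \<open>E\<close>,
  which is zero except for the diagonal block \<open>S\<close> in position \<open>j\<close>; each
  remaining index contributes a factor X.\<close>

lemma char_poly_Q_S_Q:
  "char_poly (Q j * S * transpose_mat (Q j)) = Polynomial.monom 1 (n - b j) * char_poly S"
proof -
  let ?N = "block_offset b j" and ?m = "n - (block_offset b j + b j)"
  have Nn: "?N + b j \<le> n" by (rule offset_le_n[OF j])
  define T where "T = four_block_mat S (0\<^sub>m (b j) ?m) (0\<^sub>m ?m (b j)) (0\<^sub>m ?m ?m)"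
  define E where "E = four_block_mat (0\<^sub>m ?N ?N) (0\<^sub>m ?N (b j + ?m)) (0\<^sub>m (b j + ?m) ?N) T"
  have T: "T \<in> carrier_mat (b j + ?m) (b j + ?m)" unfolding T_def using S_carrier by auto
  have E: "E \<in> carrier_mat n n" using T Nn unfolding E_def by auto
  have E_in: "E $$ (?N + c, ?N + c') = S $$ (c, c')" if "c < b j" "c' < b j" for c c'
    using that T S_carrier Nn unfolding E_def T_def by simp
  have E_out: "E $$ (g, g') = 0"
    if "g < n" "g' < n" "g < ?N \<or> ?N + b j \<le> g \<or> g' < ?N \<or> ?N + b j \<le> g'" for g g'
    using that T S_carrier Nn unfolding E_def T_def by auto
  have Qc: "Q j \<in> carrier_mat n (b j)" by (rule Q_carrier[OF j])
  have QT: "transpose_mat Qf \<in> carrier_mat n n" using Qf_carrier by simp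
  have QjT: "transpose_mat (Q j) \<in> carrier_mat (b j) n" using Qc by simp
  have eq: "Q j * S * transpose_mat (Q j) = Qf * E * transpose_mat Qf"
  proof (rule eq_matI)
    fix a a' assume "a < dim_row (Qf * E * transpose_mat Qf)" "a' < dim_col (Qf * E * transpose_mat Qf)"
    then have a: "a < n" "a' < n" using Qf_carrier by auto
    have "(Qf * E * transpose_mat Qf) $$ (a, a') = (\<Sum>g'<n. (Qf * E) $$ (a, g') * transpose_mat Qf $$ (g', a'))"
      by (rule mult_mat_index[OF mult_carrier_mat[OF Qf_carrier E] QT a])
    also have "\<dots> = (\<Sum>g'<n. (\<Sum>g<n. Qf $$ (a, g) * E $$ (g, g')) * Qf $$ (a', g'))"
      using mult_mat_index[OF Qf_carrier E a(1)] Qf_carrier a by (intro sum.cong refl) simp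
    also have "\<dots> = (\<Sum>c'<b j. (\<Sum>g<n. Qf $$ (a, g) * E $$ (g, ?N + c')) * Qf $$ (a', ?N + c'))"
      by (rule sum_block_support) (auto intro!: sum.neutral simp: E_out)
    also have "\<dots> = (\<Sum>c'<b j. (\<Sum>c<b j. Qf $$ (a, ?N + c) * E $$ (?N + c, ?N + c')) * Qf $$ (a', ?N + c'))"
    proof (rule sum.cong[OF refl])
      fix c' assume "c' \<in> {..<b j}"
      then have "?N + c' < n" using Nn by simp
      then have "(\<Sum>g<n. Qf $$ (a, g) * E $$ (g, ?N + c')) = (\<Sum>c<b j. Qf $$ (a, ?N + c) * E $$ (?N + c, ?N + c'))"
        by (intro sum_block_support) (auto simp: E_out)
      then show "(\<Sum>g<n. Qf $$ (a, g) * E $$ (g, ?N + c')) * Qf $$ (a', ?N + c') =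
          (\<Sum>c<b j. Qf $$ (a, ?N + c) * E $$ (?N + c, ?N + c')) * Qf $$ (a', ?N + c')" by simp
    qed
    also have "\<dots> = (\<Sum>c'<b j. (\<Sum>c<b j. Q j $$ (a, c) * S $$ (c, c')) * Q j $$ (a', c'))"
      using a j by (intro sum.cong refl arg_cong2[of _ _ _ _ "(*)"]) (simp_all add: Qf_index E_in)
    also have "\<dots> = (\<Sum>c'<b j. (Q j * S) $$ (a, c') * transpose_mat (Q j) $$ (c', a'))"
      using mult_mat_index[OF Qc S_carrier a(1)] Qc a by (intro sum.cong refl) simp
    also have "\<dots> = (Q j * S * transpose_mat (Q j)) $$ (a, a')"
      by (rule mult_mat_index[symmetric, OF mult_carrier_mat[OF Qc S_carrier] QjT a])
    finally show "(Q j * S * transpose_mat (Q j)) $$ (a, a') = (Qf * E * transpose_mat Qf) $$ (a, a')" ..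
  qed (use Qc Qf_carrier in auto)
  have "similar_mat (Q j * S * transpose_mat (Q j)) E"
    by (rule similar_matI[OF _ Qf_orthogonal(2,1) eq]) (use Q_S_Q_carrier E Qf_carrier in auto)
  then have "char_poly (Q j * S * transpose_mat (Q j)) = char_poly E" by (rule char_poly_similar)
  also have "\<dots> = Polynomial.monom 1 ?N * (char_poly S * Polynomial.monom 1 ?m)"
    unfolding E_def T_def using S_carrier T[unfolded T_def]
    by (simp add: char_poly_block_diagonal[of _ ?N _ "b j + ?m"] char_poly_block_diagonal[of _ "b j" _ ?m] char_poly_zero_mat)
  also have "\<dots> = Polynomial.monom 1 (?N + ?m) * char_poly S"
    using mult_monom[of "1::real" ?N 1 ?m] by (simp add: mult_ac)
  also have "?N + ?m = n - b j" using Nn by simp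
  finally show ?thesis .
qed

text \<open>For nonzero \<mu> the hypothesis \<open>out\<close> confines the coordinates of
  \<open>w\<close> to block \<open>j\<close>, so \<open>w = Q_j y\<close>; for \<mu> = 0 both sides
  are zero because S y = 0.\<close>

lemma Q_S_Q_eigenvector:
  assumes w: "w \<in> carrier_vec n" and y: "y = vec (b j) (\<lambda>c. (transpose_mat Qf *\<^sub>v w) $ (block_offset b j + c))"
    and Sy: "S *\<^sub>v y = \<mu> \<cdot>\<^sub>v y"
    and out: "\<And>g. \<mu> \<noteq> 0 \<Longrightarrow> g < n \<Longrightarrow> g < block_offset b j \<or> block_offset b (Suc j) \<le> g \<Longrightarrow>
      (transpose_mat Qf *\<^sub>v w) $ g = 0"
  shows "(Q j * S * transpose_mat (Q j)) *\<^sub>v w = \<mu> \<cdot>\<^sub>v w"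
proof -
  have Qc: "Q j \<in> carrier_mat n (b j)" by (rule Q_carrier[OF j])
  have QT: "transpose_mat Qf \<in> carrier_mat n n" using Qf_carrier by simp
  have QjT: "transpose_mat (Q j) \<in> carrier_mat (b j) n" using Qc by simp
  have yc: "y \<in> carrier_vec (b j)" unfolding y by simp
  define v where "v = transpose_mat Qf *\<^sub>v w"
  have v: "v \<in> carrier_vec n" unfolding v_def using QT w by auto
  have "transpose_mat (Q j) *\<^sub>v w = y"
  proof (rule eq_vecI)
    fix c assume "c < dim_vec y"
    then have c: "c < b j" using yc by simp
    have cn: "block_offset b j + c < n" using c offset_le_n[OF j] by simp
    have "(transpose_mat (Q j) *\<^sub>v w) $ c = (\<Sum>a<n. Q j $$ (a, c) * w $ a)"
      using mult_mat_vec_index[OF QjT w c] Qc c by simp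
    also have "\<dots> = (transpose_mat Qf *\<^sub>v w) $ (block_offset b j + c)"
      using mult_mat_vec_index[OF QT w cn] Qf_carrier Qf_index[OF j c] cn by simp
    finally show "(transpose_mat (Q j) *\<^sub>v w) $ c = y $ c" unfolding y using c by simp
  qed (use QjT yc in auto)
  then have 1: "(Q j * S * transpose_mat (Q j)) *\<^sub>v w = Q j *\<^sub>v (\<mu> \<cdot>\<^sub>v y)"
    using assoc_mult_mat_vec[OF mult_carrier_mat[OF Qc S_carrier] QjT w] assoc_mult_mat_vec[OF Qc S_carrier yc] Sy
    by simp
  show ?thesis
  proof (rule eq_vecI)
    fix a assume "a < dim_vec (\<mu> \<cdot>\<^sub>v w)"
    then have a: "a < n" using w by simp
    have Qy: "(Q j *\<^sub>v (\<mu> \<cdot>\<^sub>v y)) $ a = \<mu> * (\<Sum>c<b j. Q j $$ (a, c) * y $ c)"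
      using mult_mat_vec_index[OF Qc _ a, of "\<mu> \<cdot>\<^sub>v y"] yc by (simp add: sum_distrib_left mult_ac)
    have "\<mu> * (\<Sum>c<b j. Q j $$ (a, c) * y $ c) = \<mu> * w $ a"
    proof (cases "\<mu> = 0")
      case False
      have "w = Qf *\<^sub>v v"
        unfolding v_def using assoc_mult_mat_vec[OF Qf_carrier QT w] Qf_orthogonal(2) w by simp
      then have "w $ a = (\<Sum>g<n. Qf $$ (a, g) * v $ g)"
        using mult_mat_vec_index[OF Qf_carrier v a] by simp
      also have "\<dots> = (\<Sum>c<b j. Qf $$ (a, block_offset b j + c) * v $ (block_offset b j + c))"
        by (rule sum_block_support) (use out[OF False] in \<open>auto simp: v_def\<close>)
      also have "\<dots> = (\<Sum>c<b j. Q j $$ (a, c) * y $ c)"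
        using Qf_index[OF j _ a] by (intro sum.cong refl) (simp add: y v_def)
      finally show ?thesis by simp
    qed simp
    then show "((Q j * S * transpose_mat (Q j)) *\<^sub>v w) $ a = (\<mu> \<cdot>\<^sub>v w) $ a"
      unfolding 1 Qy using w a by simp
  qed (use Qc w in auto)
qed

end

theorem corollary6p13:
  fixes x :: "nat \<Rightarrow> real ^ 'd::{finite,linorder}"
    and n p j :: nat
    and mi :: "nat \<Rightarrow> ('d \<Rightarrow> nat) list"
    and k :: "real ^ 'd::{finite,linorder} \<Rightarrow> real ^ 'd::{finite,linorder} \<Rightarrow> real"
    and K :: "real \<Rightarrow> real mat"
    and ev :: "nat \<Rightarrow> real \<Rightarrow> real"
    and u :: "nat \<Rightarrow> real \<Rightarrow> real vec"
    and V Q :: "nat \<Rightarrow> real mat"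
    and W R H :: "nat \<Rightarrow> nat \<Rightarrow> real mat"
    and h rk b :: "nat \<Rightarrow> nat"
    and S SW :: "real mat"
    and G :: "nat set"
  assumes ordering: "monomial_ordering mi"
    and V_def: "V = vandermonde mi n x"
    and h_def: "h = (\<lambda>s. length (mi s))"
    \<comment> \<open>\<open>rk s\<close> is the rank of $V_{\le s-1}$\<close>
    and rk_def: "rk = (\<lambda>s. vec_space.rank n (block_row n V s))"
    and b_def: "b = (\<lambda>i. rk (Suc i) - rk i)"
    and W_def: "W = wronskian mi k"
    and p: "rk (Suc p) = n" "\<And>q. q < p \<Longrightarrow> rk (Suc q) \<noteq> n"
    and kernel: "pos_def_kernel k"
    and smoothness:
      "(\<exists>r. enat (p + 1) \<le> r \<and> radial_kernel_matrix r k n x K) \<or>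
       smooth_kernel_matrix (p + 1) k n x K"
    and eigensystem: "analytic_eigensystem n K ev u"
    and QR: "block_QR n p h b V Q R"
    and H_def: "H = (\<lambda>i l. R i i * W i l * transpose_mat (R l l))"
    and S_def: "S = schur_complement b H j"
    and j: "j \<le> p"
    and full_column_rank: "rk (Suc j) = dim_col (block_row n V (Suc j))"
    \<comment> \<open>$(W_{<j,<j})^{-1}$ exists\<close>
    and W_lt_invertible: "invertible_mat (block_mat h h W j)"
    and SW_def:
      "SW = W j j - block_row (h j) (W j) j * inv_mat (block_mat h h W j)
                      * transpose_mat (block_row (h j) (W j) j)"
    and G_def: "G = {i. i < n \<and> of_order (ev i) (2 * j)}"
  \<comment> \<open>The first two conjuncts: the size of the block; all its eigenvalues are of exact order
      $\varepsilon^{2j}$ if $W_{\le j,\le j}$ is nonsingular. The last four: leading coefficients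
      with multiplicity, limiting eigenvectors, coefficient of $\varepsilon^{2j}$ in the
      asymptotic spectral equivalent.\<close>
  shows
    "b j = (j + CARD('d) - 1) choose (CARD('d) - 1) \<and>
     (invertible_mat (block_mat h h W (Suc j)) \<longrightarrow>
        card G = (j + CARD('d) - 1) choose (CARD('d) - 1)) \<and>
     invertible_mat (block_mat b b H j) \<and>
     S = (if j = 0 then R 0 0 * W 0 0 * transpose_mat (R 0 0)
          else R j j * SW * transpose_mat (R j j)) \<and>
     card G \<le> b j \<and>
     char_poly S =
       Polynomial.monom 1 (b j - card G) *
         (\<Prod>i\<in>G. [:- Polynomial.lead_coeff (lead_term (ev i)), 1:]) \<and>
     (\<forall>i\<in>G. eigenvector (Q j * S * transpose_mat (Q j)) (u i 0)
                (Polynomial.lead_coeff (lead_term (ev i)))) \<and>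
     map_mat (\<lambda>q. Polynomial.coeff q (2 * j)) (spectral_equivalent n ev u) =
       Q j * S * transpose_mat (Q j) \<and>
     Q j * S * transpose_mat (Q j) =
       (if j = 0 then V 0 * W 0 0 * transpose_mat (V 0)
        else Q j * transpose_mat (Q j) * V j * SW * transpose_mat (V j)
               * Q j * transpose_mat (Q j))"
proof -
  have Vc: "V s \<in> carrier_mat n (h s)" for s
    unfolding V_def h_def vandermonde_def by simp
  have Wc: "W i l \<in> carrier_mat (h i) (h l)" for i l
    unfolding W_def h_def wronskian_def by simp
  interpret qr: qr_schur n p h b V Q R j rk W H
    by unfold_locales (fact QR Vc rk_def b_def j full_column_rank Wc H_def)+
  define N where "N = block_offset b j"
  have Nn: "N + b j \<le> n" unfolding N_def by (rule qr.offset_le_n[OF j])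
  have inj: "inj_on x {..<n}"
    using p(1) unfolding rk_def V_def by (rule distinct_points)
  note kernel_matrix = scaled_kernel_matrix[OF smoothness]
  have kj: "Cqq_near_0 j k" by (rule Cqq_near_0_mono[OF kernel_matrix(1) j])
  have k_sym: "k y z = k z y" for y z using kernel unfolding pos_def_kernel_def by simp
  have K_carrier: "K \<epsilon> \<in> carrier_mat n n" if "\<epsilon> > 0" for \<epsilon>
    unfolding kernel_matrix(2)[OF that] by simp
  have K_pos: "pos_def_mat (K \<epsilon>)" if "\<epsilon> > 0" for \<epsilon>
  proof -
    have "inj_on (\<lambda>i. \<epsilon> *\<^sub>R x i) {..<n}" using inj that by (auto simp: inj_on_def)
    then show ?thesis using kernel unfolding kernel_matrix(2)[OF that] pos_def_kernel_def by blast
  qed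
  have ev_pos: "\<forall>\<^sub>F \<epsilon> in at_right 0. (0 :: real) < \<epsilon>" by (rule eventually_at_right_less)

  \<comment> \<open>Eigenpairs and leading terms of the eigenvalues\<close>
  let ?eigen = "\<lambda>\<epsilon>. \<forall>i<n. u i \<epsilon> \<in> carrier_vec n \<and> K \<epsilon> *\<^sub>v u i \<epsilon> = ev i \<epsilon> \<cdot>\<^sub>v u i \<epsilon> \<and>
        (\<forall>l<n. u i \<epsilon> \<bullet> u l \<epsilon> = (if i = l then 1 else 0))"
  have eigen: "\<forall>\<^sub>F \<epsilon> in nhds 0. ?eigen \<epsilon>"
    using eigensystem unfolding analytic_eigensystem_def by blast
  have orth: "orthonormal_family n (\<lambda>i. u i \<epsilon>)" if "?eigen \<epsilon>" for \<epsilon>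
  proof -
    have "u i \<epsilon> \<bullet> u l \<epsilon> = (\<Sum>a<n. u i \<epsilon> $ a * u l \<epsilon> $ a)" if "l < n" for i l
      using \<open>?eigen \<epsilon>\<close> that by (auto simp: scalar_prod_def lessThan_atLeast0)
    then show ?thesis using that unfolding orthonormal_family_def by metis
  qed
  \<comment> \<open>The neighbourhood filter includes the point 0 itself, so the limiting
    eigenvectors are orthonormal too.\<close>
  have eigen0: "?eigen 0" using eigen by (rule eventually_nhds_x_imp_x)
  note orth0 = orth[OF eigen0]
  have eigen_right: "\<forall>\<^sub>F \<epsilon> in at_right 0. ?eigen \<epsilon> \<and> \<epsilon> > 0"
    using eigen ev_pos unfolding eventually_at_filter by eventually_elim auto
  \<comment> \<open>The eigenvalue is the Rayleigh quotient of its unit eigenvector.\<close>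
  have lam_pos: "\<forall>\<^sub>F \<epsilon> in at_right 0. ev i \<epsilon> > 0" if i: "i < n" for i
    using eigen_right
  proof eventually_elim
    case (elim \<epsilon>)
    have uc: "u i \<epsilon> \<in> carrier_vec n" and Ku: "K \<epsilon> *\<^sub>v u i \<epsilon> = ev i \<epsilon> \<cdot>\<^sub>v u i \<epsilon>" and uu: "u i \<epsilon> \<bullet> u i \<epsilon> = 1"
      using elim i by auto
    have "u i \<epsilon> \<noteq> 0\<^sub>v n" using uu uc by auto
    then have "u i \<epsilon> \<bullet> (K \<epsilon> *\<^sub>v u i \<epsilon>) > 0"
      using K_pos[of \<epsilon>] K_carrier[of \<epsilon>] elim uc unfolding pos_def_mat_def by auto
    then show ?case unfolding Ku using uu uc by simp
  qed
  have "\<forall>i. \<exists>a c. i < n \<longrightarrow> c > 0 \<and> leading_asymptotic (ev i) a c"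
    using analytic_positive_leading_asymptotic[OF _ lam_pos] eigensystem
    unfolding analytic_eigensystem_def by blast
  then obtain a c where ac: "\<And>i. i < n \<Longrightarrow> c i > 0" "\<And>i. i < n \<Longrightarrow> leading_asymptotic (ev i) (a i) (c i)"
    unfolding choice_iff by blast
  have order: "of_order (ev i) m \<longleftrightarrow> a i = m" if "i < n" for i m
    unfolding of_order_def using ac(2)[OF that] leading_asymptotic_unique by blast
  have lt: "lead_term (ev i) = Polynomial.monom (c i) (a i)" if "i < n" for i
    by (rule lead_term_eq[OF ac(2)[OF that]])
  have lc: "Polynomial.lead_coeff (lead_term (ev i)) = c i" if "i < n" for i
    unfolding lt[OF that] by (rule lead_coeff_monom)
  \<comment> \<open>For orders from 2j on this is the limit of ev i / eps^(2j). Orders below 2j also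
    receive 0, because their limiting eigenvectors turn out to be orthogonal to the columns of
    \<open>Q_j\<close>.\<close>
  define \<mu> where "\<mu> i = (if a i = 2 * j then c i else 0)" for i
  have G: "G = {i. i < n \<and> a i = 2 * j}" unfolding G_def using order by blast

  \<comment> \<open>Passage to the basis of the block QR factorisation\<close>
  define M where "M \<epsilon> = transpose_mat qr.Qf * K \<epsilon> * qr.Qf" for \<epsilon>
  define v where "v i \<epsilon> = transpose_mat qr.Qf *\<^sub>v u i \<epsilon>" for i \<epsilon>
  note Qf = qr.Qf_carrier
  have QT: "transpose_mat qr.Qf \<in> carrier_mat n n" using Qf by simp
  have M_carrier: "M \<epsilon> \<in> carrier_mat n n" if "\<epsilon> > 0" for \<epsilon>
    unfolding M_def using QT K_carrier[OF that] Qf by auto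
  have M_index: "M \<epsilon> $$ (g, g') =
      (\<Sum>i<n. \<Sum>l<n. qr.Qf $$ (i, g) * qr.Qf $$ (l, g') * k (\<epsilon> *\<^sub>R x i) (\<epsilon> *\<^sub>R x l))"
    if e: "\<epsilon> > 0" and g: "g < n" "g' < n" for \<epsilon> g g'
  proof -
    have "M \<epsilon> $$ (g, g') = (\<Sum>l<n. (transpose_mat qr.Qf * K \<epsilon>) $$ (g, l) * qr.Qf $$ (l, g'))"
      unfolding M_def by (rule mult_mat_index[OF mult_carrier_mat[OF QT K_carrier[OF e]] Qf g])
    also have "\<dots> = (\<Sum>l<n. (\<Sum>i<n. qr.Qf $$ (i, g) * k (\<epsilon> *\<^sub>R x i) (\<epsilon> *\<^sub>R x l)) * qr.Qf $$ (l, g'))"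
    proof (rule sum.cong[OF refl])
      fix l assume "l \<in> {..<n}"
      then have l: "l < n" by simp
      have "(transpose_mat qr.Qf * K \<epsilon>) $$ (g, l) = (\<Sum>i<n. qr.Qf $$ (i, g) * k (\<epsilon> *\<^sub>R x i) (\<epsilon> *\<^sub>R x l))"
        unfolding mult_mat_index[OF QT K_carrier[OF e] g(1) l]
        using Qf g l by (intro sum.cong refl) (simp add: kernel_matrix(2)[OF e])
      then show "(transpose_mat qr.Qf * K \<epsilon>) $$ (g, l) * qr.Qf $$ (l, g') =
          (\<Sum>i<n. qr.Qf $$ (i, g) * k (\<epsilon> *\<^sub>R x i) (\<epsilon> *\<^sub>R x l)) * qr.Qf $$ (l, g')" by simp
    qed
    also have "\<dots> = (\<Sum>l<n. \<Sum>i<n. qr.Qf $$ (i, g) * qr.Qf $$ (l, g') * k (\<epsilon> *\<^sub>R x i) (\<epsilon> *\<^sub>R x l))"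
      by (simp add: sum_distrib_left mult_ac)
    finally show ?thesis by (subst sum.swap)
  qed
  have v_carrier: "v i \<epsilon> \<in> carrier_vec n" if "u i \<epsilon> \<in> carrier_vec n" for i \<epsilon>
    unfolding v_def using QT that by auto
  have v_index: "v i \<epsilon> $ g = (\<Sum>l<n. qr.Qf $$ (l, g) * u i \<epsilon> $ l)"
    if "u i \<epsilon> \<in> carrier_vec n" "g < n" for i \<epsilon> g
    unfolding v_def mult_mat_vec_index[OF QT that] using Qf that by (intro sum.cong refl) simp
  have v_eigen: "M \<epsilon> *\<^sub>v v i \<epsilon> = ev i \<epsilon> \<cdot>\<^sub>v v i \<epsilon>" if "?eigen \<epsilon>" "\<epsilon> > 0" "i < n" for i \<epsilon>
  proof -
    have uc: "u i \<epsilon> \<in> carrier_vec n" and Ku: "K \<epsilon> *\<^sub>v u i \<epsilon> = ev i \<epsilon> \<cdot>\<^sub>v u i \<epsilon>" using that by auto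
    have "qr.Qf *\<^sub>v v i \<epsilon> = u i \<epsilon>"
      unfolding v_def using assoc_mult_mat_vec[OF Qf QT uc] qr.Qf_orthogonal(2) uc by simp
    then have "M \<epsilon> *\<^sub>v v i \<epsilon> = transpose_mat qr.Qf *\<^sub>v (ev i \<epsilon> \<cdot>\<^sub>v u i \<epsilon>)"
      unfolding M_def using assoc_mult_mat_vec[OF mult_carrier_mat[OF QT K_carrier[OF that(2)]] Qf v_carrier[OF uc]]
        assoc_mult_mat_vec[OF QT K_carrier[OF that(2)] uc] Ku by simp
    also have "\<dots> = ev i \<epsilon> \<cdot>\<^sub>v v i \<epsilon>" unfolding v_def by (rule mult_mat_vec[OF QT uc])
    finally show ?thesis .
  qed
  have v_orth: "orthonormal_family n (\<lambda>i. v i \<epsilon>)" if "?eigen \<epsilon>" for \<epsilon>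
    unfolding orthonormal_family_def
  proof (intro conjI allI impI)
    fix i l assume il: "i < n" "l < n"
    have uc: "u i \<epsilon> \<in> carrier_vec n" "u l \<epsilon> \<in> carrier_vec n" using that il by auto
    have "(\<Sum>g<n. v i \<epsilon> $ g * v l \<epsilon> $ g) = v i \<epsilon> \<bullet> v l \<epsilon>"
      using v_carrier[OF uc(2)] by (simp add: scalar_prod_def lessThan_atLeast0)
    also have "\<dots> = u i \<epsilon> \<bullet> (qr.Qf *\<^sub>v v l \<epsilon>)"
      unfolding v_def[of i] using transpose_vec_mult_scalar[OF Qf v_carrier[OF uc(2)] uc(1)] by simp
    also have "qr.Qf *\<^sub>v v l \<epsilon> = u l \<epsilon>"
      unfolding v_def using assoc_mult_mat_vec[OF Qf QT uc(2)] qr.Qf_orthogonal(2) uc by simp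
    finally show "(\<Sum>g<n. v i \<epsilon> $ g * v l \<epsilon> $ g) = (if i = l then 1 else 0)" using that il by simp
  qed (use that v_carrier in auto)
  have v_lim: "((\<lambda>\<epsilon>. v i \<epsilon> $ g) \<longlongrightarrow> v i 0 $ g) (at_right 0)" if i: "i < n" and g: "g < n" for i g
  proof -
    have "((\<lambda>\<epsilon>. u i \<epsilon> $ l) \<longlongrightarrow> u i 0 $ l) (at_right 0)" if "l < n" for l
    proof -
      have "analytic_0 (\<lambda>\<epsilon>. u i \<epsilon> $ l)"
        using eigensystem i that unfolding analytic_eigensystem_def by blast
      then have "isCont (\<lambda>\<epsilon>. u i \<epsilon> $ l) 0" by (rule analytic_0_isCont)
      then show ?thesis unfolding isCont_def by (rule tendsto_mono[rotated]) (simp add: at_le)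
    qed
    then have "((\<lambda>\<epsilon>. \<Sum>l<n. qr.Qf $$ (l, g) * u i \<epsilon> $ l) \<longlongrightarrow> (\<Sum>l<n. qr.Qf $$ (l, g) * u i 0 $ l)) (at_right 0)"
      by (intro tendsto_sum tendsto_mult tendsto_const) auto
    moreover have "\<forall>\<^sub>F \<epsilon> in at_right 0. (\<Sum>l<n. qr.Qf $$ (l, g) * u i \<epsilon> $ l) = v i \<epsilon> $ g"
      using eigen_right by eventually_elim (use v_index i g in auto)
    ultimately show ?thesis
      using v_index[of i 0 g] eigen0 i g by (auto elim: Lim_transform_eventually)
  qed

  \<comment> \<open>Degrees above \<open>j\<close> are capped at \<open>j\<close>, so that at most
    \<open>j\<close> derivatives are taken in each argument.\<close>
  define m where "m g = min (qr.degree_of g) j" for g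
  have annih: "annihilates n x (\<lambda>i. qr.Qf $$ (i, g)) (qr.degree_of g)" if g: "g < n" for g
  proof (rule annihilates_vandermonde[OF ordering])
    fix s c' assume s: "s < qr.degree_of g" "c' < length (mi s)"
    have "g < block_offset b (Suc p)" using g qr.offset_n by simp
    then obtain i r where i: "i < Suc p" "r < b i" "g = block_offset b i + r" by (rule block_index_cases)
    have "s < i" using s i qr.degree_of_offset by simp
    then have "R i s = 0\<^sub>m (b i) (h s)" using qr.R_lower i by simp
    then show "(\<Sum>a<n. qr.Qf $$ (a, g) * vandermonde mi n x s $$ (a, c')) = 0"
      using qr.Qf_V[of i r s c'] i s \<open>s < i\<close> unfolding V_def h_def by simp
  qed
  have M_lim: "((\<lambda>\<epsilon>. M \<epsilon> $$ (g, g') / \<epsilon> ^ (m g + m g')) \<longlongrightarrow> qr.H_limit g g') (at_right 0)"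
    if g: "g < n" "g' < n" for g g'
  proof -
    have "g < block_offset b (Suc p)" "g' < block_offset b (Suc p)" using g qr.offset_n by auto
    then obtain i r l r' where i: "i < Suc p" "r < b i" "g = block_offset b i + r"
      and l: "l < Suc p" "r' < b l" "g' = block_offset b l + r'"
      by (elim block_index_cases)
    have dg: "qr.degree_of g = i" "qr.degree_of g' = l" using i l qr.degree_of_offset by auto
    have mp: "m g \<le> j" "m g' \<le> j" "m g \<le> p" "m g' \<le> p" using j unfolding m_def by auto
    have "((\<lambda>\<epsilon>. (\<Sum>a<n. \<Sum>a'<n. qr.Qf $$ (a, g) * qr.Qf $$ (a', g') * k (\<epsilon> *\<^sub>R x a) (\<epsilon> *\<^sub>R x a')) / \<epsilon> ^ (m g + m g')) \<longlongrightarrow>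
      (\<Sum>c1<length (mi (m g)). \<Sum>c2<length (mi (m g')). (\<Sum>a<n. qr.Qf $$ (a, g) * vandermonde mi n x (m g) $$ (a, c1)) *
         wronskian mi k (m g) (m g') $$ (c1, c2) * (\<Sum>a'<n. qr.Qf $$ (a', g') * vandermonde mi n x (m g') $$ (a', c2)))) (at_right 0)"
      by (intro kernel_functional_limit_vandermonde[OF kj mp(1,2) ordering] annihilates_mono[OF annih])
        (use g in \<open>auto simp: m_def\<close>)
    also have "(\<Sum>c1<length (mi (m g)). \<Sum>c2<length (mi (m g')). (\<Sum>a<n. qr.Qf $$ (a, g) * vandermonde mi n x (m g) $$ (a, c1)) *
         wronskian mi k (m g) (m g') $$ (c1, c2) * (\<Sum>a'<n. qr.Qf $$ (a', g') * vandermonde mi n x (m g') $$ (a', c2))) =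
      (\<Sum>c1<h (m g). \<Sum>c2<h (m g'). R i (m g) $$ (r, c1) * W (m g) (m g') $$ (c1, c2) * R l (m g') $$ (r', c2))"
      using qr.Qf_V[of i r "m g"] qr.Qf_V[of l r' "m g'"] i l mp
      unfolding V_def[symmetric] W_def[symmetric] h_def by (intro sum.cong refl) simp
    also have "\<dots> = qr.H_limit g g'"
    proof (cases "i \<le> j \<and> l \<le> j")
      case True
      then show ?thesis
        using qr.H_index[of i l r r'] qr.H_limit_offset[of r i r' l] i l unfolding m_def dg by simp
    next
      case False
      \<comment> \<open>If one of the degrees exceeds \<open>j\<close>, its capped value lies
        strictly below it; the block of \<open>R\<close> there is below the diagonal and vanishes,
        and with it the limit.\<close>
      have "R i (m g) $$ (r, c1) * W (m g) (m g') $$ (c1, c2) * R l (m g') $$ (r', c2) = 0"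
        if "c1 < h (m g)" "c2 < h (m g')" for c1 c2
      proof (cases "i \<le> j")
        case True
        then have "m g' < l" using False unfolding m_def dg by auto
        then show ?thesis using qr.R_lower[of l "m g'"] l that by simp
      next
        case False
        then have "m g < i" unfolding m_def dg by auto
        then show ?thesis using qr.R_lower[of i "m g"] i that by simp
      qed
      then show ?thesis using False unfolding qr.H_limit_def dg by (auto intro!: sum.neutral)
    qed
    finally have "((\<lambda>\<epsilon>. (\<Sum>a<n. \<Sum>a'<n. qr.Qf $$ (a, g) * qr.Qf $$ (a', g') * k (\<epsilon> *\<^sub>R x a) (\<epsilon> *\<^sub>R x a')) / \<epsilon> ^ (m g + m g')) \<longlongrightarrow>
      qr.H_limit g g') (at_right 0)" .
    moreover have "\<forall>\<^sub>F \<epsilon> in at_right 0. (\<Sum>a<n. \<Sum>a'<n. qr.Qf $$ (a, g) * qr.Qf $$ (a', g') * k (\<epsilon> *\<^sub>R x a) (\<epsilon> *\<^sub>R x a')) /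
        \<epsilon> ^ (m g + m g') = M \<epsilon> $$ (g, g') / \<epsilon> ^ (m g + m g')"
      using ev_pos by eventually_elim (simp add: M_index g)
    ultimately show ?thesis by (rule Lim_transform_eventually)
  qed
  \<comment> \<open>Symmetry passes to the limit from the symmetry of the kernel.\<close>
  have H_sym: "qr.H_limit g g' = qr.H_limit g' g" if g: "g < n" "g' < n" for g g'
  proof (rule tendsto_unique[OF trivial_limit_at_right_real M_lim[OF g]])
    have "\<forall>\<^sub>F \<epsilon> in at_right 0. M \<epsilon> $$ (g', g) / \<epsilon> ^ (m g' + m g) = M \<epsilon> $$ (g, g') / \<epsilon> ^ (m g + m g')"
      using ev_pos
    proof eventually_elim
      case (elim \<epsilon>)
      have "M \<epsilon> $$ (g', g) = M \<epsilon> $$ (g, g')"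
        unfolding M_index[OF elim g(2,1)] M_index[OF elim g]
        by (subst sum.swap) (auto intro!: sum.cong simp: k_sym mult_ac)
      then show ?case by (simp add: add.commute)
    qed
    then show "((\<lambda>\<epsilon>. M \<epsilon> $$ (g, g') / \<epsilon> ^ (m g + m g')) \<longlongrightarrow> qr.H_limit g' g) (at_right 0)"
      by (rule Lim_transform_eventually[OF M_lim[OF g(2,1)]])
  qed
  have m_low: "m g < j" if "g < N" for g
    using qr.degree_of_less[of g j] that unfolding m_def N_def by auto
  have m_high: "m g = j" if "N \<le> g" "g < n" for g
    using qr.degree_of_ge[of j g] that unfolding m_def N_def by auto

  \<comment> \<open>Limiting eigenvectors and the Schur complement\<close>
  define y where "y i = vec (b j) (\<lambda>r. v i 0 $ (N + r))" for i
  \<comment> \<open>The cases are orders below 2j and orders from 2j on; in the second case exact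
    order 2j and higher orders differ only in the value of \<open>\<mu> i\<close>.\<close>
  have limit: "qr.S *\<^sub>v y i = \<mu> i \<cdot>\<^sub>v y i \<and>
      (\<mu> i \<noteq> 0 \<longrightarrow> (\<forall>g<n. g < N \<or> block_offset b (Suc j) \<le> g \<longrightarrow> v i 0 $ g = 0))" if i: "i < n" for i
  proof (cases "a i < 2 * j")
    case True
    have "v i 0 $ g = 0" if g: "N \<le> g" "g < n" for g
    proof (rule eigenvector_limit_small_order[where M = "\<lambda>\<epsilon>. M \<epsilon> $$ (g, g)" and lam = ev
          and v = "\<lambda>i \<epsilon>. v i \<epsilon> $ g" and n = n and j = j and k = i and a = "a i" and c = "c i"])
      show "((\<lambda>\<epsilon>. M \<epsilon> $$ (g, g) / \<epsilon> ^ (2 * j)) \<longlongrightarrow> qr.H_limit g g) (at_right 0)"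
        using M_lim[OF g(2,2)] m_high[OF g] by (simp add: mult_2)
      show "\<forall>\<^sub>F \<epsilon> in at_right 0. M \<epsilon> $$ (g, g) = (\<Sum>i<n. ev i \<epsilon> * (v i \<epsilon> $ g)\<^sup>2)"
        using eigen_right
      proof eventually_elim
        case (elim \<epsilon>)
        then have e: "?eigen \<epsilon>" "\<epsilon> > 0" by blast+
        show ?case
          using spectral_decomposition[OF M_carrier[OF e(2)] v_orth[OF e(1)] v_eigen[OF e] g(2,2)]
          by (simp add: power2_eq_square)
      qed
      show "((\<lambda>\<epsilon>. ev i \<epsilon> / \<epsilon> ^ a i) \<longlongrightarrow> c i) (at_right 0)"
        by (rule leading_asymptotic_tendsto[OF ac(2)[OF i]])
      show "((\<lambda>\<epsilon>. v i \<epsilon> $ g) \<longlongrightarrow> v i 0 $ g) (at_right 0)" by (rule v_lim[OF i g(2)])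
    qed (use lam_pos i ac(1) True in auto)
    then have "y i = 0\<^sub>v (b j)" unfolding y_def using Nn by (intro eq_vecI) auto
    moreover have "\<mu> i = 0" using True unfolding \<mu>_def by simp
    moreover have "qr.S *\<^sub>v 0\<^sub>v (b j) = 0\<^sub>v (b j)" using qr.S_carrier by (intro eq_vecI) auto
    ultimately show ?thesis by auto
  next
    case False
    have lam_lim: "((\<lambda>\<epsilon>. ev i \<epsilon> / \<epsilon> ^ (2 * j)) \<longlongrightarrow> \<mu> i) (at_right 0)"
    proof -
      have pow: "((\<lambda>\<epsilon>. \<epsilon> ^ (a i - 2 * j)) \<longlongrightarrow> (0 :: real) ^ (a i - 2 * j)) (at_right 0)"
        by (intro tendsto_power tendsto_ident_at)
      have "((\<lambda>\<epsilon>. ev i \<epsilon> / \<epsilon> ^ a i * \<epsilon> ^ (a i - 2 * j)) \<longlongrightarrow> c i * 0 ^ (a i - 2 * j)) (at_right 0)"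
        by (intro tendsto_mult leading_asymptotic_tendsto[OF ac(2)[OF i]] pow)
      moreover have "\<forall>\<^sub>F \<epsilon> in at_right 0. ev i \<epsilon> / \<epsilon> ^ a i * \<epsilon> ^ (a i - 2 * j) = ev i \<epsilon> / \<epsilon> ^ (2 * j)"
        using ev_pos
      proof eventually_elim
        case (elim \<epsilon>)
        have "\<epsilon> ^ a i = \<epsilon> ^ (2 * j) * \<epsilon> ^ (a i - 2 * j)" using False by (simp flip: power_add)
        then show ?case using elim by simp
      qed
      ultimately have "((\<lambda>\<epsilon>. ev i \<epsilon> / \<epsilon> ^ (2 * j)) \<longlongrightarrow> c i * 0 ^ (a i - 2 * j)) (at_right 0)"
        by (rule Lim_transform_eventually)
      \<comment> \<open>The power is 0 ^ 0 = 1 for order exactly 2j and 0 for higher orders.\<close>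
      moreover have "c i * 0 ^ (a i - 2 * j) = \<mu> i" using False unfolding \<mu>_def by (simp add: power_0_left)
      ultimately show ?thesis by simp
    qed
    have "(\<forall>g<N. v i 0 $ g = 0) \<and> (\<exists>w0.
      (\<forall>g<N. (\<Sum>g'<N. qr.H_limit g g' * w0 g') + (\<Sum>g'=N..<n. qr.H_limit g g' * v i 0 $ g') = 0) \<and>
      (\<forall>g\<in>{N..<n}. (\<Sum>g'<N. qr.H_limit g g' * w0 g') + (\<Sum>g'=N..<n. qr.H_limit g g' * v i 0 $ g') = \<mu> i * v i 0 $ g))"
    proof (rule eigenvector_limit_large_order[where M = "\<lambda>\<epsilon> g g'. M \<epsilon> $$ (g, g')" and m = m and v = "\<lambda>\<epsilon> g. v i \<epsilon> $ g" and lam = "ev i"])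
      fix g assume g: "g < n"
      show "\<forall>\<^sub>F \<epsilon> in at_right 0. (\<Sum>g'<n. M \<epsilon> $$ (g, g') * v i \<epsilon> $ g') = ev i \<epsilon> * v i \<epsilon> $ g"
        using eigen_right
      proof eventually_elim
        case (elim \<epsilon>)
        then have e: "?eigen \<epsilon>" "\<epsilon> > 0" and vc: "v i \<epsilon> \<in> carrier_vec n" using i v_carrier by auto
        have "(M \<epsilon> *\<^sub>v v i \<epsilon>) $ g = ev i \<epsilon> * v i \<epsilon> $ g" unfolding v_eigen[OF e i] using vc g by simp
        then show ?case using mult_mat_vec_index[OF M_carrier[OF e(2)] vc g] by simp
      qed
    next
      show "det (mat N N (\<lambda>(g, g'). qr.H_limit g g')) \<noteq> 0"
        unfolding N_def by (rule qr.det_H_limit[OF W_lt_invertible])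
    qed (use M_lim m_low m_high Nn lam_lim v_lim[OF i] in auto)
    then obtain w0 where low: "\<forall>g<N. v i 0 $ g = 0"
      and w0: "\<forall>g<N. (\<Sum>g'<N. qr.H_limit g g' * w0 g') + (\<Sum>g'=N..<n. qr.H_limit g g' * v i 0 $ g') = 0"
        "\<forall>g\<in>{N..<n}. (\<Sum>g'<N. qr.H_limit g g' * w0 g') + (\<Sum>g'=N..<n. qr.H_limit g g' * v i 0 $ g') = \<mu> i * v i 0 $ g"
      by blast
    have e1: "(\<Sum>g'<N. qr.H_limit g g' * w0 g') + (\<Sum>g'=N..<n. qr.H_limit g g' * v i 0 $ g') = 0"
      if "g < N" for g using w0(1) that by blast
    have e2: "(\<Sum>g'<N. qr.H_limit g g' * w0 g') + (\<Sum>g'=N..<n. qr.H_limit g g' * v i 0 $ g') = \<mu> i * v i 0 $ g"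
      if "N \<le> g" "g < n" for g using w0(2) that by simp
    note L = qr.limiting_eigenvector[OF W_lt_invertible H_sym e1[unfolded N_def] e2[unfolded N_def]
        y_def[of i, unfolded N_def]]
    show ?thesis using L low unfolding N_def by blast
  qed

  have SS: "S = qr.S"
  proof (cases "j = 0")
    case True
    have C: "block_row (b j) (H j) j \<in> carrier_mat (b j) 0" using qr.H_row_carrier True by simp
    have A: "inv_mat (block_mat b b H j) \<in> carrier_mat 0 0"
      using invertible_mat_inverse(1)[OF _ qr.H_block_carrier[of j]] qr.invertible_H_block[of j] W_lt_invertible True by simp
    have "block_row (b j) (H j) j * inv_mat (block_mat b b H j) * transpose_mat (block_row (b j) (H j) j) = 0\<^sub>m (b j) (b j)"
      using C A by (intro eq_matI) (auto simp: scalar_prod_def)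
    moreover have "H j j \<in> carrier_mat (b j) (b j)" using qr.H_carrier j by simp
    moreover from this have "H j j - 0\<^sub>m (b j) (b j) = H j j" by (intro eq_matI) auto
    ultimately have "qr.S = H j j" unfolding qr.S_def by simp
    then show ?thesis unfolding S_def schur_complement_def using True by simp
  next
    case False
    then show ?thesis unfolding S_def schur_complement_def qr.S_def by simp
  qed
  let ?X = "Q j * S * transpose_mat (Q j)"
  have Xc: "?X \<in> carrier_mat n n" unfolding SS by (rule qr.Q_S_Q_carrier)
  have X_eig: "?X *\<^sub>v u i 0 = \<mu> i \<cdot>\<^sub>v u i 0" if i: "i < n" for i
    unfolding SS
    by (rule qr.Q_S_Q_eigenvector[where y = "y i"])
      (use limit[OF i] eigen0 i in \<open>auto simp: y_def v_def N_def\<close>)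

  \<comment> \<open>Multiplicities from characteristic polynomials\<close>
  have Gn: "G \<subseteq> {..<n}" and finG: "finite G" unfolding G by auto
  have cardG: "card G \<le> n" using card_mono[OF _ Gn] by simp

  \<comment> \<open>The characteristic polynomial is computed a second time, now from the limiting
    eigenbasis, for comparison with \<open>char_poly_Q_S_Q\<close>.\<close>
  have "char_poly ?X = (\<Prod>i<n. [:- \<mu> i, 1:])"
    by (rule char_poly_orthonormal_eigenbasis[OF Xc orth0 X_eig])
  also have "\<dots> = (\<Prod>i\<in>G. [:- \<mu> i, 1:]) * (\<Prod>i\<in>{..<n} - G. [:- \<mu> i, 1:])"
    by (rule prod.subset_diff[OF Gn, simplified mult.commute]) simp
  also have "(\<Prod>i\<in>G. [:- \<mu> i, 1:]) = (\<Prod>i\<in>G. [:- c i, 1:])"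
    by (intro prod.cong refl) (simp add: G \<mu>_def)
  also have "(\<Prod>i\<in>{..<n} - G. [:- \<mu> i, 1:]) = (\<Prod>i\<in>{..<n} - G. [:0, 1:])"
    by (intro prod.cong refl) (auto simp: G \<mu>_def)
  also have "\<dots> = Polynomial.monom 1 (n - card G)"
    using card_Diff_subset[OF finG Gn] by (simp add: monom_altdef)
  finally have chi: "Polynomial.monom 1 (n - b j) * char_poly S =
      (\<Prod>i\<in>G. [:- c i, 1:]) * Polynomial.monom 1 (n - card G)"
    using qr.char_poly_Q_S_Q unfolding SS by simp
  have bn: "b j \<le> n" using Nn by simp
  \<comment> \<open>Otherwise X would divide the product over \<open>G\<close>, although all its
    roots \<open>c i\<close> are positive.\<close>
  have card_le: "card G \<le> b j"
  proof (rule ccontr)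
    assume "\<not> card G \<le> b j"
    then have gt: "b j < card G" by simp
    have "Polynomial.monom (1::real) (n - b j) = Polynomial.monom 1 (n - card G) * Polynomial.monom 1 (card G - b j)"
      unfolding mult_monom using gt cardG by simp
    then have "Polynomial.monom 1 (n - card G) * (Polynomial.monom 1 (card G - b j) * char_poly S) =
        Polynomial.monom 1 (n - card G) * (\<Prod>i\<in>G. [:- c i, 1:])"
      using chi by (simp add: mult_ac)
    then have "Polynomial.monom 1 (card G - b j) * char_poly S = (\<Prod>i\<in>G. [:- c i, 1:])"
      by (subst (asm) mult_cancel_left) (simp add: monom_eq_0_iff)
    then have "poly (Polynomial.monom 1 (card G - b j) * char_poly S) 0 = poly (\<Prod>i\<in>G. [:- c i, 1:]) 0" by simp
    then have "(\<Prod>i\<in>G. - c i) = 0" using gt by (simp add: poly_monom poly_prod power_0_left)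
    then obtain i where "i \<in> G" "c i = 0" using finG by auto
    then show False using ac(1)[of i] Gn by auto
  qed
  have chi_S: "char_poly S = Polynomial.monom 1 (b j - card G) * (\<Prod>i\<in>G. [:- c i, 1:])"
  proof -
    have "Polynomial.monom (1::real) (n - card G) = Polynomial.monom 1 (n - b j) * Polynomial.monom 1 (b j - card G)"
      unfolding mult_monom using card_le bn by simp
    then have "Polynomial.monom 1 (n - b j) * char_poly S =
        Polynomial.monom 1 (n - b j) * (Polynomial.monom 1 (b j - card G) * (\<Prod>i\<in>G. [:- c i, 1:]))"
      using chi by (simp add: mult_ac)
    then show ?thesis by (subst (asm) mult_cancel_left) (simp add: monom_eq_0_iff)
  qed
  have b_card: "b j = (j + CARD('d) - 1) choose (CARD('d) - 1)"
    using qr.b_eq_h[of j] length_monomial_ordering[OF ordering, of j] unfolding h_def by simp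
  \<comment> \<open>A deficit would leave a positive power of X in the characteristic polynomial of
    \<open>S\<close>, hence a zero eigenvalue, which \<open>S_injective\<close> excludes.\<close>
  have full_block: "card G = b j" if inv: "invertible_mat (block_mat h h W (Suc j))"
  proof (rule ccontr)
    assume "card G \<noteq> b j"
    then have "poly (char_poly S) 0 = 0" using card_le unfolding chi_S by (simp add: poly_monom power_0_left)
    then have "eigenvalue S 0" using eigenvalue_root_char_poly[OF qr.S_carrier] unfolding SS by simp
    then obtain z where z: "z \<in> carrier_vec (b j)" "z \<noteq> 0\<^sub>v (b j)" "S *\<^sub>v z = 0 \<cdot>\<^sub>v z"
      using qr.S_carrier unfolding eigenvalue_def eigenvector_def SS by auto
    have "S *\<^sub>v z = 0\<^sub>v (b j)" using z(1) unfolding z(3) by (intro eq_vecI) auto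
    then show False
      using qr.S_injective[OF W_lt_invertible inv H_sym z(1)] z(2) unfolding SS by simp
  qed
  \<comment> \<open>The coefficient of eps^(2j) in the leading term of \<open>ev i\<close> is
    \<open>\<mu> i\<close>, so the sum is the spectral decomposition of \<open>?X\<close> in the
    limiting eigenbasis.\<close>
  have spectral: "map_mat (\<lambda>q. Polynomial.coeff q (2 * j)) (spectral_equivalent n ev u) = ?X"
  proof (rule eq_matI)
    fix r s assume "r < dim_row ?X" "s < dim_col ?X"
    then have rs: "r < n" "s < n" using Xc by auto
    have "map_mat (\<lambda>q. Polynomial.coeff q (2 * j)) (spectral_equivalent n ev u) $$ (r, s) =
        (\<Sum>i<n. Polynomial.coeff (Polynomial.smult (u i 0 $ r * u i 0 $ s) (lead_term (ev i))) (2 * j))"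
      unfolding spectral_equivalent_def using rs by (simp add: coeff_sum)
    also have "\<dots> = (\<Sum>i<n. \<mu> i * (u i 0 $ r * u i 0 $ s))"
      by (intro sum.cong refl) (auto simp: lt \<mu>_def)
    also have "\<dots> = ?X $$ (r, s)"
      by (rule spectral_decomposition[OF Xc orth0 X_eig rs, symmetric])
    finally show "map_mat (\<lambda>q. Polynomial.coeff q (2 * j)) (spectral_equivalent n ev u) $$ (r, s) = ?X $$ (r, s)" .
  qed (use Xc in \<open>auto simp: spectral_equivalent_def\<close>)
  have eigvec: "eigenvector ?X (u i 0) (Polynomial.lead_coeff (lead_term (ev i)))" if "i \<in> G" for i
  proof -
    have i: "i < n" and mu: "\<mu> i = c i" using that unfolding G \<mu>_def by auto
    have "u i 0 \<bullet> u i 0 = 1" "u i 0 \<in> carrier_vec n" using eigen0 i by auto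
    then have "u i 0 \<noteq> 0\<^sub>v n" by auto
    then show ?thesis
      using X_eig[OF i] eigen0 i Xc unfolding eigenvector_def lc[OF i] mu by auto
  qed

  \<comment> \<open>Explicit forms of the Schur complement and of its lift to the full space\<close>
  have SR: "S = R j j * SW * transpose_mat (R j j)"
    unfolding SS qr.S_def SW_def by (rule qr.schur_complement_H[OF W_lt_invertible])
  have S0: "S = R 0 0 * W 0 0 * transpose_mat (R 0 0)" if "j = 0"
    unfolding S_def schur_complement_def H_def using that by simp
  have Qc: "Q j \<in> carrier_mat n (b j)" by (rule qr.Q_carrier[OF j])
  have Rc: "R j j \<in> carrier_mat (b j) (h j)" using qr.R_carrier j by simp
  have X0: "?X = V 0 * W 0 0 * transpose_mat (V 0)" if "j = 0"
  proof -
    have Q0: "Q 0 \<in> carrier_mat n (b 0)" and R0: "R 0 0 \<in> carrier_mat (b 0) (h 0)"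
      using Qc Rc that by auto
    \<comment> \<open>In the first block column of \<open>R\<close> only \<open>R_{0,0}\<close> is
      nonzero.\<close>
    have V0: "V 0 = Q 0 * R 0 0"
    proof (rule eq_matI)
      fix r s assume "r < dim_row (Q 0 * R 0 0)" "s < dim_col (Q 0 * R 0 0)"
      then have rs: "r < n" "s < h 0" using Q0 R0 by auto
      have "V 0 $$ (r, s) = (\<Sum>i<Suc p. \<Sum>c'<b i. Q i $$ (r, c') * R i 0 $$ (c', s))"
        by (rule qr.V_index[OF _ rs(2,1)]) simp
      also have "\<dots> = (\<Sum>i\<in>{0}. \<Sum>c'<b i. Q i $$ (r, c') * R i 0 $$ (c', s))"
      proof (rule sum.mono_neutral_right)
        show "\<forall>i\<in>{..<Suc p} - {0}. (\<Sum>c'<b i. Q i $$ (r, c') * R i 0 $$ (c', s)) = 0"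
          using qr.R_lower[of _ 0] rs by (auto intro!: sum.neutral)
      qed auto
      also have "\<dots> = (Q 0 * R 0 0) $$ (r, s)"
        using mult_mat_index[OF Q0 R0 rs] by simp
      finally show "V 0 $$ (r, s) = (Q 0 * R 0 0) $$ (r, s)" .
    qed (use Vc[of 0] Q0 R0 in auto)
    have QT0: "transpose_mat (Q 0) \<in> carrier_mat (b 0) n" and RT0: "transpose_mat (R 0 0) \<in> carrier_mat (h 0) (b 0)"
      using Q0 R0 by auto
    have "V 0 * W 0 0 * transpose_mat (V 0) = Q 0 * R 0 0 * W 0 0 * (transpose_mat (R 0 0) * transpose_mat (Q 0))"
      unfolding V0 transpose_mult[OF Q0 R0] ..
    also have "\<dots> = Q 0 * (R 0 0 * W 0 0 * transpose_mat (R 0 0)) * transpose_mat (Q 0)"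
    proof -
      have RW: "R 0 0 * W 0 0 \<in> carrier_mat (b 0) (h 0)" using R0 Wc[of 0 0] by auto
      show ?thesis
        unfolding assoc_mult_mat[OF Q0 R0 Wc[of 0 0]] assoc_mult_mat[OF Q0 RW RT0, symmetric]
        by (rule assoc_mult_mat[OF mult_carrier_mat[OF Q0 RW] RT0 QT0, symmetric])
    qed
    finally show ?thesis using S0[OF that] that by simp
  qed
  have XR: "?X = Q j * transpose_mat (Q j) * V j * SW * transpose_mat (V j) * Q j * transpose_mat (Q j)"
  proof -
    have SWc: "SW \<in> carrier_mat (h j) (h j)"
    proof -
      have "dim_row SW = h j" "dim_col SW = h j"
        unfolding SW_def using block_row_carrier[of j "W j" "h j" h] Wc by auto
      then show ?thesis by auto
    qed
    have QT': "transpose_mat (Q j) \<in> carrier_mat (b j) n" using Qc by simp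
    have RT': "transpose_mat (R j j) \<in> carrier_mat (h j) (b j)" using Rc by simp
    have VT: "transpose_mat (V j) \<in> carrier_mat (h j) n" using Vc[of j] by simp
    \<comment> \<open>The projection Q_j Q_j^T keeps from \<open>V_j\<close> exactly the part
      \<open>Q_j R_{j,j}\<close>.\<close>
    have 1: "Q j * transpose_mat (Q j) * V j = Q j * R j j"
      using assoc_mult_mat[OF Qc QT' Vc[of j]] qr.transpose_Q_V[OF j j] by simp
    have 2: "transpose_mat (V j) * Q j = transpose_mat (R j j)"
      using transpose_mult[OF QT' Vc[of j]] qr.transpose_Q_V[OF j j] by simp
    have QRc: "Q j * R j j * SW \<in> carrier_mat n (h j)" using Qc Rc SWc by auto
    have "Q j * transpose_mat (Q j) * V j * SW * transpose_mat (V j) * Q j * transpose_mat (Q j) =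
        Q j * R j j * SW * transpose_mat (R j j) * transpose_mat (Q j)"
      unfolding 1 using assoc_mult_mat[OF QRc VT Qc] 2 by simp
    also have "Q j * R j j * SW * transpose_mat (R j j) = Q j * S"
      unfolding SR using assoc_mult_mat[OF Qc Rc SWc] assoc_mult_mat[OF Qc mult_carrier_mat[OF Rc SWc] RT'] by simp
    finally show ?thesis by simp
  qed
  have invH: "invertible_mat (block_mat b b H j)"
    using qr.invertible_H_block[of j] W_lt_invertible by simp
  have chi': "char_poly S = Polynomial.monom 1 (b j - card G) *
         (\<Prod>i\<in>G. [:- Polynomial.lead_coeff (lead_term (ev i)), 1:])"
    unfolding chi_S using Gn lc by (intro arg_cong2[of _ _ _ _ "(*)"] refl prod.cong) auto
  show ?thesis
    using b_card full_block invH S0 SR card_le chi' eigvec spectral X0 XR by auto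
qed

end
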